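(* Let $\mathcal{H}$ be a separable Hilbert space, $T>0$, $x_0\in\mathcal{H}$. Let $F\colon[0,T]\times\mathcal{H}\rightrightarrows\mathcal{H}$ have nonempty, closed, convex values and satisfy: (F1) for each $v$, $F(\cdot,v)$ is measurable; (F2) for a.e. $t$, $F(t,\cdot)$ is upper semicontinuous from $\mathcal{H}$ into $\mathcal{H}_w$; (F3) there exist integrable $c,d\colon[0,T]\to\mathbb{R}_+$ with $\inf\{\|w\|\colon w\in F(t,v)\}\le c(t)\|v\|+d(t)$ for all $v$ and a.e. $t$; (F5) there is an integrable $\tilde k\colon[0,T]\to\mathbb{R}$ such that for a.e. $t$ and all $x_1,x_2\in\mathcal{H}$, $\langle v_1-v_2,x_1-x_2\rangle\le\tilde k(t)\|x_1-x_2\|^2$ for all $v_1\in F(t,x_1)$, $v_2\in F(t,x_2)$. Let $g\colon[0,T]\times[0,T]\times\mathcal{H}\to\mathcal{H}$ satisfy: (g1) for each $v$, $(t,s)\mapsto g(t,s,v)$ is measurable; (g2) for every $r>0$ there is an integrable $\mu_r\colon[0,T]\to\mathbb{R}_+$ with $\|g(t,s,x)-g(t,s,y)\|\le\mu_r(t)\|x-y\|$ for all $(t,s)\in D:=\{(t,s)\in[0,T]^2\colon s\le t\}$ and $x,y\in r\mathbb{B}$; (g3) there is a nonnegative integrable $\sigma\colon D\to\mathbb{R}$ with $\|g(t,s,x)\|\le\sigma(t,s)(1+\|x\|)$ for all $(t,s)\in D$, $x\in\mathcal{H}$. Then the problem $$\dot x(t)\in F(t,x(t))+\int_0^tg(t,s,x(s))ds\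 \text{ a.e. } t\in[0,T],\qquad x(0)=x_0,$$ has a unique absolutely continuous solution $x$. Moreover, $\|x(t)\|\le r(t)$ for all $t$ and $\|\dot x(t)\|\le\psi(t)$ for a.e. $t$, where $$e(t_2,t_1):=\exp\left(\int_{t_1}^{t_2}\Big(c(s)+\int_0^s\sigma(s,\tau)d\tau\Big)ds\right),\quad r(t):=\|x_0\|e(t,0)+\int_0^t\Big(d(s)+\int_0^s\sigma(s,\tau)d\tau\Big)e(t,s)ds,$$ $$\psi(t):=c(t)r(t)+d(t)+\int_0^t\sigma(t,s)ds+\int_0^t\sigma(t,s)r(s)ds.$$
   Context: $\mathbb{B}$ is the closed unit ball, $\mathcal{H}_w$ is $\mathcal{H}$ with the weak topology. *)

theory Defs
  imports "HOL-Analysis.Analysis"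
begin

definition weakly_open :: "'a::real_inner set \<Rightarrow> bool" where
  "weakly_open W \<longleftrightarrow>
     (\<forall>x\<in>W. \<exists>Z \<epsilon>. finite Z \<and> \<epsilon> > 0 \<and>
        {y. \<forall>z\<in>Z. \<bar>inner (y - x) z\<bar> < \<epsilon>} \<subseteq> W)"

definition usc_weak :: "('a::real_inner \<Rightarrow> 'a set) \<Rightarrow> bool" where
  "usc_weak \<Phi> \<longleftrightarrow>
     (\<forall>x W. weakly_open W \<and> \<Phi> x \<subseteq> W \<longrightarrow>
        (\<exists>\<delta>>0. \<forall>y. norm (y - x) < \<delta> \<longrightarrow> \<Phi> y \<subseteq> W))"

definition measurable_multifun :: "real set \<Rightarrow> (real \<Rightarrow> 'a::topological_space set) \<Rightarrow> bool" where
  "measurable_multifun S \<Phi> \<longleftrightarrow>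
     (\<forall>U. open U \<longrightarrow> {t\<in>S. \<Phi> t \<inter> U \<noteq> {}} \<in> sets lebesgue)"

definition abs_continuous_on :: "real \<Rightarrow> real \<Rightarrow> (real \<Rightarrow> 'a::real_normed_vector) \<Rightarrow> bool" where
  "abs_continuous_on a b x \<longleftrightarrow>
     (\<forall>\<epsilon>>0. \<exists>\<delta>>0. \<forall>(n::nat) (I :: nat \<Rightarrow> real \<times> real).
        (\<forall>i<n. a \<le> fst (I i) \<and> fst (I i) \<le> snd (I i) \<and> snd (I i) \<le> b) \<and>
        (\<forall>i<n. \<forall>j<n. i \<noteq> j \<longrightarrow>
            {fst (I i)<..<snd (I i)} \<inter> {fst (I j)<..<snd (I j)} = {}) \<and>
        (\<Sum>i<n. snd (I i) - fst (I i)) < \<delta>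
        \<longrightarrow> (\<Sum>i<n. norm (x (snd (I i)) - x (fst (I i)))) < \<epsilon>)"

definition is_solution ::
  "real \<Rightarrow> (real \<Rightarrow> 'a \<Rightarrow> 'a set) \<Rightarrow> (real \<Rightarrow> real \<Rightarrow> 'a \<Rightarrow> 'a) \<Rightarrow> 'a
     \<Rightarrow> (real \<Rightarrow> 'a::{real_inner,complete_space,second_countable_topology}) \<Rightarrow> bool" where
  "is_solution T F g x0 x \<longleftrightarrow>
     abs_continuous_on 0 T x \<and> x 0 = x0 \<and>
     (AE t in lebesgue. t \<in> {0..T} \<longrightarrow>
        (\<exists>v. (x has_vector_derivative v) (at t within {0..T}) \<and>
             v \<in> (\<lambda>w. w + (LINT s:{0..t}|lebesgue. g t s (x s))) ` F t (x t)))"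

definition e_fun :: "(real \<Rightarrow> real) \<Rightarrow> (real \<Rightarrow> real \<Rightarrow> real) \<Rightarrow> real \<Rightarrow> real \<Rightarrow> real" where
  "e_fun c \<sigma> t2 t1 =
     exp (LINT s:{t1..t2}|lebesgue. c s + (LINT \<tau>:{0..s}|lebesgue. \<sigma> s \<tau>))"

definition r_fun :: "(real \<Rightarrow> real) \<Rightarrow> (real \<Rightarrow> real) \<Rightarrow> (real \<Rightarrow> real \<Rightarrow> real) \<Rightarrow> real \<Rightarrow> real \<Rightarrow> real" where
  "r_fun c d \<sigma> n0 t =
     n0 * e_fun c \<sigma> t 0 +
     (LINT s:{0..t}|lebesgue. (d s + (LINT \<tau>:{0..s}|lebesgue. \<sigma> s \<tau>)) * e_fun c \<sigma> t s)"

definition psi_fun :: "(real \<Rightarrow> real) \<Rightarrow> (real \<Rightarrow> real) \<Rightarrow> (real \<Rightarrow> real \<Rightarrow> real) \<Rightarrow> real \<Rightarrow> real \<Rightarrow> real" where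
  "psi_fun c d \<sigma> n0 t =
     c t * r_fun c d \<sigma> n0 t + d t + (LINT s:{0..t}|lebesgue. \<sigma> t s)
     + (LINT s:{0..t}|lebesgue. \<sigma> t s * r_fun c d \<sigma> n0 s)"

end

theory Submission
  imports Defs
begin

text \<open>Euler polygons are built with the selection of minimal norm of \<open>F\<close> and with the state in both
  \<open>F\<close> and the integral frozen at the preceding grid point. Gronwall's inequality bounds them by \<open>r\<close>
  and their velocities by \<open>\<psi>\<close>. The one-sided Lipschitz condition makes \<open>\<parallel>x\<^sub>n - x\<^sub>m\<parallel>\<^sup>2\<close> satisfy a
  Gronwall inequality whose data tend to zero, so the polygons converge uniformly without any
  compactness. The limit \<open>x\<close> inherits the modulus of continuity \<open>\<integral> \<psi>\<close> and is therefore differentiable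
  almost everywhere. Instead of a weak limit of the velocities, one passes to the limit in the
  integrated one-sided Lipschitz inequality tested against a fixed \<open>v\<close>; differentiating it at a common
  Lebesgue point for all \<open>v\<close> in a countable dense set, the inclusion follows from weak upper
  semicontinuity by Minty's argument. Uniqueness is again Gronwall's inequality.\<close>

section \<open>Lebesgue differentiation\<close>

text \<open>Hypothesis \<open>F3\<close> controls only the smallest norm in \<open>F t v\<close>, so
  a growth bound, and with it \<open>r\<close> and \<psi>, is available only along the selection of
  minimal norm. That selection is measurable in \<open>t\<close> but may be discontinuous in
  \<open>v\<close>. Freezing the state on a grid leaves finitely many functions of \<open>t\<close>
  with constant \<open>v\<close>; freezing it in the integral too makes each step explicit. The
  price is the error between polygon and frozen state, uniformly small because all polygons share
  one modulus of continuity. The memory term ties the estimate at \<open>t\<close> to all earlier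
  times; running suprema absorb both memory and delay, so that an ordinary Gronwall inequality
  closes. After testing against a fixed \<open>v\<close>, the values of the selection along the
  polygons, which need not converge, have disappeared from the inequality. Curves are only
  absolutely continuous, so derivatives are handled with gauges: Henstock's lemma yields Lebesgue
  points, and the Henstock-Kurzweil integral recovers increments from derivatives.\<close>

lemma ex_lmeasurable_superset_if_negligible_Diff:
  assumes N: "negligible (B - U)" and U: "U \<in> lmeasurable" "measure lebesgue U \<le> e"
  shows "\<exists>T. B \<subseteq> T \<and> T \<in> lmeasurable \<and> measure lebesgue T \<le> e"
proof (intro exI conjI)
  show "B \<subseteq> U \<union> (B - U)" by blast
  show "U \<union> (B - U) \<in> lmeasurable" by (intro fmeasurable.Un U negligible_imp_measurable N)
  have "B - U \<in> null_sets lebesgue" using N by (simp add: negligible_iff_null_sets)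
  then have "measure lebesgue (U \<union> (B - U)) = measure lebesgue U" by (rule measure_Un_null_set[OF fmeasurableD[OF U(1)]])
  then show "measure lebesgue (U \<union> (B - U)) \<le> e" using U by linarith
qed

text \<open>Henstock's lemma meets Vitali's covering theorem: finitely many disjoint bad intervals
  form a fine tagged partial division, so \<eta> times their total length stays below the total
  Henstock error. The point \<open>x\<close> may lie anywhere in \<open>{u..v}\<close>, in
  particular at an endpoint, as one-sided difference quotients require.\<close>

lemma negligible_not_Lebesgue_point:
  fixes f :: "real \<Rightarrow> real"
  assumes f: "f integrable_on {a..b}" and \<eta>: "\<eta> > 0"
  shows "negligible {x. \<forall>\<delta>>0. \<exists>u v. a \<le> u \<and> u \<le> x \<and> x \<le> v \<and> v \<le> b \<and> u < v \<and> v - u < \<delta> \<and>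
            \<eta> * (v - u) \<le> \<bar>f x * (v - u) - integral {u..v} f\<bar>}" (is "negligible ?B")
proof (subst negligible_outer_le, intro allI impI)
  fix e :: real assume e: "e > 0"
  then have "e * \<eta> > 0" using \<eta> by simp
  have fi: "f integrable_on cbox a b" using f by simp
  \<comment> \<open>The error \<open>e * \<eta>\<close> leaves total length at most \<open>e\<close>
    after division by \<eta>.\<close>
  obtain \<gamma> where g: "gauge \<gamma>" and \<gamma>: "\<And>p. \<lbrakk>p tagged_partial_division_of (cbox a b); \<gamma> fine p\<rbrakk> \<Longrightarrow>
             sum (\<lambda>(x,k). norm(measure lborel k *\<^sub>R f x - integral k f)) p < e * \<eta>"
    by (rule Henstock_lemma[OF fi \<open>e * \<eta> > 0\<close>]) blast
  define K where "K = {(x,u,v). a \<le> u \<and> u \<le> x \<and> x \<le> v \<and> v \<le> b \<and> u < v \<and> {u..v} \<subseteq> \<gamma> x \<and>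
            \<eta> * (v - u) \<le> \<bar>f x * (v - u) - integral {u..v} f\<bar>}"
  define c where "c = (\<lambda>(x::real,u::real,v::real). (u + v)/2)"
  define r where "r = (\<lambda>(x::real,u::real,v::real). (v - u)/2)"
  have cb: "cball (c (x,u,v)) (r (x,u,v)) = {u..v}" for x u v
    unfolding c_def r_def by (auto simp: cball_eq_atLeastAtMost field_simps)
  have r_pos: "0 < r i" if "i \<in> K" for i using that by (auto simp: K_def r_def)
  have "\<exists>i. i \<in> K \<and> x \<in> cball (c i) (r i) \<and> r i < d" if x: "x \<in> ?B" and d: "0 < d" for x d
  proof -
    obtain \<rho> where \<rho>: "\<rho> > 0" "ball x \<rho> \<subseteq> \<gamma> x"
      using g unfolding gauge_def open_contains_ball by blast
    have "min d \<rho> > 0" using d \<rho> by simp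
    then obtain u v where uv: "a \<le> u" "u \<le> x" "x \<le> v" "v \<le> b" "u < v" "v - u < min d \<rho>"
            "\<eta> * (v - u) \<le> \<bar>f x * (v - u) - integral {u..v} f\<bar>"
      using x unfolding mem_Collect_eq by meson
    have "{u..v} \<subseteq> ball x \<rho>" using uv by (auto simp: dist_real_def)
    then have "(x,u,v) \<in> K" using uv \<rho> by (auto simp: K_def)
    moreover have "x \<in> cball (c (x,u,v)) (r (x,u,v))" unfolding cb using uv by auto
    moreover have "r (x,u,v) < d" using uv by (auto simp: r_def)
    ultimately show ?thesis by blast
  qed
  note cover = this
  \<comment> \<open>Vitali: countably many disjoint bad intervals exhaust \<open>?B\<close> up to a
    null set, so only their total length has to be bounded.\<close>
  obtain C where C: "countable C" "C \<subseteq> K"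
     "pairwise (\<lambda>i j. disjnt (cball (c i) (r i)) (cball (c j) (r j))) C"
     "negligible(?B - (\<Union>i \<in> C. cball (c i) (r i)))"
    by (rule Vitali_covering_theorem_cballs[of K r ?B c, OF r_pos cover])
  have bound: "(\<Sum>i\<in>C'. measure lebesgue (cball (c i) (r i))) \<le> e" if C': "C' \<subseteq> C" "finite C'" for C'
  proof -
    let ?h = "\<lambda>(x::real,u::real,v::real). (x,{u..v})"
    have inj: "inj_on ?h C'"
    proof (rule inj_onI)
      fix i j assume ij: "i \<in> C'" "j \<in> C'" "?h i = ?h j"
      obtain x u v where i: "i = (x,u,v)" by (cases i) auto
      obtain y w z where j: "j = (y,w,z)" by (cases j) auto
      have "u < v" using ij(1) i C'(1) C(2) by (auto simp: K_def)
      then show "i = j" using ij i j by auto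
    qed
    have tp: "?h ` C' tagged_partial_division_of (cbox a b)"
      unfolding tagged_partial_division_of_def
    proof (intro conjI allI impI)
      show "finite (?h ` C')" using C' by simp
      fix x L assume "(x,L) \<in> ?h ` C'"
      then obtain u v where uv: "L = {u..v}" "(x,u,v) \<in> C'" by auto
      then have "(x,u,v) \<in> K" using C'(1) C(2) by auto
      then show "x \<in> L" "L \<subseteq> cbox a b" "\<exists>a b. L = cbox a b" using uv by (auto simp: K_def)
    next
      fix x1 K1 x2 K2 assume H: "(x1, K1) \<in> ?h ` C' \<and> (x2, K2) \<in> ?h ` C' \<and> (x1, K1) \<noteq> (x2, K2)"
      then obtain i j where ij: "i \<in> C'" "j \<in> C'" "?h i = (x1,K1)" "?h j = (x2,K2)" unfolding image_iff by metis
      have "K1 = cball (c i) (r i)" using ij(3) cb by (cases i) auto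
      moreover have "K2 = cball (c j) (r j)" using ij(4) cb by (cases j) auto
      moreover have "i \<noteq> j" using H ij by auto
      ultimately have "disjnt K1 K2" using C(3) C'(1) ij unfolding pairwise_def by blast
      then show "interior K1 \<inter> interior K2 = {}"
        using interior_subset[of K1] interior_subset[of K2] unfolding disjnt_def by blast
    qed
    have "\<gamma> fine ?h ` C'" unfolding fine_def using C'(1) C(2) by (auto simp: K_def)
    from \<gamma>[OF tp this] have "(\<Sum>i\<in>C'. case ?h i of (x,k) \<Rightarrow> norm (measure lborel k *\<^sub>R f x - integral k f)) < e * \<eta>"
      unfolding sum.reindex[OF inj] o_def .
    moreover have "(\<Sum>i\<in>C'. case ?h i of (x,k) \<Rightarrow> norm (measure lborel k *\<^sub>R f x - integral k f))
       = (\<Sum>(x,u,v)\<in>C'. \<bar>f x * (v - u) - integral {u..v} f\<bar>)"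
    proof (rule sum.cong[OF refl])
      fix i assume i: "i \<in> C'"
      obtain x u v where iv: "i = (x,u,v)" by (cases i) auto
      have "u < v" using i iv C'(1) C(2) by (auto simp: K_def)
      then show "(case ?h i of (x,k) \<Rightarrow> norm (measure lborel k *\<^sub>R f x - integral k f))
         = (case i of (x,u,v) \<Rightarrow> \<bar>f x * (v - u) - integral {u..v} f\<bar>)"
        unfolding iv by (simp add: mult.commute)
    qed
    ultimately have s: "(\<Sum>(x,u,v)\<in>C'. \<bar>f x * (v - u) - integral {u..v} f\<bar>) < e * \<eta>" by simp
    have "(\<Sum>i\<in>C'. measure lebesgue (cball (c i) (r i))) * \<eta> = (\<Sum>(x,u,v)\<in>C'. \<eta> * (v - u))"
      unfolding sum_distrib_right
    proof (rule sum.cong[OF refl])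
      fix i assume i: "i \<in> C'"
      obtain x u v where iv: "i = (x,u,v)" by (cases i) auto
      have "u < v" using i iv C'(1) C(2) by (auto simp: K_def)
      then show "measure lebesgue (cball (c i) (r i)) * \<eta> = (case i of (x,u,v) \<Rightarrow> \<eta> * (v - u))"
        unfolding iv cb by simp
    qed
    also have "\<dots> \<le> (\<Sum>(x,u,v)\<in>C'. \<bar>f x * (v - u) - integral {u..v} f\<bar>)"
      using C'(1) C(2) by (intro sum_mono) (auto simp: K_def)
    finally have "(\<Sum>i\<in>C'. measure lebesgue (cball (c i) (r i))) * \<eta> < e * \<eta>" using s by linarith
    then show ?thesis using \<eta> by simp
  qed
  let ?U = "\<Union>i \<in> C. cball (c i) (r i)"
  have U: "(\<Union>i\<in>C'. cball (c i) (r i)) \<in> lmeasurable"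
      "measure lebesgue (\<Union>i\<in>C'. cball (c i) (r i)) \<le> e" if "C' \<subseteq> C" "finite C'" for C'
    using order_trans[OF measure_UNION_le[OF that(2)] bound[OF that]] that(2) by auto
  have "?U \<in> lmeasurable" "measure lebesgue ?U \<le> e"
    by (rule fmeasurable_UN_bound measure_UN_bound, rule C(1), simp, rule U(2), assumption+)+
  then show "\<exists>T. ?B \<subseteq> T \<and> T \<in> lmeasurable \<and> measure lebesgue T \<le> e"
    by (rule ex_lmeasurable_superset_if_negligible_Diff[OF C(4)])
qed

section \<open>Integrals over subintervals and differentiation of Bochner integrals\<close>

lemma set_integrable_Icc_subset:
  fixes u :: "real \<Rightarrow> 'b::{banach,second_countable_topology}"
  assumes "set_integrable lebesgue {a..b} u" "a \<le> s" "t \<le> b"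
  shows "set_integrable lebesgue {s..t} u"
  by (rule set_integrable_subset[OF assms(1)]) (use assms in auto)

lemma set_integral_Icc_split:
  fixes u :: "real \<Rightarrow> 'b::{banach,second_countable_topology}"
  assumes u: "set_integrable lebesgue {a..b} u" and "a \<le> s" "s \<le> t" "t \<le> b"
  shows "(LINT \<tau>:{a..t}|lebesgue. u \<tau>) = (LINT \<tau>:{a..s}|lebesgue. u \<tau>) + (LINT \<tau>:{s..t}|lebesgue. u \<tau>)"
proof -
  have "AE x in lebesgue. x \<noteq> s"
    unfolding eventually_ae_filter_negligible by (rule exI[of _ "{s}"]) auto
  then have "AE x in lebesgue. \<not> (x \<in> {a..s} \<and> x \<in> {s..t})" by eventually_elim auto
  from set_integral_Un_AE[OF this, of u]
  have "(LINT \<tau>:{a..s} \<union> {s..t}|lebesgue. u \<tau>) = (LINT \<tau>:{a..s}|lebesgue. u \<tau>) + (LINT \<tau>:{s..t}|lebesgue. u \<tau>)"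
    using set_integrable_Icc_subset[OF u] assms by auto
  moreover have "{a..s} \<union> {s..t} = {a..t}" using assms by auto
  ultimately show ?thesis by simp
qed

lemma set_integral_Icc_const:
  fixes z :: "'b::{banach,second_countable_topology}"
  assumes "s \<le> (t::real)"
  shows "(LINT \<tau>:{s..t}|lebesgue. z) = (t - s) *\<^sub>R z"
  using assms by (simp add: set_lebesgue_integral_def)

lemma set_integrable_Icc_const [simp]:
  fixes z :: "'b::{banach,second_countable_topology}"
  shows "set_integrable lebesgue {s..t::real} (\<lambda>_. z)"
  unfolding set_integrable_def by (rule integrable_scaleR_left) (simp add: integrable_indicator_iff emeasure_lborel_Icc_eq)

text \<open>The scalar result for \<open>norm (u \<tau> - z)\<close>, with \<open>z\<close> in a
  countable dense set, is enough. Outside a countable union of null sets, \<open>z\<close> is taken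
  close to \<open>u t\<close>; the mean of \<open>norm (u \<tau> - z)\<close> over short intervals
  around \<open>t\<close> is then close to the small number \<open>norm (u t - z)\<close>.\<close>

theorem AE_indefinite_integral_has_vector_derivative:
  fixes u :: "real \<Rightarrow> 'b::{banach,second_countable_topology}"
  assumes u: "set_integrable lebesgue {a..b} u"
  shows "AE t in lebesgue. t \<in> {a..b} \<longrightarrow>
     ((\<lambda>s. LINT \<tau>:{a..s}|lebesgue. u \<tau>) has_vector_derivative u t) (at t within {a..b})"
proof -
  obtain Z :: "'b set" where Z: "countable Z" "\<And>U. open U \<Longrightarrow> U \<noteq> {} \<Longrightarrow> \<exists>z\<in>Z. z \<in> U"
    using countable_dense_exists by blast
  define N where "N z \<eta> = {x. \<forall>\<delta>>0. \<exists>p q. a \<le> p \<and> p \<le> x \<and> x \<le> q \<and> q \<le> b \<and> p < q \<and> q - p < \<delta> \<and>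
            \<eta> * (q - p) \<le> \<bar>norm (u x - z) * (q - p) - integral {p..q} (\<lambda>\<tau>. norm (u \<tau> - z))\<bar>}" for z and \<eta> :: real
  have uz: "set_integrable lebesgue {a..b} (\<lambda>\<tau>. norm (u \<tau> - z))" for z
    by (intro set_integrable_norm set_integral_diff u set_integrable_Icc_const)
  have "negligible (N z \<eta>)" if "\<eta> > 0" for z \<eta>
    unfolding N_def by (rule negligible_not_Lebesgue_point[OF set_lebesgue_integral_eq_integral(1)[OF uz] that])
  then have "negligible (\<Union>z\<in>Z. \<Union>n. N z (inverse (real (Suc n))))"
    using Z(1) by (intro negligible_countable_Union) (auto intro!: negligible_countable_Union)
  then have "AE t in lebesgue. \<forall>z\<in>Z. \<forall>n. t \<notin> N z (inverse (real (Suc n)))"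
    unfolding eventually_ae_filter_negligible by (intro exI conjI) auto
  then show ?thesis
  proof eventually_elim
    case (elim t)
    show ?case
    proof
      assume t: "t \<in> {a..b}"
      let ?U = "\<lambda>s. LINT \<tau>:{a..s}|lebesgue. u \<tau>"
      show "(?U has_vector_derivative u t) (at t within {a..b})"
        unfolding has_vector_derivative_def has_derivative_within_alt
      proof (intro conjI allI impI)
        show "bounded_linear (\<lambda>x. x *\<^sub>R u t)" by (rule bounded_linear_scaleR_left)
        fix \<epsilon> :: real assume \<epsilon>: "\<epsilon> > 0"
        then obtain z where z: "z \<in> Z" "norm (u t - z) < \<epsilon>/3"
          using Z(2)[of "ball (u t) (\<epsilon>/3)"] by (auto simp: dist_norm)
        obtain n where n: "inverse (real (Suc n)) < \<epsilon>/3" using \<epsilon> reals_Archimedean[of "\<epsilon>/3"] by auto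
        from elim z(1) have "t \<notin> N z (inverse (real (Suc n)))" by blast
        then have "\<exists>\<delta>>0. \<forall>p q. a \<le> p \<longrightarrow> p \<le> t \<longrightarrow> t \<le> q \<longrightarrow> q \<le> b \<longrightarrow> p < q \<longrightarrow> q - p < \<delta> \<longrightarrow>
           \<bar>norm (u t - z) * (q - p) - integral {p..q} (\<lambda>\<tau>. norm (u \<tau> - z))\<bar> < inverse (real (Suc n)) * (q - p)"
          unfolding N_def mem_Collect_eq by (meson not_le)
        then obtain \<delta> where \<delta>: "\<delta> > 0" "\<And>p q. a \<le> p \<Longrightarrow> p \<le> t \<Longrightarrow> t \<le> q \<Longrightarrow> q \<le> b \<Longrightarrow> p < q \<Longrightarrow> q - p < \<delta> \<Longrightarrow>
           \<bar>norm (u t - z) * (q - p) - integral {p..q} (\<lambda>\<tau>. norm (u \<tau> - z))\<bar> < inverse (real (Suc n)) * (q - p)"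
          by blast
        have key: "norm ((LINT \<tau>:{p..q}|lebesgue. u \<tau>) - (q - p) *\<^sub>R u t) \<le> \<epsilon> * (q - p)"
          if pq: "a \<le> p" "p \<le> t" "t \<le> q" "q \<le> b" "p < q" "q - p < \<delta>" for p q
        proof -
          have up: "set_integrable lebesgue {p..q} u" by (rule set_integrable_Icc_subset[OF u]) (use pq in auto)
          have uzp: "set_integrable lebesgue {p..q} (\<lambda>\<tau>. norm (u \<tau> - z))"
            by (rule set_integrable_Icc_subset[OF uz]) (use pq in auto)
          have "(LINT \<tau>:{p..q}|lebesgue. u \<tau>) - (q - p) *\<^sub>R u t
             = (LINT \<tau>:{p..q}|lebesgue. u \<tau> - z) + (q - p) *\<^sub>R (z - u t)"
            using up pq by (simp add: set_integral_diff set_integral_Icc_const algebra_simps)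
          then have "norm ((LINT \<tau>:{p..q}|lebesgue. u \<tau>) - (q - p) *\<^sub>R u t)
            \<le> norm (LINT \<tau>:{p..q}|lebesgue. u \<tau> - z) + (q - p) * norm (z - u t)"
            using norm_triangle_ineq[of "LINT \<tau>:{p..q}|lebesgue. u \<tau> - z" "(q - p) *\<^sub>R (z - u t)"] pq by simp
          also have "norm (LINT \<tau>:{p..q}|lebesgue. u \<tau> - z) \<le> (LINT \<tau>:{p..q}|lebesgue. norm (u \<tau> - z))"
            by (rule set_integral_norm_bound) (intro set_integral_diff up set_integrable_Icc_const)
          also have "\<dots> = integral {p..q} (\<lambda>\<tau>. norm (u \<tau> - z))"
            by (rule set_lebesgue_integral_eq_integral(2)[OF uzp])
          also have "\<dots> \<le> norm (u t - z) * (q - p) + inverse (real (Suc n)) * (q - p)"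
            using \<delta>(2)[OF pq] by linarith
          also have "\<dots> + (q - p) * norm (z - u t) \<le> (\<epsilon>/3) * (q - p) + (\<epsilon>/3) * (q - p) + (q - p) * (\<epsilon>/3)"
            using z n pq by (intro add_mono mult_right_mono mult_left_mono) (auto simp: norm_minus_commute)
          finally show ?thesis by (simp add: field_simps)
        qed
        show "\<exists>d>0. \<forall>y\<in>{a..b}. norm (y - t) < d \<longrightarrow> norm (?U y - ?U t - (y - t) *\<^sub>R u t) \<le> \<epsilon> * norm (y - t)"
        proof (intro exI[of _ \<delta>] conjI \<delta>(1) ballI impI)
          fix y assume y: "y \<in> {a..b}" "norm (y - t) < \<delta>"
          consider "y = t" | "y > t" | "y < t" by linarith
          then show "norm (?U y - ?U t - (y - t) *\<^sub>R u t) \<le> \<epsilon> * norm (y - t)"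
          proof cases
            case 2
            then show ?thesis using key[of t y] y t set_integral_Icc_split[OF u, of t y] by simp
          next
            case 3
            have "?U y - ?U t - (y - t) *\<^sub>R u t = - ((LINT \<tau>:{y..t}|lebesgue. u \<tau>) - (t - y) *\<^sub>R u t)"
              using set_integral_Icc_split[OF u, of y t] 3 y t by (simp add: algebra_simps)
            then show ?thesis using key[of y t] y t 3 by (simp only: norm_minus_cancel) (simp add: abs_if)
          qed simp
        qed
      qed
    qed
  qed
qed

section \<open>Absolutely continuous functions\<close>

text \<open>Lebesgue measure is complete, and preimages under \<open>f\<close> and \<open>g\<close>
  differ by a null set.\<close>

lemma borel_measurable_lebesgue_AE:
  fixes f g :: "'a::euclidean_space \<Rightarrow> 'b::topological_space"
  assumes f: "f \<in> borel_measurable lebesgue" and ae: "AE x in lebesgue. f x = g x"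
  shows "g \<in> borel_measurable lebesgue"
proof (rule measurableI)
  fix B :: "'b set" assume B: "B \<in> sets borel"
  have "AE x in lebesgue. x \<in> f -` B \<inter> space lebesgue \<longleftrightarrow> x \<in> g -` B \<inter> space lebesgue"
    using ae by eventually_elim auto
  then show "g -` B \<inter> space lebesgue \<in> sets lebesgue"
    by (rule completion.in_sets_AE) (use measurable_sets[OF f B] in auto)
qed simp

lemma set_integral_Ioo_eq_Icc:
  fixes w :: "real \<Rightarrow> 'b::{banach,second_countable_topology}"
  shows "(LINT \<tau>:{l<..<r}|lebesgue. w \<tau>) = (LINT \<tau>:{l..r}|lebesgue. w \<tau>)"
proof -
  have "AE x in lebesgue. x \<noteq> l \<and> x \<noteq> r"
    unfolding eventually_ae_filter_negligible by (rule exI[of _ "{l,r}"]) auto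
  then have ae: "AE x in lebesgue. indicator {l<..<r} x *\<^sub>R w x = indicator {l..r} x *\<^sub>R w x"
    by eventually_elim (auto simp: indicator_def)
  note fin = borel_measurable_lebesgue_AE
  show ?thesis unfolding set_lebesgue_integral_def
  proof (cases "(\<lambda>x. indicator {l<..<r} x *\<^sub>R w x) \<in> borel_measurable lebesgue")
    case True
    from integral_cong_AE[OF True fin[OF True ae] ae]
    show "(LINT x|lebesgue. indicator {l<..<r} x *\<^sub>R w x) = (LINT x|lebesgue. indicator {l..r} x *\<^sub>R w x)" .
  next
    case False
    \<comment> \<open>Without measurability neither integrand is integrable, and both integrals have
      the default value 0.\<close>
    have "AE x in lebesgue. indicator {l..r} x *\<^sub>R w x = indicator {l<..<r} x *\<^sub>R w x"
      using ae by eventually_elim (rule sym)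
    then have 1: "\<not> integrable lebesgue (\<lambda>x. indicator {l..r} x *\<^sub>R w x)"
      using fin[of "\<lambda>x. indicator {l..r} x *\<^sub>R w x" "\<lambda>x. indicator {l<..<r} x *\<^sub>R w x"] False by auto
    have 2: "\<not> integrable lebesgue (\<lambda>x. indicator {l<..<r} x *\<^sub>R w x)" using False by auto
    show "(LINT x|lebesgue. indicator {l<..<r} x *\<^sub>R w x) = (LINT x|lebesgue. indicator {l..r} x *\<^sub>R w x)"
      by (rule trans[OF not_integrable_integral_eq[OF 2] not_integrable_integral_eq[OF 1, symmetric]])
  qed
qed

text \<open>At each point at most one indicator of an open interval is nonzero. Shared endpoints are
  harmless because integrals over open and closed intervals agree.\<close>

lemma sum_set_integral_disjoint_le:
  fixes w :: "real \<Rightarrow> real"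
  assumes A: "finite A" and sub: "\<And>i. i \<in> A \<Longrightarrow> {l i<..<r i} \<subseteq> S"
    and dis: "\<And>i j. i \<in> A \<Longrightarrow> j \<in> A \<Longrightarrow> i \<noteq> j \<Longrightarrow> {l i<..<r i} \<inter> {l j<..<r j} = {}"
    and w: "set_integrable lebesgue S w" and w0: "\<And>x. x \<in> S \<Longrightarrow> w x \<ge> 0"
  shows "(\<Sum>i\<in>A. LINT \<tau>:{l i..r i}|lebesgue. w \<tau>) \<le> (LINT \<tau>:S|lebesgue. w \<tau>)"
proof -
  have wi: "set_integrable lebesgue {l i<..<r i} w" if "i \<in> A" for i
    by (rule set_integrable_subset[OF w _ sub[OF that]]) auto
  have "(\<Sum>i\<in>A. LINT \<tau>:{l i..r i}|lebesgue. w \<tau>) = (\<Sum>i\<in>A. LINT \<tau>:{l i<..<r i}|lebesgue. w \<tau>)"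
    by (simp add: set_integral_Ioo_eq_Icc)
  also have "\<dots> = (LINT \<tau>|lebesgue. (\<Sum>i\<in>A. indicator {l i<..<r i} \<tau> *\<^sub>R w \<tau>))"
    unfolding set_lebesgue_integral_def
    using wi by (subst Bochner_Integration.integral_sum) (auto simp: set_integrable_def)
  also have "\<dots> \<le> (LINT \<tau>|lebesgue. indicator S \<tau> *\<^sub>R w \<tau>)"
  proof (rule integral_mono)
    show "integrable lebesgue (\<lambda>\<tau>. \<Sum>i\<in>A. indicator {l i<..<r i} \<tau> *\<^sub>R w \<tau>)"
      using wi by (auto simp: set_integrable_def)
    show "integrable lebesgue (\<lambda>\<tau>. indicator S \<tau> *\<^sub>R w \<tau>)" using w by (simp add: set_integrable_def)
    fix x
    show "(\<Sum>i\<in>A. indicator {l i<..<r i} x *\<^sub>R w x) \<le> indicator S x *\<^sub>R w x"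
    proof (cases "\<exists>j\<in>A. x \<in> {l j<..<r j}")
      case True
      then obtain j where j: "j \<in> A" "x \<in> {l j<..<r j}" by blast
      have "(\<Sum>i\<in>A. indicator {l i<..<r i} x *\<^sub>R w x) = (\<Sum>i\<in>A. if i = j then w x else 0)"
      proof (rule sum.cong[OF refl])
        fix i assume i: "i \<in> A"
        show "indicator {l i<..<r i} x *\<^sub>R w x = (if i = j then w x else 0)"
          using dis[OF i j(1)] j(2) by (cases "i = j") (auto simp: indicator_def disjoint_iff simp del: Int_greaterThanLessThan)
      qed
      also have "\<dots> = w x" using A j by simp
      finally show ?thesis using sub[OF j(1)] j(2) by auto
    next
      case False
      then have "(\<Sum>i\<in>A. indicator {l i<..<r i} x *\<^sub>R w x) = 0" by (intro sum.neutral) (auto simp: indicator_def)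
      then show ?thesis using w0[of x] by (auto simp: indicator_def)
    qed
  qed
  finally show ?thesis by (simp add: set_lebesgue_integral_def)
qed

text \<open>The definition numbers its intervals by \<open>i < n\<close>, whereas tagged divisions
  are finite sets. A bijection of index sets gives the criterion for families over any finite
  set.\<close>

lemma abs_continuous_onD:
  fixes x :: "real \<Rightarrow> 'a::real_normed_vector"
  assumes "abs_continuous_on a b x" and "\<epsilon> > 0"
  obtains \<delta> where "\<delta> > 0"
    "\<And>(A::'i set) l r. \<lbrakk>finite A; \<And>i. i \<in> A \<Longrightarrow> a \<le> l i \<and> l i \<le> r i \<and> r i \<le> b;
       \<And>i j. i \<in> A \<Longrightarrow> j \<in> A \<Longrightarrow> i \<noteq> j \<Longrightarrow> {l i<..<r i} \<inter> {l j<..<r j} = {};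
       (\<Sum>i\<in>A. r i - l i) < \<delta>\<rbrakk> \<Longrightarrow> (\<Sum>i\<in>A. norm (x (r i) - x (l i))) < \<epsilon>"
proof -
  obtain \<delta> where \<delta>: "\<delta> > 0" and H: "\<forall>(n::nat) (I :: nat \<Rightarrow> real \<times> real).
        (\<forall>i<n. a \<le> fst (I i) \<and> fst (I i) \<le> snd (I i) \<and> snd (I i) \<le> b) \<and>
        (\<forall>i<n. \<forall>j<n. i \<noteq> j \<longrightarrow> {fst (I i)<..<snd (I i)} \<inter> {fst (I j)<..<snd (I j)} = {}) \<and>
        (\<Sum>i<n. snd (I i) - fst (I i)) < \<delta>
        \<longrightarrow> (\<Sum>i<n. norm (x (snd (I i)) - x (fst (I i)))) < \<epsilon>"
    using assms(1)[unfolded abs_continuous_on_def, THEN spec, THEN mp, OF assms(2)] by (elim exE conjE)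
  show thesis
  proof (rule that[OF \<delta>])
    fix A :: "'i set" and l r
    assume A: "finite A" and lr: "\<And>i. i \<in> A \<Longrightarrow> a \<le> l i \<and> l i \<le> r i \<and> r i \<le> b"
      and dis: "\<And>i j. i \<in> A \<Longrightarrow> j \<in> A \<Longrightarrow> i \<noteq> j \<Longrightarrow> {l i<..<r i} \<inter> {l j<..<r j} = {}"
      and s: "(\<Sum>i\<in>A. r i - l i) < \<delta>"
    obtain h where h: "bij_betw h {..<card A} A"
      using ex_bij_betw_nat_finite[OF A] by (auto simp: atLeast0LessThan)
    have hA: "h i \<in> A" if "i < card A" for i using h that by (auto simp: bij_betw_def)
    have hinj: "h i \<noteq> h j" if "i < card A" "j < card A" "i \<noteq> j" for i j
      using h that by (auto simp: bij_betw_def inj_on_def)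
    have re: "(\<Sum>i<card A. f (h i)) = (\<Sum>i\<in>A. f i)" for f :: "'i \<Rightarrow> real"
      by (rule sum.reindex_bij_betw[OF h])
    let ?I = "\<lambda>i. (l (h i), r (h i))"
    have "(\<Sum>i<card A. norm (x (snd (?I i)) - x (fst (?I i)))) < \<epsilon>"
    proof (rule H[THEN spec, THEN spec, THEN mp], intro conjI allI impI)
      fix i j assume ij: "i < card A" "j < card A" "i \<noteq> j"
      show "{fst (?I i)<..<snd (?I i)} \<inter> {fst (?I j)<..<snd (?I j)} = {}"
        unfolding fst_conv snd_conv by (rule dis[OF hA[OF ij(1)] hA[OF ij(2)] hinj[OF ij]])
    next
      show "(\<Sum>i<card A. snd (?I i) - fst (?I i)) < \<delta>"
        unfolding fst_conv snd_conv re[of "\<lambda>i. r i - l i"] by (rule s)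
    qed (use lr hA in \<open>simp_all only: fst_conv snd_conv\<close>)
    then show "(\<Sum>i\<in>A. norm (x (r i) - x (l i))) < \<epsilon>"
      unfolding fst_conv snd_conv re[of "\<lambda>i. norm (x (r i) - x (l i))"] .
  qed
qed

text \<open>One criterion for all closure properties used below: products, differences, exponentials
  and squared norms of absolutely continuous functions satisfy such an increment bound on a bounded
  interval.\<close>

lemma abs_continuous_on_dominated:
  assumes x: "abs_continuous_on a b x" and y: "abs_continuous_on a b y" and C: "C \<ge> 0"
    and dom: "\<And>s t. a \<le> s \<Longrightarrow> s \<le> t \<Longrightarrow> t \<le> b \<Longrightarrow> norm (\<phi> t - \<phi> s) \<le> C * (norm (x t - x s) + norm (y t - y s))"
  shows "abs_continuous_on a b \<phi>"
  unfolding abs_continuous_on_def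
proof (intro allI impI)
  fix \<epsilon> :: real assume \<epsilon>: "\<epsilon> > 0"
  define \<eta> where "\<eta> = \<epsilon> / (2 * (C + 1))"
  have \<eta>: "\<eta> > 0" using \<epsilon> C by (simp add: \<eta>_def)
  obtain \<delta>1 where d1: "\<delta>1 > 0" "\<And>(A::nat set) l r. \<lbrakk>finite A; \<And>i. i \<in> A \<Longrightarrow> a \<le> l i \<and> l i \<le> r i \<and> r i \<le> b;
       \<And>i j. i \<in> A \<Longrightarrow> j \<in> A \<Longrightarrow> i \<noteq> j \<Longrightarrow> {l i<..<r i} \<inter> {l j<..<r j} = {};
       (\<Sum>i\<in>A. r i - l i) < \<delta>1\<rbrakk> \<Longrightarrow> (\<Sum>i\<in>A. norm (x (r i) - x (l i))) < \<eta>"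
    using abs_continuous_onD[OF x \<eta>, where 'i=nat] by blast
  obtain \<delta>2 where d2: "\<delta>2 > 0" "\<And>(A::nat set) l r. \<lbrakk>finite A; \<And>i. i \<in> A \<Longrightarrow> a \<le> l i \<and> l i \<le> r i \<and> r i \<le> b;
       \<And>i j. i \<in> A \<Longrightarrow> j \<in> A \<Longrightarrow> i \<noteq> j \<Longrightarrow> {l i<..<r i} \<inter> {l j<..<r j} = {};
       (\<Sum>i\<in>A. r i - l i) < \<delta>2\<rbrakk> \<Longrightarrow> (\<Sum>i\<in>A. norm (y (r i) - y (l i))) < \<eta>"
    using abs_continuous_onD[OF y \<eta>, where 'i=nat] by blast
  show "\<exists>\<delta>>0. \<forall>(n::nat) (I :: nat \<Rightarrow> real \<times> real).
        (\<forall>i<n. a \<le> fst (I i) \<and> fst (I i) \<le> snd (I i) \<and> snd (I i) \<le> b) \<and>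
        (\<forall>i<n. \<forall>j<n. i \<noteq> j \<longrightarrow> {fst (I i)<..<snd (I i)} \<inter> {fst (I j)<..<snd (I j)} = {}) \<and>
        (\<Sum>i<n. snd (I i) - fst (I i)) < \<delta>
        \<longrightarrow> (\<Sum>i<n. norm (\<phi> (snd (I i)) - \<phi> (fst (I i)))) < \<epsilon>"
  proof (intro exI[of _ "min \<delta>1 \<delta>2"] conjI allI impI)
    show "min \<delta>1 \<delta>2 > 0" using d1 d2 by simp
    fix n and I :: "nat \<Rightarrow> real \<times> real"
    assume H: "(\<forall>i<n. a \<le> fst (I i) \<and> fst (I i) \<le> snd (I i) \<and> snd (I i) \<le> b) \<and>
        (\<forall>i<n. \<forall>j<n. i \<noteq> j \<longrightarrow> {fst (I i)<..<snd (I i)} \<inter> {fst (I j)<..<snd (I j)} = {}) \<and>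
        (\<Sum>i<n. snd (I i) - fst (I i)) < min \<delta>1 \<delta>2"
    let ?l = "\<lambda>i. fst (I i)" and ?r = "\<lambda>i. snd (I i)"
    have sx: "(\<Sum>i<n. norm (x (?r i) - x (?l i))) < \<eta>" by (rule d1(2)) (use H in auto)
    have sy: "(\<Sum>i<n. norm (y (?r i) - y (?l i))) < \<eta>" by (rule d2(2)) (use H in auto)
    have "(\<Sum>i<n. norm (\<phi> (?r i) - \<phi> (?l i))) \<le> (\<Sum>i<n. C * (norm (x (?r i) - x (?l i)) + norm (y (?r i) - y (?l i))))"
      using H by (intro sum_mono dom) auto
    also have "\<dots> = C * ((\<Sum>i<n. norm (x (?r i) - x (?l i))) + (\<Sum>i<n. norm (y (?r i) - y (?l i))))"
      by (simp only: sum.distrib sum_distrib_left[symmetric])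
    also have "\<dots> \<le> C * (\<eta> + \<eta>)" using sx sy C by (intro mult_left_mono) auto
    also have "\<dots> = \<epsilon> * (C / (C + 1))"
    proof -
      have "2 * \<eta> = \<epsilon> / (C + 1)" unfolding \<eta>_def by (subst times_divide_eq_right, subst mult_divide_mult_cancel_left) simp_all
      then show ?thesis by (simp add: mult_2[symmetric] del: mult_2)
    qed
    also have "\<dots> < \<epsilon> * 1" using \<epsilon> C by (intro mult_strict_left_mono) auto
    finally show "(\<Sum>i<n. norm (\<phi> (?r i) - \<phi> (?l i))) < \<epsilon>" by simp
  qed
qed

lemma abs_continuous_on_imp_continuous_on:
  assumes x: "abs_continuous_on a b x"
  shows "continuous_on {a..b} x"
  unfolding continuous_on_iff
proof (intro ballI allI impI)
  fix t \<epsilon> :: real assume t: "t \<in> {a..b}" and \<epsilon>: "\<epsilon> > 0"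
  obtain \<delta> where d: "\<delta> > 0" "\<And>(A::nat set) l r. \<lbrakk>finite A; \<And>i. i \<in> A \<Longrightarrow> a \<le> l i \<and> l i \<le> r i \<and> r i \<le> b;
       \<And>i j. i \<in> A \<Longrightarrow> j \<in> A \<Longrightarrow> i \<noteq> j \<Longrightarrow> {l i<..<r i} \<inter> {l j<..<r j} = {};
       (\<Sum>i\<in>A. r i - l i) < \<delta>\<rbrakk> \<Longrightarrow> (\<Sum>i\<in>A. norm (x (r i) - x (l i))) < \<epsilon>"
    using abs_continuous_onD[OF x \<epsilon>, where 'i=nat] by blast
  show "\<exists>d>0. \<forall>x'\<in>{a..b}. dist x' t < d \<longrightarrow> dist (x x') (x t) < \<epsilon>"
  proof (intro exI[of _ \<delta>] conjI d(1) ballI impI)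
    fix s assume s: "s \<in> {a..b}" "dist s t < \<delta>"
    have "norm (x (max s t) - x (min s t)) < \<epsilon>"
      using d(2)[of "{0}" "\<lambda>_. min s t" "\<lambda>_. max s t"] s t by (auto simp: dist_real_def)
    then show "dist (x s) (x t) < \<epsilon>" by (auto simp: dist_norm max_def min_def norm_minus_commute split: if_splits)
  qed
qed

text \<open>Truncation: the part of \<open>m\<close> above the level \<open>K\<close> has small
  integral, and the part below contributes at most \<open>K\<close> times the total length of the
  intervals.\<close>

lemma abs_continuous_on_if_integral_bound:
  fixes m :: "real \<Rightarrow> real"
  assumes m: "set_integrable lebesgue {a..b} m" and m0: "\<And>t. t \<in> {a..b} \<Longrightarrow> m t \<ge> 0"
    and x: "\<And>s t. a \<le> s \<Longrightarrow> s \<le> t \<Longrightarrow> t \<le> b \<Longrightarrow> norm (x t - x s) \<le> (LINT \<tau>:{s..t}|lebesgue. m \<tau>)"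
  shows "abs_continuous_on a b x"
  unfolding abs_continuous_on_def
proof (intro allI impI)
  fix \<epsilon> :: real assume \<epsilon>: "\<epsilon> > 0"
  define q where "q K t = m t - min (m t) (real K)" for K t
  have mK: "set_integrable lebesgue {a..b} (\<lambda>t. min (m t) (real K))" for K
  proof (rule set_integrable_bound[OF m])
    have "(\<lambda>x. indicator {a..b} x *\<^sub>R m x) \<in> borel_measurable lebesgue"
      using m by (simp add: set_integrable_def)
    then have "(\<lambda>x. min (indicator {a..b} x *\<^sub>R m x) (real K)) \<in> borel_measurable lebesgue" by measurable
    then show "set_borel_measurable lebesgue {a..b} (\<lambda>t. min (m t) (real K))"
      unfolding set_borel_measurable_def by (rule measurable_cong[THEN iffD1, rotated]) (auto simp: indicator_def)
    show "AE t in lebesgue. t \<in> {a..b} \<longrightarrow> norm (min (m t) (real K)) \<le> norm (m t)"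
      using m0 by (intro AE_I2) (auto simp: min_def)
  qed
  then have qi: "set_integrable lebesgue {a..b} (q K)" for K
    unfolding q_def using m by (intro set_integral_diff)
  have "(\<lambda>K. LINT t|lebesgue. indicator {a..b} t *\<^sub>R q K t) \<longlonglongrightarrow> integral\<^sup>L (lebesgue::real measure) (\<lambda>_. 0::real)"
  proof (rule Bochner_Integration.integral_dominated_convergence[of "\<lambda>_. 0" _ "\<lambda>K t. indicator {a..b} t *\<^sub>R q K t" "\<lambda>t. indicator {a..b} t *\<^sub>R m t"])
    show "integrable lebesgue (\<lambda>t. indicator {a..b} t *\<^sub>R m t)" using m by (simp add: set_integrable_def)
    show "(\<lambda>t. indicator {a..b} t *\<^sub>R q K t) \<in> borel_measurable lebesgue" for K
      using qi by (simp add: set_integrable_def)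
    show "AE t in lebesgue. (\<lambda>K. indicator {a..b} t *\<^sub>R q K t) \<longlonglongrightarrow> 0"
    proof (rule AE_I2)
      fix t
      obtain K0 where "m t \<le> real K0" using real_arch_simple by blast
      then have "\<forall>K\<ge>K0. indicator {a..b} t *\<^sub>R q K t = 0" by (auto simp: q_def)
      then show "(\<lambda>K. indicator {a..b} t *\<^sub>R q K t) \<longlonglongrightarrow> 0"
        by (intro tendsto_eventually) (auto simp: eventually_sequentially)
    qed
    show "AE t in lebesgue. norm (indicator {a..b} t *\<^sub>R q K t) \<le> indicator {a..b} t *\<^sub>R m t" for K
      using m0 by (intro AE_I2) (auto simp: indicator_def q_def)
  qed auto
  then have "(\<lambda>K. LINT t:{a..b}|lebesgue. q K t) \<longlonglongrightarrow> 0" by (simp add: set_lebesgue_integral_def)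
  then have "eventually (\<lambda>K. (LINT t:{a..b}|lebesgue. q K t) < \<epsilon>/2) sequentially"
    using \<epsilon> by (intro order_tendstoD) auto
  then obtain K where K: "(LINT t:{a..b}|lebesgue. q K t) < \<epsilon>/2" by (auto simp: eventually_sequentially)
  show "\<exists>\<delta>>0. \<forall>(n::nat) (I :: nat \<Rightarrow> real \<times> real).
        (\<forall>i<n. a \<le> fst (I i) \<and> fst (I i) \<le> snd (I i) \<and> snd (I i) \<le> b) \<and>
        (\<forall>i<n. \<forall>j<n. i \<noteq> j \<longrightarrow> {fst (I i)<..<snd (I i)} \<inter> {fst (I j)<..<snd (I j)} = {}) \<and>
        (\<Sum>i<n. snd (I i) - fst (I i)) < \<delta>
        \<longrightarrow> (\<Sum>i<n. norm (x (snd (I i)) - x (fst (I i)))) < \<epsilon>"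
  proof (intro exI[of _ "\<epsilon> / (2 * (real K + 1))"] conjI allI impI)
    show "\<epsilon> / (2 * (real K + 1)) > 0" using \<epsilon> by (intro divide_pos_pos) auto
    fix n and I :: "nat \<Rightarrow> real \<times> real"
    assume H: "(\<forall>i<n. a \<le> fst (I i) \<and> fst (I i) \<le> snd (I i) \<and> snd (I i) \<le> b) \<and>
        (\<forall>i<n. \<forall>j<n. i \<noteq> j \<longrightarrow> {fst (I i)<..<snd (I i)} \<inter> {fst (I j)<..<snd (I j)} = {}) \<and>
        (\<Sum>i<n. snd (I i) - fst (I i)) < \<epsilon> / (2 * (real K + 1))"
    let ?l = "\<lambda>i. fst (I i)" and ?r = "\<lambda>i. snd (I i)"
    have "(\<Sum>i<n. norm (x (?r i) - x (?l i))) \<le> (\<Sum>i<n. (LINT \<tau>:{?l i..?r i}|lebesgue. q K \<tau>) + real K * (?r i - ?l i))"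
    proof (rule sum_mono)
      fix i assume "i \<in> {..<n}"
      then have i: "a \<le> ?l i" "?l i \<le> ?r i" "?r i \<le> b" using H by auto
      have "norm (x (?r i) - x (?l i)) \<le> (LINT \<tau>:{?l i..?r i}|lebesgue. m \<tau>)" using i by (rule x)
      also have "\<dots> \<le> (LINT \<tau>:{?l i..?r i}|lebesgue. q K \<tau> + real K)"
        using i by (intro set_integral_mono set_integral_add set_integrable_Icc_subset[OF m]
            set_integrable_Icc_subset[OF qi] set_integrable_Icc_const) (auto simp: q_def)
      also have "\<dots> = (LINT \<tau>:{?l i..?r i}|lebesgue. q K \<tau>) + real K * (?r i - ?l i)"
        using i set_integrable_Icc_subset[OF qi] by (subst set_integral_add) (auto simp: set_integral_Icc_const)
      finally show "norm (x (?r i) - x (?l i)) \<le> (LINT \<tau>:{?l i..?r i}|lebesgue. q K \<tau>) + real K * (?r i - ?l i)" .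
    qed
    also have "\<dots> = (\<Sum>i<n. (LINT \<tau>:{?l i..?r i}|lebesgue. q K \<tau>)) + real K * (\<Sum>i<n. ?r i - ?l i)"
      by (simp add: sum.distrib sum_distrib_left)
    also have "(\<Sum>i<n. (LINT \<tau>:{?l i..?r i}|lebesgue. q K \<tau>)) \<le> (LINT \<tau>:{a..b}|lebesgue. q K \<tau>)"
      using H by (intro sum_set_integral_disjoint_le qi) (force simp: q_def)+
    also have "real K * (\<Sum>i<n. ?r i - ?l i) \<le> real K * (\<epsilon> / (2 * (real K + 1)))"
      using H by (intro mult_left_mono) auto
    also have "\<dots> = \<epsilon>/2 * (real K / (real K + 1))" by (simp add: field_simps)
    also have "\<dots> \<le> \<epsilon>/2 * 1" using \<epsilon> by (intro mult_left_mono) auto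
    finally show "(\<Sum>i<n. norm (x (?r i) - x (?l i))) < \<epsilon>" using K by simp
  qed
qed


text \<open>The fundamental theorem of calculus as an inequality. The derivative, set to 0 on the
  exceptional set, is shown directly to have Henstock-Kurzweil integral
  \<open>\<phi> b - \<phi> a\<close>; monotonicity of that integral then gives the comparison with
  \<open>h\<close>, without a detour through Lebesgue integrability of the derivative.\<close>

theorem abs_continuous_on_diff_le_integral:
  fixes \<phi> h :: "real \<Rightarrow> real"
  assumes ab: "a \<le> b" and \<phi>: "abs_continuous_on a b \<phi>" and h: "set_integrable lebesgue {a..b} h"
    and ae: "AE t in lebesgue. t \<in> {a..b} \<longrightarrow> (\<exists>D. (\<phi> has_vector_derivative D) (at t within {a..b}) \<and> D \<le> h t)"
  shows "\<phi> b - \<phi> a \<le> (LINT t:{a..b}|lebesgue. h t)"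
proof -
  obtain N where N: "negligible N" and "\<And>t. t \<notin> N \<Longrightarrow> t \<in> {a..b} \<Longrightarrow>
      \<exists>D. (\<phi> has_vector_derivative D) (at t within {a..b}) \<and> D \<le> h t"
  proof -
    from ae obtain N where N: "negligible N" "{x. \<not> (x \<in> {a..b} \<longrightarrow>
        (\<exists>D. (\<phi> has_vector_derivative D) (at x within {a..b}) \<and> D \<le> h x))} \<subseteq> N"
      unfolding eventually_ae_filter_negligible by (elim exE conjE)
    show thesis by (rule that[OF N(1)]) (use N(2) in blast)
  qed
  then have "\<exists>f0. \<forall>t. t \<notin> N \<longrightarrow> t \<in> {a..b} \<longrightarrow> (\<phi> has_vector_derivative f0 t) (at t within {a..b}) \<and> f0 t \<le> h t"
    by (intro choice) blast
  then obtain f0 where f0: "\<And>t. t \<notin> N \<Longrightarrow> t \<in> {a..b} \<Longrightarrow>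
      (\<phi> has_vector_derivative f0 t) (at t within {a..b}) \<and> f0 t \<le> h t" by blast
  define f where "f t = (if t \<in> N then 0 else f0 t)" for t
  have "(f has_integral (\<phi> b - \<phi> a)) {a..b}"
    unfolding has_integral_real
  proof (intro allI impI)
    fix e :: real assume e: "e > 0"
    then have e2: "e/2 > 0" by simp
    obtain \<delta> where \<delta>: "\<delta> > 0" and small: "\<forall>(A::(real \<times> real set) set) l r. finite A \<longrightarrow>
       (\<forall>i\<in>A. a \<le> l i \<and> l i \<le> r i \<and> r i \<le> b) \<longrightarrow>
       (\<forall>i\<in>A. \<forall>j\<in>A. i \<noteq> j \<longrightarrow> {l i<..<r i} \<inter> {l j<..<r j} = {}) \<longrightarrow>
       (\<Sum>i\<in>A. r i - l i) < \<delta> \<longrightarrow> (\<Sum>i\<in>A. norm (\<phi> (r i) - \<phi> (l i))) < e/2"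
    proof (rule abs_continuous_onD[OF \<phi> e2, where 'i="real \<times> real set"])
      fix \<delta> assume \<delta>: "\<delta> > 0" and *: "\<And>(A::(real \<times> real set) set) l r. \<lbrakk>finite A; \<And>i. i \<in> A \<Longrightarrow> a \<le> l i \<and> l i \<le> r i \<and> r i \<le> b;
       \<And>i j. i \<in> A \<Longrightarrow> j \<in> A \<Longrightarrow> i \<noteq> j \<Longrightarrow> {l i<..<r i} \<inter> {l j<..<r j} = {};
       (\<Sum>i\<in>A. r i - l i) < \<delta>\<rbrakk> \<Longrightarrow> (\<Sum>i\<in>A. norm (\<phi> (r i) - \<phi> (l i))) < e/2"
      show thesis
      proof (rule that[OF \<delta>], intro allI impI)
        fix A :: "(real \<times> real set) set" and l r
        assume A: "finite A" and 1: "\<forall>i\<in>A. a \<le> l i \<and> l i \<le> r i \<and> r i \<le> b"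
          and 2: "\<forall>i\<in>A. \<forall>j\<in>A. i \<noteq> j \<longrightarrow> {l i<..<r i} \<inter> {l j<..<r j} = {}"
          and 3: "(\<Sum>i\<in>A. r i - l i) < \<delta>"
        show "(\<Sum>i\<in>A. norm (\<phi> (r i) - \<phi> (l i))) < e/2"
          by (rule *[OF A bspec[OF 1] bspec[OF bspec[OF 2], THEN mp] 3])
      qed
    qed
    \<comment> \<open>Intervals tagged in \<open>N\<close> will be confined to an open set of
      measure below \<delta>, where absolute continuity bounds the sum of their increments.\<close>
    obtain U where U: "open U" "N \<subseteq> U" "U - N \<in> lmeasurable" "emeasure lebesgue (U - N) < ennreal \<delta>"
      by (rule sets_lebesgue_outer_open[OF negligible_imp_sets[OF N] \<delta>])
    have Ul: "U \<in> lmeasurable"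
      using fmeasurable.Un[OF U(3) negligible_imp_measurable[OF N]] U(2) by (simp add: Un_absorb2)
    have mU: "measure lebesgue U < \<delta>"
    proof -
      have "measure lebesgue (U - N) < \<delta>"
        using U(3,4) \<delta> by (simp add: emeasure_eq_measure2 ennreal_less_iff)
      then show ?thesis
        using measure_Diff_null_set[of U lebesgue N] Ul N by (auto simp: negligible_iff_null_sets)
    qed
    \<comment> \<open>The relative error is spread over the length \<open>b - a\<close>; the summand
      1 admits \<open>a = b\<close>.\<close>
    define \<eta> where "\<eta> = e / (2 * (b - a + 1))"
    have \<eta>: "\<eta> > 0" using e ab by (simp add: \<eta>_def)
    have "\<exists>d>0. \<forall>y\<in>{a..b}. norm (y - t) < d \<longrightarrow> norm (\<phi> y - \<phi> t - (y - t) *\<^sub>R f0 t) \<le> \<eta> * norm (y - t)"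
      if "t \<notin> N" "t \<in> {a..b}" for t
      using f0[OF that] \<eta> unfolding has_vector_derivative_def has_derivative_within_alt by blast
    then have "\<exists>d. \<forall>t. t \<notin> N \<longrightarrow> t \<in> {a..b} \<longrightarrow> d t > 0 \<and>
       (\<forall>y\<in>{a..b}. norm (y - t) < d t \<longrightarrow> norm (\<phi> y - \<phi> t - (y - t) *\<^sub>R f0 t) \<le> \<eta> * norm (y - t))"
      by (intro choice) blast
    then obtain d where d: "\<And>t. t \<notin> N \<Longrightarrow> t \<in> {a..b} \<Longrightarrow> d t > 0"
      "\<And>t y. t \<notin> N \<Longrightarrow> t \<in> {a..b} \<Longrightarrow> y \<in> {a..b} \<Longrightarrow> norm (y - t) < d t \<Longrightarrow> norm (\<phi> y - \<phi> t - (y - t) *\<^sub>R f0 t) \<le> \<eta> * norm (y - t)"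
      by blast
    \<comment> \<open>Tags outside \<open>N\<close> see the difference quotient with error \<eta>,
      tags inside \<open>N\<close> see only \<open>U\<close>. The radius 1 outside
      \<open>{a..b}\<close> is a filler that keeps \<gamma> a gauge.\<close>
    define \<gamma> where "\<gamma> t = (if t \<in> N then U else if t \<in> {a..b} then ball t (d t) else ball t 1)" for t
    show "\<exists>\<gamma>. gauge \<gamma> \<and> (\<forall>\<D>. \<D> tagged_division_of {a..b} \<and> \<gamma> fine \<D> \<longrightarrow>
        norm ((\<Sum>(x, k)\<in>\<D>. measure lborel k *\<^sub>R f x) - (\<phi> b - \<phi> a)) < e)"
    proof (intro exI[of _ \<gamma>] conjI allI impI)
      show "gauge \<gamma>" unfolding gauge_def \<gamma>_def using U d(1) by auto
      fix \<D> assume D': "\<D> tagged_division_of {a..b} \<and> \<gamma> fine \<D>"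
      then have D: "\<D> tagged_division_of {a..b}" and fine: "\<gamma> fine \<D>" by auto
      note DD = tagged_division_ofD[OF D]
      have K: "\<exists>u v. k = {u..v} \<and> u \<le> v \<and> a \<le> u \<and> v \<le> b \<and> x \<in> {u..v}" if xk: "(x,k) \<in> \<D>" for x k
      proof -
        obtain u v where "k = {u..v}" using DD(4)[OF xk] by auto
        then show ?thesis using DD(2,3)[OF xk] by auto
      qed
      have fin: "finite \<D>" by (rule DD(1))
      define D2 where "D2 = {p \<in> \<D>. fst p \<in> N}"
      define D1 where "D1 = \<D> - D2"
      have split: "\<D> = D1 \<union> D2" "D1 \<inter> D2 = {}" "finite D1" "finite D2" using fin by (auto simp: D1_def D2_def)
      let ?c = "\<lambda>(x,k). measure lborel k *\<^sub>R f x - (\<phi> (Sup k) - \<phi> (Inf k))"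
      have "(\<Sum>(x, k)\<in>\<D>. measure lborel k *\<^sub>R f x) - (\<phi> b - \<phi> a) = (\<Sum>p\<in>\<D>. ?c p)"
        unfolding additive_tagged_division_1[OF ab D, of \<phi>, symmetric] sum_subtractf[symmetric]
        by (rule sum.cong) auto
      also have "\<dots> = (\<Sum>p\<in>D1. ?c p) + (\<Sum>p\<in>D2. ?c p)"
        using split by (simp add: sum.union_disjoint)
      finally have eq: "(\<Sum>(x, k)\<in>\<D>. measure lborel k *\<^sub>R f x) - (\<phi> b - \<phi> a) = (\<Sum>p\<in>D1. ?c p) + (\<Sum>p\<in>D2. ?c p)" .
      have "norm (\<Sum>p\<in>D1. ?c p) \<le> (\<Sum>p\<in>D1. \<eta> * measure lborel (snd p))"
      proof (rule sum_norm_le)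
        fix p assume p: "p \<in> D1"
        obtain x k where xk: "p = (x,k)" by (cases p)
        have pD: "(x,k) \<in> \<D>" "x \<notin> N" using p xk by (auto simp: D1_def D2_def)
        obtain u v where uv: "k = {u..v}" "u \<le> v" "a \<le> u" "v \<le> b" "x \<in> {u..v}" using K[OF pD(1)] by blast
        have x: "x \<in> {a..b}" using uv by auto
        have "k \<subseteq> ball x (d x)" using fine pD x unfolding fine_def \<gamma>_def by force
        then have "norm (u - x) < d x" "norm (v - x) < d x" using uv(1,2) by (auto simp: subset_iff dist_norm abs_minus_commute)
        from d(2)[OF pD(2) x _ this(1)] d(2)[OF pD(2) x _ this(2)]
        have "norm (\<phi> u - \<phi> x - (u - x) * f0 x) \<le> \<eta> * (x - u)" "norm (\<phi> v - \<phi> x - (v - x) * f0 x) \<le> \<eta> * (v - x)"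
          using uv by auto
        then have "norm ((v - u) * f0 x - (\<phi> v - \<phi> u)) \<le> \<eta> * (v - u)"
          by (simp add: algebra_simps)
        then show "norm (?c p) \<le> \<eta> * measure lborel (snd p)"
          using uv pD by (simp add: xk f_def)
      qed
      also have "\<dots> \<le> (\<Sum>p\<in>\<D>. \<eta> * measure lborel (snd p))"
        using fin \<eta> by (intro sum_mono2) (auto simp: D1_def)
      also have "\<dots> = \<eta> * (b - a)"
        using additive_content_tagged_division[of \<D> a b] D ab by (simp add: sum_distrib_left[symmetric] case_prod_unfold)
      also have "\<dots> < e/2" using e ab by (simp add: \<eta>_def field_simps)
      finally have 1: "norm (\<Sum>p\<in>D1. ?c p) < e/2" .
      have int: "{Inf (snd p)<..<Sup (snd p)} = interior (snd p) \<and> a \<le> Inf (snd p) \<and> Inf (snd p) \<le> Sup (snd p) \<and> Sup (snd p) \<le> b"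
        if p: "p \<in> \<D>" for p
      proof -
        obtain u v where "snd p = {u..v}" "u \<le> v" "a \<le> u" "v \<le> b" using K[of "fst p" "snd p"] p by auto
        then show ?thesis by simp
      qed
      have dis: "{Inf (snd p)<..<Sup (snd p)} \<inter> {Inf (snd q)<..<Sup (snd q)} = {}" if "p \<in> D2" "q \<in> D2" "p \<noteq> q" for p q
      proof -
        have "p \<in> \<D>" "q \<in> \<D>" using that by (auto simp: D2_def)
        moreover from this have "interior (snd p) \<inter> interior (snd q) = {}"
          by (intro DD(5)[of "fst p" _ "fst q"]) (use that in \<open>simp_all add: prod_eq_iff\<close>)
        ultimately show ?thesis using int by metis
      qed
      have "(\<Sum>p\<in>D2. Sup (snd p) - Inf (snd p)) = (\<Sum>p\<in>D2. LINT \<tau>:{Inf (snd p)..Sup (snd p)}|lebesgue. 1)"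
        using int by (intro sum.cong refl, subst set_integral_Icc_const) (auto simp: D2_def)
      also have "\<dots> \<le> (LINT \<tau>:U|lebesgue. 1)"
      proof (rule sum_set_integral_disjoint_le[OF split(4) _ dis])
        fix p assume p: "p \<in> D2"
        then have "snd p \<subseteq> U" using fine unfolding fine_def \<gamma>_def D2_def by force
        then show "{Inf (snd p)<..<Sup (snd p)} \<subseteq> U" using int[of p] p interior_subset[of "snd p"] by (auto simp: D2_def)
      qed (use Ul in \<open>auto simp: set_integrable_def fmeasurable_def integrable_indicator_iff\<close>)
      also have "\<dots> < \<delta>" using mU by (simp add: set_lebesgue_integral_def)
      finally have len: "(\<Sum>p\<in>D2. Sup (snd p) - Inf (snd p)) < \<delta>" .
      have "(\<Sum>p\<in>D2. norm (\<phi> (Sup (snd p)) - \<phi> (Inf (snd p)))) < e/2"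
      proof (rule small[rule_format, OF split(4) _ dis len])
        show "a \<le> Inf (snd p) \<and> Inf (snd p) \<le> Sup (snd p) \<and> Sup (snd p) \<le> b" if "p \<in> D2" for p
          using int[of p] that by (simp add: D2_def)
      qed
      moreover have "norm (\<Sum>p\<in>D2. ?c p) \<le> (\<Sum>p\<in>D2. norm (\<phi> (Sup (snd p)) - \<phi> (Inf (snd p))))"
        by (rule sum_norm_le) (auto simp: D2_def f_def)
      ultimately have 2: "norm (\<Sum>p\<in>D2. ?c p) < e/2" by linarith
      show "norm ((\<Sum>(x, k)\<in>\<D>. measure lborel k *\<^sub>R f x) - (\<phi> b - \<phi> a)) < e"
        unfolding eq using 1 2 norm_triangle_ineq[of "\<Sum>p\<in>D1. ?c p" "\<Sum>p\<in>D2. ?c p"] by linarith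
    qed
  qed
  moreover have "((\<lambda>t. if t \<in> N then 0 else h t) has_integral (LINT t:{a..b}|lebesgue. h t)) {a..b}"
    by (rule has_integral_spike[OF N _ has_integral_set_lebesgue[OF h]]) auto
  ultimately show ?thesis
    by (rule has_integral_le) (use f0 in \<open>auto simp: f_def\<close>)
qed

section \<open>Gronwall's inequality\<close>

lemma set_integral_lebesgue_singleton [simp]:
  fixes u :: "real \<Rightarrow> 'b::{banach,second_countable_topology}"
  shows "(LINT \<tau>:{a}|lebesgue. u \<tau>) = 0"
  using set_integral_Ioo_eq_Icc[of a a u] by (simp add: set_lebesgue_integral_def)

lemma abs_continuous_on_indefinite_integral:
  fixes u :: "real \<Rightarrow> 'b::{banach,second_countable_topology}"
  assumes u: "set_integrable lebesgue {a..b} u"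
  shows "abs_continuous_on a b (\<lambda>t. z + (LINT \<tau>:{a..t}|lebesgue. u \<tau>))"
proof (rule abs_continuous_on_if_integral_bound)
  show "set_integrable lebesgue {a..b} (\<lambda>t. norm (u t))" by (rule set_integrable_norm[OF u])
  fix s t assume st: "a \<le> s" "s \<le> t" "t \<le> b"
  have "(z + (LINT \<tau>:{a..t}|lebesgue. u \<tau>)) - (z + (LINT \<tau>:{a..s}|lebesgue. u \<tau>)) = (LINT \<tau>:{s..t}|lebesgue. u \<tau>)"
    using set_integral_Icc_split[OF u st] by simp
  then show "norm ((z + (LINT \<tau>:{a..t}|lebesgue. u \<tau>)) - (z + (LINT \<tau>:{a..s}|lebesgue. u \<tau>)))
      \<le> (LINT \<tau>:{s..t}|lebesgue. norm (u \<tau>))"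
    using set_integral_norm_bound[OF set_integrable_Icc_subset[OF u], of s t] st by simp
qed simp

lemma continuous_on_Icc_norm_bound:
  fixes f :: "real \<Rightarrow> 'b::real_normed_vector"
  assumes "continuous_on {a..b} f"
  obtains B where "B \<ge> 0" "\<And>t. t \<in> {a..b} \<Longrightarrow> norm (f t) \<le> B"
proof -
  obtain B where B: "\<forall>x\<in>f ` {a..b}. norm x \<le> B"
    using compact_imp_bounded[OF compact_continuous_image[OF assms compact_Icc]] unfolding bounded_iff by blast
  show thesis
  proof (rule that[of "max B 0"])
    fix t assume "t \<in> {a..b}"
    then show "norm (f t) \<le> max B 0" using B by (simp add: le_max_iff_disj)
  qed simp
qed

lemma set_integrable_mult_continuous:
  fixes h q :: "real \<Rightarrow> real"
  assumes h: "set_integrable lebesgue {a..b} h" and q: "continuous_on {a..b} q"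
  shows "set_integrable lebesgue {a..b} (\<lambda>t. h t * q t)"
proof -
  obtain B where B: "\<And>t. t \<in> {a..b} \<Longrightarrow> \<bar>q t\<bar> \<le> B"
    using continuous_on_Icc_norm_bound[OF q] by auto
  have qm: "(\<lambda>t. indicator {a..b} t *\<^sub>R q t) \<in> borel_measurable lebesgue"
    by (rule measurable_completion) (use borel_measurable_continuous_on_indicator[OF _ q] in simp)
  have hm: "(\<lambda>t. indicator {a..b} t *\<^sub>R h t) \<in> borel_measurable lebesgue"
    using h by (simp add: set_integrable_def)
  show ?thesis
  proof (rule set_integrable_bound[of _ _ "\<lambda>t. B * h t"])
    show "set_integrable lebesgue {a..b} (\<lambda>t. B * h t)" using h by simp
    have "(\<lambda>t. (indicator {a..b} t *\<^sub>R h t) * (indicator {a..b} t *\<^sub>R q t)) \<in> borel_measurable lebesgue"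
      using hm qm by (rule borel_measurable_times)
    then show "set_borel_measurable lebesgue {a..b} (\<lambda>t. h t * q t)"
      unfolding set_borel_measurable_def by (rule measurable_cong[THEN iffD1, rotated]) (auto simp: indicator_def)
    show "AE x in lebesgue. x \<in> {a..b} \<longrightarrow> norm (h x * q x) \<le> norm (B * h x)"
    proof (rule AE_I2, rule impI)
      fix x assume "x \<in> {a..b}"
      then have "\<bar>q x\<bar> \<le> \<bar>B\<bar>" using B by fastforce
      then show "norm (h x * q x) \<le> norm (B * h x)" by (simp add: abs_mult mult.commute[of "\<bar>h x\<bar>"] mult_right_mono)
    qed
  qed
qed

text \<open>Integrating factor: the right-hand side \<rho> of the hypothesis is absolutely
  continuous whatever the regularity of \<open>R\<close>, and its product with
  \<open>E = exp (- A)\<close> has derivative at most \<open>\<beta> * E\<close> almost everywhere.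
  \<open>R\<close> enters only through integrability of \<open>\<alpha> * R\<close>, so running
  suprema qualify.\<close>

theorem gronwall_integral:
  fixes R \<alpha> \<beta> :: "real \<Rightarrow> real"
  assumes \<alpha>: "set_integrable lebesgue {0..t} \<alpha>" and \<alpha>0: "\<And>s. s \<in> {0..t} \<Longrightarrow> \<alpha> s \<ge> 0"
    and \<beta>: "set_integrable lebesgue {0..t} \<beta>"
    and \<alpha>R: "set_integrable lebesgue {0..t} (\<lambda>s. \<alpha> s * R s)" and t: "0 \<le> t"
    and R: "\<And>s. s \<in> {0..t} \<Longrightarrow> R s \<le> a + (LINT \<tau>:{0..s}|lebesgue. \<alpha> \<tau> * R \<tau> + \<beta> \<tau>)"
  shows "R t \<le> a * exp (LINT \<tau>:{0..t}|lebesgue. \<alpha> \<tau>) + (LINT s:{0..t}|lebesgue. \<beta> s * exp (LINT \<tau>:{s..t}|lebesgue. \<alpha> \<tau>))"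
proof -
  define h where "h s = \<alpha> s * R s + \<beta> s" for s
  define \<rho> where "\<rho> s = a + (LINT \<tau>:{0..s}|lebesgue. h \<tau>)" for s
  \<comment> \<open>The summand 0 gives the shape \<open>z + integral\<close> for which absolute
    continuity has been shown.\<close>
  define A where "A s = 0 + (LINT \<tau>:{0..s}|lebesgue. \<alpha> \<tau>)" for s
  define E where "E s = exp (- A s)" for s
  have h: "set_integrable lebesgue {0..t} h" unfolding h_def using \<alpha>R \<beta> by (rule set_integral_add)
  have ac\<rho>: "abs_continuous_on 0 t \<rho>" unfolding \<rho>_def by (rule abs_continuous_on_indefinite_integral[OF h])
  have acA: "abs_continuous_on 0 t A" unfolding A_def by (rule abs_continuous_on_indefinite_integral[OF \<alpha>])
  have Adiff: "A q - A p = (LINT \<tau>:{p..q}|lebesgue. \<alpha> \<tau>)" if "0 \<le> p" "p \<le> q" "q \<le> t" for p q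
    using set_integral_Icc_split[OF \<alpha> that] by (simp add: A_def)
  have Amono: "A p \<le> A q" if "0 \<le> p" "p \<le> q" "q \<le> t" for p q
  proof -
    have "0 \<le> (LINT \<tau>:{p..q}|lebesgue. \<alpha> \<tau>)"
      unfolding set_lebesgue_integral_def using that \<alpha>0 by (intro Bochner_Integration.integral_nonneg) (auto simp: indicator_def)
    then show ?thesis using Adiff[OF that] by simp
  qed
  have A0: "A 0 = 0"
    by (simp add: A_def)
  have Apos: "A p \<ge> 0" if "p \<in> {0..t}" for p using Amono[of 0 p] A0 that by simp
  obtain B where B: "\<And>s. s \<in> {0..t} \<Longrightarrow> \<bar>\<rho> s\<bar> \<le> B"
    using continuous_on_Icc_norm_bound[OF abs_continuous_on_imp_continuous_on[OF ac\<rho>]] by auto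
  \<comment> \<open>The function \<open>exp (- y)\<close> has Lipschitz constant 1 on nonnegative
    \<open>y\<close>, so \<open>E\<close> is absolutely continuous along with
    \<open>A\<close>.\<close>
  have Elip: "\<bar>E q - E p\<bar> \<le> \<bar>A q - A p\<bar>" and E1: "0 < E p" "E p \<le> 1" if "0 \<le> p" "p \<le> q" "q \<le> t" for p q
  proof -
    show E: "0 < E p" "E p \<le> 1" using Apos[of p] that by (auto simp: E_def)
    have "E q = E p * exp (- (A q - A p))" by (simp add: E_def flip: exp_add)
    then have "E p - E q = E p * (1 - exp (- (A q - A p)))" by (simp add: algebra_simps)
    also have "\<dots> \<le> 1 * (A q - A p)"
    proof (rule mult_mono)
      show "1 - exp (- (A q - A p)) \<le> A q - A p" using exp_ge_add_one_self[of "- (A q - A p)"] by linarith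
    qed (use E Amono[OF that] in auto)
    finally have "E p - E q \<le> A q - A p" by simp
    moreover have "E q \<le> E p" using Amono[OF that] by (simp add: E_def)
    ultimately show "\<bar>E q - E p\<bar> \<le> \<bar>A q - A p\<bar>" by linarith
  qed
  have acE: "abs_continuous_on 0 t E"
  proof (rule abs_continuous_on_dominated[OF acA acA, of 1])
    fix p q assume "0 \<le> p" "p \<le> q" "q \<le> t"
    from Elip[OF this] show "norm (E q - E p) \<le> 1 * (norm (A q - A p) + norm (A q - A p))"
      unfolding real_norm_def mult_1 by (rule order_trans) simp
  qed simp
  have ac: "abs_continuous_on 0 t (\<lambda>s. \<rho> s * E s)"
  proof (rule abs_continuous_on_dominated[OF ac\<rho> acE, of "1 + \<bar>B\<bar>"])
    fix p q :: real assume pq: "0 \<le> p" "p \<le> q" "q \<le> t"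
    have "\<rho> q * E q - \<rho> p * E p = E p * (\<rho> q - \<rho> p) + \<rho> q * (E q - E p)" by (simp add: algebra_simps)
    then have "norm (\<rho> q * E q - \<rho> p * E p) \<le> \<bar>E p\<bar> * \<bar>\<rho> q - \<rho> p\<bar> + \<bar>\<rho> q\<bar> * \<bar>E q - E p\<bar>"
      by (metis abs_mult abs_triangle_ineq real_norm_def)
    also have "\<dots> \<le> (1 + \<bar>B\<bar>) * \<bar>\<rho> q - \<rho> p\<bar> + (1 + \<bar>B\<bar>) * \<bar>E q - E p\<bar>"
      using E1[OF pq] B[of q] pq by (intro add_mono mult_right_mono) auto
    finally show "norm (\<rho> q * E q - \<rho> p * E p) \<le> (1 + \<bar>B\<bar>) * (norm (\<rho> q - \<rho> p) + norm (E q - E p))"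
      by (simp add: distrib_left)
  qed simp
  have Ec: "continuous_on {0..t} E" by (rule abs_continuous_on_imp_continuous_on[OF acE])
  have \<beta>E: "set_integrable lebesgue {0..t} (\<lambda>s. \<beta> s * E s)" by (rule set_integrable_mult_continuous[OF \<beta> Ec])
  have "AE s in lebesgue. s \<in> {0..t} \<longrightarrow> (\<exists>D. ((\<lambda>s. \<rho> s * E s) has_vector_derivative D) (at s within {0..t}) \<and> D \<le> \<beta> s * E s)"
    using AE_indefinite_integral_has_vector_derivative[OF h] AE_indefinite_integral_has_vector_derivative[OF \<alpha>]
  proof eventually_elim
    case (elim s)
    show ?case
    proof
      assume s: "s \<in> {0..t}"
      let ?F = "at s within {0..t}"
      have 1: "(\<rho> has_real_derivative h s) ?F"
        unfolding \<rho>_def has_real_derivative_iff_has_vector_derivative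
        using elim(1) s by (auto intro!: derivative_eq_intros)
      have 2: "(A has_real_derivative \<alpha> s) ?F"
        unfolding A_def has_real_derivative_iff_has_vector_derivative
        using elim(2) s by (auto intro!: derivative_eq_intros)
      have 3: "((\<lambda>s. \<rho> s * E s) has_real_derivative (h s * E s - \<rho> s * (\<alpha> s * E s))) ?F"
        unfolding E_def by (auto intro!: derivative_eq_intros 1 2 simp: algebra_simps)
      have "\<alpha> s * R s \<le> \<alpha> s * \<rho> s" using R[OF s] \<alpha>0[OF s] by (intro mult_left_mono) (auto simp: \<rho>_def h_def)
      then have "(\<alpha> s * R s - \<alpha> s * \<rho> s + \<beta> s) * E s \<le> \<beta> s * E s"
        using E1(1)[of s t] s by (intro mult_right_mono) auto
      then have "h s * E s - \<rho> s * (\<alpha> s * E s) \<le> \<beta> s * E s" by (simp add: h_def algebra_simps)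
      then show "\<exists>D. ((\<lambda>s. \<rho> s * E s) has_vector_derivative D) ?F \<and> D \<le> \<beta> s * E s"
        using 3 unfolding has_real_derivative_iff_has_vector_derivative by blast
    qed
  qed
  from abs_continuous_on_diff_le_integral[OF t ac \<beta>E this]
  have "\<rho> t * E t - \<rho> 0 * E 0 \<le> (LINT s:{0..t}|lebesgue. \<beta> s * E s)" .
  moreover have "\<rho> 0 = a" "E 0 = 1"
    using A0 by (auto simp: \<rho>_def E_def)
  ultimately have "\<rho> t * E t \<le> a + (LINT s:{0..t}|lebesgue. \<beta> s * E s)" by simp
  then have "\<rho> t * E t * exp (A t) \<le> (a + (LINT s:{0..t}|lebesgue. \<beta> s * E s)) * exp (A t)"
    by (intro mult_right_mono) auto
  moreover have "\<rho> t * E t * exp (A t) = \<rho> t" by (simp add: E_def exp_minus)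
  ultimately have "\<rho> t \<le> a * exp (A t) + (LINT s:{0..t}|lebesgue. \<beta> s * E s) * exp (A t)"
    by (simp only: distrib_right)
  also have "(LINT s:{0..t}|lebesgue. \<beta> s * E s) * exp (A t) = (LINT s:{0..t}|lebesgue. \<beta> s * E s * exp (A t))"
    by simp
  also have "\<dots> = (LINT s:{0..t}|lebesgue. \<beta> s * exp (LINT \<tau>:{s..t}|lebesgue. \<alpha> \<tau>))"
  proof (rule set_lebesgue_integral_cong)
    show "\<forall>s. s \<in> {0..t} \<longrightarrow> \<beta> s * E s * exp (A t) = \<beta> s * exp (LINT \<tau>:{s..t}|lebesgue. \<alpha> \<tau>)"
    proof (intro allI impI)
      fix s assume "s \<in> {0..t}"
      then have "exp (LINT \<tau>:{s..t}|lebesgue. \<alpha> \<tau>) = E s * exp (A t)"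
        using Adiff[of s t] by (simp add: E_def flip: exp_add)
      then show "\<beta> s * E s * exp (A t) = \<beta> s * exp (LINT \<tau>:{s..t}|lebesgue. \<alpha> \<tau>)" by simp
    qed
  qed simp
  finally show ?thesis using R[of t] t by (simp add: \<rho>_def h_def A_def)
qed

section \<open>Points of minimal norm and measurable selections\<close>

text \<open>The projection of 0 onto \<open>C\<close>. Its norm is the infimum that the growth
  condition on \<open>F\<close> bounds, hence this particular selection.\<close>

definition min_norm_point :: "'a::real_normed_vector set \<Rightarrow> 'a" where
  "min_norm_point C = (SOME p. p \<in> C \<and> norm p = Inf (norm ` C))"

lemma Inf_norm_le: "x \<in> C \<Longrightarrow> Inf (norm ` C) \<le> norm x"
  by (rule cInf_lower) (auto intro: bdd_belowI[of _ 0])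

lemma Inf_norm_nonneg: "C \<noteq> {} \<Longrightarrow> 0 \<le> Inf (norm ` C)"
  by (rule cInf_greatest) auto

text \<open>Parallelogram law: the midpoint of \<open>x\<close> and \<open>y\<close> lies in
  \<open>C\<close>, so \<open>norm (x + y)\<close> is at least twice the infimum. This makes
  minimising sequences Cauchy and, in the measurability proof, nearly minimal elements close to the
  minimiser.\<close>

lemma norm_diff_near_min_norm:
  fixes x y :: "'a::real_inner"
  assumes C: "convex C" and x: "x \<in> C" "norm x \<le> q" and y: "y \<in> C" "norm y \<le> q"
  shows "(norm (x - y))\<^sup>2 \<le> 4 * (q\<^sup>2 - (Inf (norm ` C))\<^sup>2)"
proof -
  let ?m = "Inf (norm ` C)"
  have "(1/2) *\<^sub>R x + (1/2) *\<^sub>R y \<in> C" using C x y by (intro convexD) auto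
  then have "?m \<le> norm ((1/2) *\<^sub>R x + (1/2) *\<^sub>R y)" by (rule Inf_norm_le)
  also have "(1/2) *\<^sub>R x + (1/2) *\<^sub>R y = (1/2) *\<^sub>R (x + y)" by (simp add: scaleR_add_right)
  finally have "2 * ?m \<le> norm (x + y)" by simp
  moreover have "0 \<le> ?m" using x by (intro Inf_norm_nonneg) auto
  ultimately have "(2 * ?m)\<^sup>2 \<le> (norm (x + y))\<^sup>2" by (intro power_mono) auto
  moreover have "(norm (x + y))\<^sup>2 + (norm (x - y))\<^sup>2 = 2 * (norm x)\<^sup>2 + 2 * (norm y)\<^sup>2"
    by (simp add: power2_norm_eq_inner inner_add inner_diff inner_commute)
  moreover have "(norm x)\<^sup>2 \<le> q\<^sup>2" "(norm y)\<^sup>2 \<le> q\<^sup>2" using x y by (auto intro: power_mono)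
  ultimately show ?thesis by (simp add: power_mult_distrib)
qed

lemma exists_near_min_norm:
  fixes C :: "'a::real_inner set"
  assumes "\<epsilon> > 0"
  obtains q where "q > Inf (norm ` C)" "4 * (q\<^sup>2 - (Inf (norm ` C))\<^sup>2) < \<epsilon>\<^sup>2"
proof -
  let ?m = "Inf (norm ` C)"
  have "((\<lambda>q. 4 * (q\<^sup>2 - ?m\<^sup>2)) \<longlongrightarrow> 4 * (?m\<^sup>2 - ?m\<^sup>2)) (at_right ?m)" by (intro tendsto_intros)
  then have "eventually (\<lambda>q. 4 * (q\<^sup>2 - ?m\<^sup>2) < \<epsilon>\<^sup>2) (at_right ?m)"
    using assms by (intro order_tendstoD(2)) auto
  moreover have "eventually (\<lambda>q. q > ?m) (at_right ?m)" by (rule eventually_at_right_less)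
  ultimately have "eventually (\<lambda>q. q > ?m \<and> 4 * (q\<^sup>2 - ?m\<^sup>2) < \<epsilon>\<^sup>2) (at_right ?m)" by eventually_elim simp
  then have "\<exists>q. q > ?m \<and> 4 * (q\<^sup>2 - ?m\<^sup>2) < \<epsilon>\<^sup>2"
    by (rule eventually_happens'[rotated]) simp
  then show thesis using that by blast
qed

lemma min_norm_point:
  fixes C :: "'a::{real_inner,complete_space} set"
  assumes ne: "C \<noteq> {}" and cl: "closed C" and C: "convex C"
  shows "min_norm_point C \<in> C" "norm (min_norm_point C) = Inf (norm ` C)"
proof -
  let ?m = "Inf (norm ` C)"
  have ex: "\<exists>w\<in>C. norm w < q" if "q > ?m" for q
    using cInf_lessD[of "norm ` C" q] ne that by auto
  have "\<exists>w. w \<in> C \<and> norm w < ?m + inverse (real (Suc n))" for n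
    using ex[of "?m + inverse (real (Suc n))"] by auto
  then obtain w where w: "\<And>n. w n \<in> C" "\<And>n. norm (w n) < ?m + inverse (real (Suc n))" by metis
  have "Cauchy w"
  proof (rule metric_CauchyI)
    fix \<epsilon> :: real assume \<epsilon>: "\<epsilon> > 0"
    obtain q where q: "q > ?m" "4 * (q\<^sup>2 - ?m\<^sup>2) < \<epsilon>\<^sup>2" using exists_near_min_norm[OF \<epsilon>] by metis
    obtain N where N: "inverse (real (Suc N)) < q - ?m" using reals_Archimedean[of "q - ?m"] q by auto
    have small: "norm (w n) \<le> q" if "n \<ge> N" for n
    proof -
      have "inverse (real (Suc n)) \<le> inverse (real (Suc N))" using that by (intro le_imp_inverse_le) auto
      then show ?thesis using w(2)[of n] N by linarith
    qed
    have "dist (w m) (w n) < \<epsilon>" if "m \<ge> N" "n \<ge> N" for m n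
    proof -
      have "(norm (w m - w n))\<^sup>2 < \<epsilon>\<^sup>2"
        using norm_diff_near_min_norm[OF C w(1) small[OF that(1)] w(1) small[OF that(2)]] q by linarith
      then show ?thesis using \<epsilon> by (simp add: dist_norm power_less_imp_less_base)
    qed
    then show "\<exists>M. \<forall>m\<ge>M. \<forall>n\<ge>M. dist (w m) (w n) < \<epsilon>" by blast
  qed
  then obtain p where p: "w \<longlonglongrightarrow> p" using Cauchy_convergent convergent_def by blast
  have "p \<in> C" using closed_sequentially[OF cl _ p] w(1) by blast
  moreover have "norm p \<le> ?m"
  proof (rule LIMSEQ_le[OF tendsto_norm[OF p]])
    show "(\<lambda>n. ?m + inverse (real (Suc n))) \<longlonglongrightarrow> ?m" using LIMSEQ_inverse_real_of_nat_add .
    show "\<exists>N. \<forall>n\<ge>N. norm (w n) \<le> ?m + inverse (real (Suc n))" using w(2) by (meson less_imp_le)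
  qed
  ultimately have "\<exists>p. p \<in> C \<and> norm p = ?m" using Inf_norm_le[of p C] by force
  then have "min_norm_point C \<in> C \<and> norm (min_norm_point C) = ?m"
    unfolding min_norm_point_def by (rule someI_ex)
  then show "min_norm_point C \<in> C" "norm (min_norm_point C) = ?m" by auto
qed

text \<open>The variational inequality of the projection: if it failed, a short move from the
  projection towards \<open>q\<close> would decrease the norm.\<close>

lemma min_norm_point_inner:
  fixes C :: "'a::{real_inner,complete_space} set"
  assumes ne: "C \<noteq> {}" and cl: "closed C" and C: "convex C" and q: "q \<in> C"
  shows "(norm (min_norm_point C))\<^sup>2 \<le> inner q (min_norm_point C)"
proof (rule ccontr)
  let ?p = "min_norm_point C"
  note p = min_norm_point[OF ne cl C]
  assume "\<not> ?thesis"
  then have neg: "inner ?p (q - ?p) < 0"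
    by (simp add: inner_diff power2_norm_eq_inner inner_commute)
  define a where "a = - inner ?p (q - ?p)"
  have a: "a > 0" using neg by (simp add: a_def)
  \<comment> \<open>The quadratic in \<open>s\<close> is smallest at
    \<open>a / (norm (q - ?p))\<^sup>2\<close>; adding \<open>a\<close> to the denominator forces
    \<open>s \<le> 1\<close> and still decreases the norm.\<close>
  define b where "b = (norm (q - ?p))\<^sup>2 + a"
  have b: "b > 0" "a \<le> b" using a by (auto simp: b_def add_nonneg_pos)
  define s where "s = a / b"
  have s: "0 < s" "s \<le> 1" using a b by (auto simp: s_def)
  have "?p + s *\<^sub>R (q - ?p) = (1 - s) *\<^sub>R ?p + s *\<^sub>R q" by (simp add: algebra_simps)
  then have "?p + s *\<^sub>R (q - ?p) \<in> C" using convexD[OF C p(1) q, of "1 - s" s] s by simp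
  then have "norm ?p \<le> norm (?p + s *\<^sub>R (q - ?p))" using Inf_norm_le p(2) by metis
  then have "(norm ?p)\<^sup>2 \<le> (norm (?p + s *\<^sub>R (q - ?p)))\<^sup>2" by (intro power_mono) auto
  also have "\<dots> = (norm ?p)\<^sup>2 + 2 * s * inner ?p (q - ?p) + s\<^sup>2 * (norm (q - ?p))\<^sup>2"
    unfolding power2_norm_eq_inner inner_add_left inner_add_right inner_scaleR_left inner_scaleR_right
    by (simp add: inner_commute power2_eq_square algebra_simps)
  finally have "2 * s * a \<le> s\<^sup>2 * (norm (q - ?p))\<^sup>2" by (simp add: a_def)
  also have "\<dots> \<le> s\<^sup>2 * b" using a by (intro mult_left_mono) (auto simp: b_def)
  also have "\<dots> = s * a" using b by (simp add: s_def power2_eq_square)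
  finally show False using s a by simp
qed

text \<open>Here \<open>e\<close> is minus the projection of 0 onto the translate of
  \<open>C\<close> by \<open>- z\<close>, and the gap \<delta> is the squared distance from
  \<open>z\<close> to \<open>C\<close>.\<close>

lemma closed_convex_separation:
  fixes C :: "'a::{real_inner,complete_space} set"
  assumes ne: "C \<noteq> {}" and cl: "closed C" and C: "convex C" and z: "z \<notin> C"
  obtains e \<delta> where "\<delta> > 0" "\<And>w. w \<in> C \<Longrightarrow> inner w e \<le> inner z e - \<delta>"
proof -
  let ?C = "(\<lambda>w. w - z) ` C"
  have *: "?C \<noteq> {}" "closed ?C" "convex ?C"
    using ne cl C closed_translation_subtract[of C z] convex_translation_subtract[of C z] by auto
  let ?p = "min_norm_point ?C"
  have "?p \<noteq> 0" using min_norm_point(1)[OF *] z by auto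
  show thesis
  proof (rule that[of "(norm ?p)\<^sup>2" "- ?p"])
    show "(norm ?p)\<^sup>2 > 0" using \<open>?p \<noteq> 0\<close> by simp
    fix w assume "w \<in> C"
    then have "(norm ?p)\<^sup>2 \<le> inner (w - z) ?p" by (intro min_norm_point_inner[OF *]) auto
    then show "inner w (- ?p) \<le> inner z (- ?p) - (norm ?p)\<^sup>2" by (simp add: inner_diff_left)
  qed
qed

text \<open>In a separable metric space an open set is a countable union of closed balls with
  centres in a dense set and radii \<open>inverse (real (Suc n))\<close>. For the minimal selection,
  closed balls are the accessible preimages.\<close>

lemma borel_measurable_lebesgue_if_cball:
  fixes f :: "real \<Rightarrow> 'a::{metric_space,second_countable_topology}"
  assumes "\<And>z r. r > 0 \<Longrightarrow> {t. f t \<in> cball z r} \<in> sets lebesgue"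
  shows "f \<in> borel_measurable lebesgue"
proof (rule borel_measurableI)
  fix U :: "'a set" assume U: "open U"
  obtain Z :: "'a set" where Z: "countable Z" "\<And>U. open U \<Longrightarrow> U \<noteq> {} \<Longrightarrow> \<exists>z\<in>Z. z \<in> U"
    using countable_dense_exists by blast
  define J where "J = {(z,n). z \<in> Z \<and> cball z (inverse (real (Suc n))) \<subseteq> U}"
  have "countable J" by (rule countable_subset[of _ "Z \<times> UNIV"]) (use Z in \<open>auto simp: J_def\<close>)
  have "f -` U = (\<Union>(z,n)\<in>J. {t. f t \<in> cball z (inverse (real (Suc n)))})"
  proof (intro equalityI subsetI)
    fix t assume "t \<in> f -` U"
    then obtain \<rho> where \<rho>: "\<rho> > 0" "ball (f t) \<rho> \<subseteq> U" using U open_contains_ball by blast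
    obtain n where n: "inverse (real (Suc n)) < \<rho>/2" using reals_Archimedean[of "\<rho>/2"] \<rho> by auto
    obtain z where z: "z \<in> Z" "z \<in> ball (f t) (inverse (real (Suc n)))"
      using Z(2)[of "ball (f t) (inverse (real (Suc n)))"] by auto
    have "cball z (inverse (real (Suc n))) \<subseteq> ball (f t) \<rho>"
    proof
      fix y assume "y \<in> cball z (inverse (real (Suc n)))"
      then show "y \<in> ball (f t) \<rho>" using z(2) n dist_triangle[of "f t" y z] by simp
    qed
    then have "(z,n) \<in> J" using z \<rho> by (auto simp: J_def)
    moreover have "f t \<in> cball z (inverse (real (Suc n)))" using z(2) by (simp add: dist_commute less_imp_le)
    ultimately show "t \<in> (\<Union>(z,n)\<in>J. {t. f t \<in> cball z (inverse (real (Suc n)))})" by blast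
  qed (auto simp: J_def)
  also have "\<dots> \<in> sets lebesgue"
    using \<open>countable J\<close> by (intro sets.countable_UN') (auto intro!: assms[unfolded mem_cball] simp: mem_cball)
  finally show "f -` U \<inter> space lebesgue \<in> sets lebesgue" by simp
qed

text \<open>Membership of the minimal point in \<open>cball z r\<close> is expressed through open
  sets hit by \<open>\<Phi> t\<close>: for all rational \<open>q\<close> and all \<open>n\<close>,
  if \<open>\<Phi> t\<close> meets \<open>ball 0 q\<close>, it also does so inside the ball around
  \<open>z\<close> enlarged by \<open>inverse (real (Suc n))\<close>. Conversely, elements whose
  norm barely exceeds the infimum are close to the minimal point, so a \<open>q\<close> just above
  the infimum locates that point.\<close>

lemma min_norm_point_measurable:
  fixes \<Phi> :: "real \<Rightarrow> 'a::{real_inner,complete_space,second_countable_topology} set"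
  assumes \<Phi>: "measurable_multifun S \<Phi>" and S: "S \<in> sets lebesgue"
    and val: "\<And>t. t \<in> S \<Longrightarrow> \<Phi> t \<noteq> {} \<and> closed (\<Phi> t) \<and> convex (\<Phi> t)"
  shows "(\<lambda>t. indicator S t *\<^sub>R min_norm_point (\<Phi> t)) \<in> borel_measurable lebesgue"
proof (rule borel_measurable_lebesgue_if_cball)
  fix z :: 'a and r :: real assume "r > 0"
  define p where "p t = min_norm_point (\<Phi> t)" for t
  define G where "G U = {t\<in>S. \<Phi> t \<inter> U \<noteq> {}}" for U
  have G: "G U \<in> sets lebesgue" if "open U" for U
    using \<Phi> that by (auto simp: measurable_multifun_def G_def)
  have "{t\<in>S. p t \<in> cball z r} =
     (\<Inter>q\<in>\<rat>. \<Inter>n. (S - G (ball 0 q)) \<union> G (ball 0 q \<inter> ball z (r + inverse (real (Suc n)))))" (is "?L = ?R")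
  proof (intro equalityI subsetI)
    fix t assume t: "t \<in> ?L"
    then have pt: "p t \<in> \<Phi> t" "norm (p t) = Inf (norm ` \<Phi> t)"
      unfolding p_def using min_norm_point[of "\<Phi> t"] val[of t] by auto
    show "t \<in> ?R"
    proof (intro INT_I)
      fix q :: real and n :: nat
      show "t \<in> (S - G (ball 0 q)) \<union> G (ball 0 q \<inter> ball z (r + inverse (real (Suc n))))"
      proof (cases "t \<in> G (ball 0 q)")
        case True
        then obtain w where "w \<in> \<Phi> t" "norm w < q" by (auto simp: G_def)
        then have "norm (p t) < q" using Inf_norm_le[of w "\<Phi> t"] pt by linarith
        moreover have "dist z (p t) < r + inverse (real (Suc n))"
        proof -
          have "0 < inverse (real (Suc n))" "dist z (p t) \<le> r" using t by auto
          then show ?thesis by linarith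
        qed
        ultimately have "p t \<in> \<Phi> t \<inter> (ball 0 q \<inter> ball z (r + inverse (real (Suc n))))" using pt by simp
        then show ?thesis using t unfolding G_def by blast
      qed (use t in auto)
    qed
  next
    fix t assume t: "t \<in> ?R"
    have tS: "t \<in> S" using t Rats_0 by (auto simp: G_def)
    then have pt: "p t \<in> \<Phi> t" "norm (p t) = Inf (norm ` \<Phi> t)"
      unfolding p_def using min_norm_point[of "\<Phi> t"] val[of t] by auto
    have "dist z (p t) \<le> r + \<epsilon>" if \<epsilon>: "\<epsilon> > 0" for \<epsilon>
    proof -
      have "\<epsilon>/2 > 0" using \<epsilon> by simp
      then obtain q0 where q0: "q0 > Inf (norm ` \<Phi> t)" "4 * (q0\<^sup>2 - (Inf (norm ` \<Phi> t))\<^sup>2) < (\<epsilon>/2)\<^sup>2"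
        by (rule exists_near_min_norm)
      obtain q where q: "q \<in> \<rat>" "Inf (norm ` \<Phi> t) < q" "q < q0" using Rats_dense_in_real[OF q0(1)] by blast
      obtain n where n: "inverse (real (Suc n)) < \<epsilon>/2" using reals_Archimedean[of "\<epsilon>/2"] \<epsilon> by auto
      have "t \<in> G (ball 0 q)" using pt q tS by (auto simp: G_def)
      then have "t \<in> G (ball 0 q \<inter> ball z (r + inverse (real (Suc n))))" using t q(1) by blast
      then obtain w where w: "w \<in> \<Phi> t" "norm w < q" "dist z w < r + inverse (real (Suc n))" by (auto simp: G_def)
      have "(norm (w - p t))\<^sup>2 \<le> 4 * (q0\<^sup>2 - (Inf (norm ` \<Phi> t))\<^sup>2)"
        using val[OF tS] w q pt by (intro norm_diff_near_min_norm) auto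
      then have "(norm (w - p t))\<^sup>2 < (\<epsilon>/2)\<^sup>2" using q0 by linarith
      then have "dist w (p t) < \<epsilon>/2" unfolding dist_norm by (rule power_less_imp_less_base) (use \<epsilon> in simp)
      then show ?thesis using w n dist_triangle[of z "p t" w] by linarith
    qed
    then have "dist z (p t) \<le> r" by (rule field_le_epsilon)
    then show "t \<in> ?L" using tS by simp
  qed
  also have "\<dots> \<in> sets lebesgue"
    using S by (intro sets.countable_INT'' sets.countable_INT' countable_rat) (auto intro!: G sets.Un sets.Diff)
  finally have L: "{t\<in>S. p t \<in> cball z r} \<in> sets lebesgue" .
  have "{t. indicator S t *\<^sub>R min_norm_point (\<Phi> t) \<in> cball z r} =
     {t\<in>S. p t \<in> cball z r} \<union> (if 0 \<in> cball z r then - S else {})"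
    by (auto simp: p_def indicator_def)
  then show "{t. indicator S t *\<^sub>R min_norm_point (\<Phi> t) \<in> cball z r} \<in> sets lebesgue"
    using L S by (auto simp: Compl_in_sets_lebesgue intro!: sets.Un)
qed

section \<open>The Radon-Nikodym property of Hilbert spaces\<close>

lemma set_integrable_scaleR_bounded:
  fixes w :: "'c \<Rightarrow> real" and v :: "'c \<Rightarrow> 'b::{banach,second_countable_topology}"
  assumes w: "set_integrable M A w" and v: "v \<in> borel_measurable M"
    and B: "\<And>t. t \<in> A \<Longrightarrow> norm (v t) \<le> B"
  shows "set_integrable M A (\<lambda>t. w t *\<^sub>R v t)"
proof (rule set_integrable_bound[of _ _ "\<lambda>t. B * w t"])
  show "set_integrable M A (\<lambda>t. B * w t)" using w by simp
  have "(\<lambda>t. (indicator A t *\<^sub>R w t) *\<^sub>R v t) \<in> borel_measurable M"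
    by (rule borel_measurable_scaleR[OF borel_measurable_integrable[OF w[unfolded set_integrable_def]] v])
  then show "set_borel_measurable M A (\<lambda>t. w t *\<^sub>R v t)"
    unfolding set_borel_measurable_def by simp
  show "AE x in M. x \<in> A \<longrightarrow> norm (w x *\<^sub>R v x) \<le> norm (B * w x)"
  proof (rule AE_I2, rule impI)
    fix x assume "x \<in> A"
    then have "norm (v x) \<le> \<bar>B\<bar>" using B by fastforce
    then show "norm (w x *\<^sub>R v x) \<le> norm (B * w x)" by (simp add: abs_mult mult.commute[of "\<bar>w x\<bar>"] mult_right_mono)
  qed
qed

text \<open>Step functions on a grid are known only inside the cells; endpoints form a null
  set.\<close>

lemma set_integral_Icc_cong_interior:
  fixes f g :: "real \<Rightarrow> 'b::{banach,second_countable_topology}"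
  assumes "\<And>t. a < t \<Longrightarrow> t < b \<Longrightarrow> f t = g t"
  shows "(LINT t:{a..b}|lebesgue. f t) = (LINT t:{a..b}|lebesgue. g t)"
proof -
  have "(LINT t:{a<..<b}|lebesgue. f t) = (LINT t:{a<..<b}|lebesgue. g t)"
    by (rule set_lebesgue_integral_cong) (use assms in auto)
  then show ?thesis by (simp add: set_integral_Ioo_eq_Icc)
qed

text \<open>The sum of the norms has a finite integral by monotone convergence, hence is finite
  almost everywhere.\<close>

lemma AE_summable_if_integral_norm_le:
  fixes f :: "nat \<Rightarrow> 'c \<Rightarrow> 'b::{banach,second_countable_topology}"
  assumes f: "\<And>k. integrable M (f k)" and le: "\<And>k. (LINT t|M. norm (f k t)) \<le> c k" and c: "summable c"
  shows "AE t in M. summable (\<lambda>k. norm (f k t))"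
proof -
  have fm: "(\<lambda>t. ennreal (norm (f k t))) \<in> borel_measurable M" for k
    using borel_measurable_integrable[OF f] by measurable
  have c0: "c k \<ge> 0" for k using order_trans[OF _ le[of k]] by (simp add: Bochner_Integration.integral_nonneg)
  have "(\<integral>\<^sup>+t. (\<Sum>k. ennreal (norm (f k t))) \<partial>M) = (\<Sum>k. \<integral>\<^sup>+t. ennreal (norm (f k t)) \<partial>M)"
    by (rule nn_integral_suminf[OF fm])
  also have "\<dots> \<le> (\<Sum>k. ennreal (c k))"
  proof (rule suminf_le)
    show "(\<integral>\<^sup>+t. ennreal (norm (f k t)) \<partial>M) \<le> ennreal (c k)" for k
      using nn_integral_eq_integral[OF integrable_norm[OF f]] le[of k] by (simp add: ennreal_leI)
  qed auto
  also have "\<dots> = ennreal (\<Sum>k. c k)" by (rule suminf_ennreal2[OF c0 c])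
  finally have "(\<integral>\<^sup>+t. (\<Sum>k. ennreal (norm (f k t))) \<partial>M) \<noteq> \<infinity>" by (auto simp: top_unique)
  then have "AE t in M. (\<Sum>k. ennreal (norm (f k t))) \<noteq> \<infinity>"
    by (intro nn_integral_PInf_AE) (use fm in measurable)
  then show ?thesis
    by eventually_elim (auto intro!: summable_suminf_not_top)
qed


lemma set_integral_scaleR_const:
  fixes w :: "'c \<Rightarrow> real" and z :: "'b::{banach,second_countable_topology}"
  assumes "set_integrable M A w"
  shows "(LINT t:A|M. w t *\<^sub>R z) = (LINT t:A|M. w t) *\<^sub>R z"
  using integral_scaleR_left[of z M "\<lambda>t. indicator A t *\<^sub>R w t"] assms
  unfolding set_lebesgue_integral_def set_integrable_def scaleR_scaleR real_scaleR_def by blast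

lemma set_integral_inner_right:
  fixes f :: "'c \<Rightarrow> 'b::{real_inner,banach,second_countable_topology}"
  assumes "set_integrable M A f"
  shows "(LINT t:A|M. inner z (f t)) = inner z (LINT t:A|M. f t)"
  using assms integral_inner_right[of z M "\<lambda>t. indicator A t *\<^sub>R f t"]
  by (simp add: set_lebesgue_integral_def set_integrable_def)

text \<open>The slopes of \<open>x\<close> over dyadic intervals, taken
  with respect to the measure \<open>w dt\<close>, form a bounded martingale, whose increments are orthogonal
  in \<open>L\<^sup>2(w dt)\<close>; hence it is Cauchy.\<close>

theorem indefinite_integral_if_integral_bound:
  fixes x :: "real \<Rightarrow> 'b::{real_inner,banach,second_countable_topology}" and m :: "real \<Rightarrow> real"
  assumes T: "T > 0" and m: "set_integrable lebesgue {0..T} m" and m0: "\<And>t. t \<in> {0..T} \<Longrightarrow> m t \<ge> 0"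
    and x: "\<And>s t. 0 \<le> s \<Longrightarrow> s \<le> t \<Longrightarrow> t \<le> T \<Longrightarrow> norm (x t - x s) \<le> (LINT \<tau>:{s..t}|lebesgue. m \<tau>)"
  obtains u where "set_integrable lebesgue {0..T} u"
    "\<And>t. t \<in> {0..T} \<Longrightarrow> x t = x 0 + (LINT \<tau>:{0..t}|lebesgue. u \<tau>)"
proof -
  \<comment> \<open>Adding 1 to \<open>m\<close> gives every nondegenerate cell positive weight, so
    the slopes are defined; since \<open>w \<ge> m\<close> on \<open>{0..T}\<close>, they have norm
    at most 1.\<close>
  define w where "w t = m t + 1" for t
  have w: "set_integrable lebesgue {0..T} w" unfolding w_def using m by (intro set_integral_add) auto
  have w1: "w t \<ge> 1" if "t \<in> {0..T}" for t using m0[OF that] by (simp add: w_def)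
  note wsub = set_integrable_Icc_subset[OF w]
  have xw: "norm (x t - x s) \<le> (LINT \<tau>:{s..t}|lebesgue. w \<tau>)" and w_len: "t - s \<le> (LINT \<tau>:{s..t}|lebesgue. w \<tau>)"
    if st: "0 \<le> s" "s \<le> t" "t \<le> T" for s t
  proof -
    have "(LINT \<tau>:{s..t}|lebesgue. m \<tau>) \<le> (LINT \<tau>:{s..t}|lebesgue. w \<tau>)"
      using st wsub set_integrable_Icc_subset[OF m] by (intro set_integral_mono) (auto simp: w_def)
    then show "norm (x t - x s) \<le> (LINT \<tau>:{s..t}|lebesgue. w \<tau>)" using x[OF st] by linarith
    have "(LINT \<tau>:{s..t}|lebesgue. 1) \<le> (LINT \<tau>:{s..t}|lebesgue. w \<tau>)"
      using st wsub w1 by (intro set_integral_mono) auto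
    then show "t - s \<le> (LINT \<tau>:{s..t}|lebesgue. w \<tau>)" using set_integral_Icc_const[OF st(2), of "1::real"] by simp
  qed
  define \<tau> where "\<tau> n j = T * real j / 2 ^ n" for n j :: nat
  have \<tau>0: "\<tau> n 0 = 0" and \<tau>T: "\<tau> n (2 ^ n) = T" for n by (auto simp: \<tau>_def)
  have \<tau>mono: "\<tau> n i \<le> \<tau> n j" if "i \<le> j" for n i j using that T by (auto simp: \<tau>_def divide_right_mono)
  have \<tau>less: "\<tau> n j < \<tau> n (Suc j)" for n j using T by (auto simp: \<tau>_def divide_strict_right_mono)
  have \<tau>nonneg: "0 \<le> \<tau> n j" for n j using T by (simp add: \<tau>_def)
  have \<tau>leT: "\<tau> n j \<le> T" if "j \<le> 2 ^ n" for n j using \<tau>mono[OF that, of n] \<tau>T by simp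
  have \<tau>refine: "\<tau> n j = \<tau> k (j * 2 ^ (k - n))" if "n \<le> k" for n k j
  proof -
    have "(2::real) ^ k = 2 ^ n * 2 ^ (k - n)" using that by (simp flip: power_add)
    then show ?thesis by (simp add: \<tau>_def)
  qed
  \<comment> \<open>The default 0 covers the index \<open>2 ^ n\<close>, reached at
    \<open>t = T\<close>, and everything beyond, so the bound by 1 holds for every
    \<open>j\<close>.\<close>
  define \<xi> where "\<xi> n j = (if j < 2 ^ n then
      (x (\<tau> n (Suc j)) - x (\<tau> n j)) /\<^sub>R (LINT \<tau>:{\<tau> n j..\<tau> n (Suc j)}|lebesgue. w \<tau>) else 0)" for n j :: nat
  define ix where "ix n t = nat \<lfloor>2 ^ n * t / T\<rfloor>" for n :: nat and t :: real
  define v where "v n t = \<xi> n (ix n t)" for n t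
  have vm: "v n \<in> borel_measurable lebesgue" for n
    unfolding v_def ix_def by (rule measurable_completion) measurable
  have Wpos: "0 < (LINT \<tau>:{\<tau> n j..\<tau> n (Suc j)}|lebesgue. w \<tau>)" if "j < 2 ^ n" for n j
    using w_len[of "\<tau> n j" "\<tau> n (Suc j)"] \<tau>less[of n j] \<tau>nonneg[of n j] \<tau>leT[of "Suc j" n] that by auto
  have \<xi>1: "norm (\<xi> n j) \<le> 1" for n j
    using xw[of "\<tau> n j" "\<tau> n (Suc j)"] \<tau>less[of n j] \<tau>nonneg[of n j] \<tau>leT[of "Suc j" n] Wpos[of j n]
    by (auto simp: \<xi>_def divide_inverse[symmetric] divide_le_eq_1 mult.commute)
  have v1: "norm (v n t) \<le> 1" for n t by (simp add: v_def \<xi>1)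
  have wv: "set_integrable lebesgue {0..T} (\<lambda>t. w t *\<^sub>R v n t)" for n
    by (rule set_integrable_scaleR_bounded[OF w vm v1])
  have ix: "ix n t = j" if "\<tau> n j < t" "t < \<tau> n (Suc j)" for n j t
  proof -
    have "real j < 2 ^ n * t / T" "2 ^ n * t / T < real j + 1"
      using that T by (auto simp: \<tau>_def field_simps)
    then have "\<lfloor>2 ^ n * t / T\<rfloor> = int j" by (simp add: floor_eq_iff)
    then show ?thesis by (simp add: ix_def)
  qed
  have cell: "(LINT t:{\<tau> n j..\<tau> n (Suc j)}|lebesgue. w t *\<^sub>R v n t) = x (\<tau> n (Suc j)) - x (\<tau> n j)" if j: "j < 2 ^ n" for n j
  proof -
    have "(LINT t:{\<tau> n j..\<tau> n (Suc j)}|lebesgue. w t *\<^sub>R v n t) = (LINT t:{\<tau> n j..\<tau> n (Suc j)}|lebesgue. w t *\<^sub>R \<xi> n j)"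
      by (rule set_integral_Icc_cong_interior) (simp add: v_def ix)
    also have "\<dots> = (LINT t:{\<tau> n j..\<tau> n (Suc j)}|lebesgue. w t) *\<^sub>R \<xi> n j"
      using wsub[of "\<tau> n j" "\<tau> n (Suc j)"] \<tau>nonneg[of n j] \<tau>leT[of "Suc j" n] j
      by (simp add: set_integral_scaleR_const)
    also have "\<dots> = x (\<tau> n (Suc j)) - x (\<tau> n j)" using Wpos[OF j] j by (simp add: \<xi>_def)
    finally show ?thesis .
  qed
  have cells: "(LINT t:{\<tau> n i..\<tau> n j}|lebesgue. w t *\<^sub>R v n t) = x (\<tau> n j) - x (\<tau> n i)" if "i \<le> j" "j \<le> 2 ^ n" for n i j
    using that
  proof (induction j rule: dec_induct)
    case base
    show ?case by simp
  next
    case (step j)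
    have "(LINT t:{\<tau> n i..\<tau> n (Suc j)}|lebesgue. w t *\<^sub>R v n t)
       = (LINT t:{\<tau> n i..\<tau> n j}|lebesgue. w t *\<^sub>R v n t) + (LINT t:{\<tau> n j..\<tau> n (Suc j)}|lebesgue. w t *\<^sub>R v n t)"
    proof (rule set_integral_Icc_split)
      show "set_integrable lebesgue {\<tau> n i..T} (\<lambda>t. w t *\<^sub>R v n t)"
        by (rule set_integrable_Icc_subset[OF wv]) (use \<tau>nonneg in auto)
    qed (use step \<tau>mono[of i j n] \<tau>mono[of j "Suc j" n] \<tau>leT in auto)
    then show ?case using step cell[of j n] by simp
  qed
  have int: "set_integrable lebesgue {0..T} (\<lambda>t. w t * inner (v p t) (v q t))" for p q
  proof -
    have "norm (inner (v p t) (v q t)) \<le> 1" for t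
      using order_trans[OF Cauchy_Schwarz_ineq2 mult_le_one[OF v1 norm_ge_zero v1]] by simp
    from set_integrable_scaleR_bounded[OF w borel_measurable_inner[OF vm vm] this] show ?thesis by simp
  qed
  \<comment> \<open>The martingale property: \<open>v n\<close> is constant inside cells of level
    \<open>n\<close>, and over such a cell \<open>w\<close> times \<open>v k\<close> and
    \<open>w\<close> times \<open>v n\<close> have the same integral, the increment of
    \<open>x\<close>.\<close>
  have cross: "(LINT t:{0..T}|lebesgue. w t * inner (v n t) (v k t)) = (LINT t:{0..T}|lebesgue. w t * inner (v n t) (v n t))"
    if nk: "n \<le> k" for n k
  proof -
    have "(LINT t:{0..\<tau> n j}|lebesgue. w t * inner (v n t) (v k t)) = (LINT t:{0..\<tau> n j}|lebesgue. w t * inner (v n t) (v n t))"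
      if "j \<le> 2 ^ n" for j
      using that
    proof (induction j)
      case 0
      show ?case by (simp add: \<tau>0)
    next
      case (Suc j)
      have j: "j < 2 ^ n" using Suc by simp
      have eq: "(LINT t:{\<tau> n j..\<tau> n (Suc j)}|lebesgue. w t * inner (v n t) (v q t)) = inner (\<xi> n j) (x (\<tau> n (Suc j)) - x (\<tau> n j))"
        if q: "n \<le> q" for q
      proof -
        have "(LINT t:{\<tau> n j..\<tau> n (Suc j)}|lebesgue. w t * inner (v n t) (v q t))
            = (LINT t:{\<tau> n j..\<tau> n (Suc j)}|lebesgue. inner (\<xi> n j) (w t *\<^sub>R v q t))"
          by (rule set_integral_Icc_cong_interior) (simp add: v_def ix)
        also have "\<dots> = inner (\<xi> n j) (LINT t:{\<tau> n j..\<tau> n (Suc j)}|lebesgue. w t *\<^sub>R v q t)"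
          by (rule set_integral_inner_right[OF set_integrable_Icc_subset[OF wv]]) (use \<tau>nonneg \<tau>leT[of "Suc j" n] j in auto)
        also have "(LINT t:{\<tau> n j..\<tau> n (Suc j)}|lebesgue. w t *\<^sub>R v q t) = x (\<tau> n (Suc j)) - x (\<tau> n j)"
        proof -
          have "Suc j * 2 ^ (q - n) \<le> 2 ^ n * 2 ^ (q - n)" using j by (intro mult_le_mono1) simp
          also have "\<dots> = (2::nat) ^ q" using q by (simp flip: power_add)
          finally show ?thesis
            using cells[of "j * 2 ^ (q - n)" "Suc j * 2 ^ (q - n)" q] \<tau>refine[OF q] by simp
        qed
        finally show ?thesis .
      qed
      have sp: "(LINT t:{0..\<tau> n (Suc j)}|lebesgue. w t * inner (v n t) (v q t)) =
         (LINT t:{0..\<tau> n j}|lebesgue. w t * inner (v n t) (v q t)) + (LINT t:{\<tau> n j..\<tau> n (Suc j)}|lebesgue. w t * inner (v n t) (v q t))" for q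
        by (rule set_integral_Icc_split[OF int]) (use \<tau>nonneg \<tau>leT[of "Suc j" n] j \<tau>mono[of j "Suc j" n] in auto)
      show ?case unfolding sp using Suc eq[OF nk] eq[of n] by simp
    qed
    from this[of "2 ^ n"] show ?thesis by (simp add: \<tau>T)
  qed
  define e where "e n = (LINT t:{0..T}|lebesgue. w t * inner (v n t) (v n t))" for n
  \<comment> \<open>Orthogonality of increments. As \<open>e\<close> is nondecreasing and bounded by
    the total weight, \<open>v n\<close> is Cauchy in the weighted square norm.\<close>
  have D: "(LINT t:{0..T}|lebesgue. w t * (norm (v k t - v n t))\<^sup>2) = e k - e n" if "n \<le> k" for n k
  proof -
    have "(LINT t:{0..T}|lebesgue. w t * (norm (v k t - v n t))\<^sup>2) =
      (LINT t:{0..T}|lebesgue. w t * inner (v k t) (v k t) + w t * inner (v n t) (v n t) - 2 * (w t * inner (v n t) (v k t)))"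
      by (intro set_lebesgue_integral_cong) (auto simp: power2_norm_eq_inner inner_diff inner_commute algebra_simps)
    also have "\<dots> = e k + e n - 2 * (LINT t:{0..T}|lebesgue. w t * inner (v n t) (v k t))"
      using int by (simp add: set_integral_diff set_integral_add e_def)
    finally show ?thesis using cross[OF that] by (simp add: e_def)
  qed
  have norm_int: "set_integrable lebesgue {0..T} (\<lambda>t. w t * (norm (v k t - v n t))\<^sup>2)" for k n
  proof -
    have "set_integrable lebesgue {0..T} (\<lambda>t. w t * inner (v k t) (v k t) + w t * inner (v n t) (v n t) - 2 * (w t * inner (v n t) (v k t)))"
      using int by (intro set_integral_diff set_integral_add) auto
    then show ?thesis by (simp add: power2_norm_eq_inner inner_diff inner_commute algebra_simps)
  qed
  have emono: "e n \<le> e k" if "n \<le> k" for n k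
  proof -
    have "0 \<le> (LINT t:{0..T}|lebesgue. w t * (norm (v k t - v n t))\<^sup>2)"
      unfolding set_lebesgue_integral_def
    proof (rule Bochner_Integration.integral_nonneg)
      fix t show "0 \<le> indicator {0..T} t *\<^sub>R (w t * (norm (v k t - v n t))\<^sup>2)"
        using w1[of t] by (auto simp: indicator_def)
    qed
    then show ?thesis using D[OF that] by simp
  qed
  define Wt where "Wt = (LINT t:{0..T}|lebesgue. w t)"
  have Wt0: "Wt \<ge> 0" using w_len[of 0 T] T by (simp add: Wt_def)
  have eW: "e n \<le> Wt" for n
    unfolding e_def Wt_def
  proof (rule set_integral_mono[OF int w])
    fix t assume "t \<in> {0..T}"
    moreover have "inner (v n t) (v n t) \<le> 1" using v1[of n t] by (simp add: power2_norm_eq_inner[symmetric] power_le_one)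
    ultimately show "w t * inner (v n t) (v n t) \<le> w t" using w1[of t] mult_left_le[of "inner (v n t) (v n t)" "w t"] by simp
  qed
  obtain L where L: "e \<longlonglongrightarrow> L" "\<And>n. e n \<le> L"
    using incseq_convergent[of e Wt] emono eW by (auto simp: incseq_def)
  have "\<exists>N0. \<forall>p\<ge>N0. L - e p \<le> (1/4) ^ k" for k
  proof -
    have "eventually (\<lambda>p. e p > L - (1/4) ^ k) sequentially" by (rule order_tendstoD(1)[OF L(1)]) simp
    then obtain N0 where "\<forall>p\<ge>N0. e p > L - (1/4) ^ k" by (auto simp: eventually_sequentially)
    then have "\<forall>p\<ge>N0. L - e p \<le> (1/4) ^ k" by (auto simp: algebra_simps less_imp_le)
    then show ?thesis by blast
  qed
  then obtain N0 where N0: "\<And>k p. p \<ge> N0 k \<Longrightarrow> L - e p \<le> (1/4) ^ k" by metis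
  \<comment> \<open>Summing successors gives a strictly increasing sequence that dominates
    \<open>N0\<close>.\<close>
  define N where "N k = (\<Sum>i\<le>k. Suc (N0 i))" for k
  have Nge: "N0 k \<le> N k" for k
  proof -
    have "Suc (N0 k) \<le> N k" unfolding N_def by (rule member_le_sum) auto
    then show ?thesis by simp
  qed
  have Nmono: "strict_mono N" by (simp add: strict_mono_Suc_iff N_def)
  have DN: "(LINT t:{0..T}|lebesgue. w t * (norm (v (N (Suc k)) t - v (N k) t))\<^sup>2) \<le> (1/4) ^ k" for k
  proof -
    have "N k \<le> N (Suc k)" using Nmono by (simp add: strict_mono_less_eq)
    from D[OF this] show ?thesis using L(2)[of "N (Suc k)"] N0[OF Nge[of k]] by simp
  qed
  define f where "f k t = indicator {0..T} t *\<^sub>R (w t *\<^sub>R (v (N (Suc k)) t - v (N k) t))" for k t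
  have f_int: "integrable lebesgue (f k)" for k
  proof -
    have "set_integrable lebesgue {0..T} (\<lambda>t. w t *\<^sub>R v (N (Suc k)) t - w t *\<^sub>R v (N k) t)"
      by (intro set_integral_diff wv)
    then show ?thesis by (simp add: set_integrable_def f_def[abs_def] scaleR_diff_right)
  qed
  have f_le: "(LINT t|lebesgue. norm (f k t)) \<le> (1/2) ^ k * (Wt + 1)" for k
  proof -
    let ?n = "\<lambda>t. norm (v (N (Suc k)) t - v (N k) t)"
    have "(LINT t|lebesgue. norm (f k t)) \<le> (LINT t:{0..T}|lebesgue. (1/2) ^ k * w t + 2 ^ k * (w t * (?n t)\<^sup>2))"
      unfolding set_lebesgue_integral_def
    proof (rule integral_mono)
      show "integrable lebesgue (\<lambda>t. norm (f k t))" using f_int by simp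
      have "set_integrable lebesgue {0..T} (\<lambda>t. (1/2) ^ k * w t + 2 ^ k * (w t * (?n t)\<^sup>2))"
        using w norm_int by (intro set_integral_add) auto
      then show "integrable lebesgue (\<lambda>t. indicator {0..T} t *\<^sub>R ((1/2) ^ k * w t + 2 ^ k * (w t * (?n t)\<^sup>2)))"
        by (simp add: set_integrable_def)
      fix t
      \<comment> \<open>Completing the square. The weights \<open>(1/2) ^ k\<close> and
        \<open>2 ^ k\<close> turn the bound \<open>(1/4) ^ k\<close> for squares into the summable
        bound \<open>(1/2) ^ k * (Wt + 1)\<close> for first powers.\<close>
      have amgm: "a \<le> (1/2) ^ k + 2 ^ k * a\<^sup>2" for a :: real
      proof -
        have "0 \<le> (2 ^ k * a - 1/2)\<^sup>2 + 3/4" by simp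
        then have "0 \<le> (1/2) ^ k * ((2 ^ k * a - 1/2)\<^sup>2 + 3/4)" by simp
        also have "(1/2) ^ k * ((2 ^ k * a - 1/2)\<^sup>2 + 3/4) = (1/2) ^ k - a + 2 ^ k * a\<^sup>2"
          by (simp add: power2_eq_square field_simps power_divide)
        finally show ?thesis by simp
      qed
      show "norm (f k t) \<le> indicator {0..T} t *\<^sub>R ((1/2) ^ k * w t + 2 ^ k * (w t * (?n t)\<^sup>2))"
      proof (cases "t \<in> {0..T}")
        case True
        then have "norm (f k t) = w t * ?n t" using w1[OF True] by (simp add: f_def)
        also have "\<dots> \<le> w t * ((1/2) ^ k + 2 ^ k * (?n t)\<^sup>2)" using amgm w1[OF True] by (intro mult_left_mono) auto
        finally show ?thesis using True by (simp add: algebra_simps)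
      qed (simp add: f_def)
    qed
    also have "\<dots> = (1/2) ^ k * Wt + 2 ^ k * (LINT t:{0..T}|lebesgue. w t * (?n t)\<^sup>2)"
      using w norm_int by (subst set_integral_add) (auto simp: Wt_def)
    also have "\<dots> \<le> (1/2) ^ k * Wt + 2 ^ k * (1/4) ^ k" using DN[of k] by simp
    also have "(2::real) ^ k * (1/4) ^ k = (1/2) ^ k" by (simp flip: power_mult_distrib)
    finally show ?thesis by (simp add: algebra_simps)
  qed
  have "AE t in lebesgue. summable (\<lambda>k. norm (f k t))"
    by (rule AE_summable_if_integral_norm_le[OF f_int f_le]) (intro summable_mult2 summable_geometric, simp)
  then have conv: "AE t in lebesgue. t \<in> {0..T} \<longrightarrow> convergent (\<lambda>K. v (N K) t)"
  proof eventually_elim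
    case (elim t)
    show ?case
    proof
      assume t: "t \<in> {0..T}"
      have wt: "w t > 0" using w1[OF t] by simp
      have "(\<Sum>k<K. f k t) = w t *\<^sub>R (v (N K) t - v (N 0) t)" for K
        by (induction K) (use t in \<open>auto simp: f_def algebra_simps\<close>)
      moreover have "convergent (\<lambda>K. \<Sum>k<K. f k t)"
        using summable_norm_cancel[OF elim] by (simp add: summable_iff_convergent)
      ultimately have "convergent (\<lambda>K. w t *\<^sub>R (v (N K) t - v (N 0) t))" by simp
      then obtain l where "(\<lambda>K. w t *\<^sub>R (v (N K) t - v (N 0) t)) \<longlonglongrightarrow> l" by (auto simp: convergent_def)
      then have "(\<lambda>K. inverse (w t) *\<^sub>R (w t *\<^sub>R (v (N K) t - v (N 0) t)) + v (N 0) t) \<longlonglongrightarrow> inverse (w t) *\<^sub>R l + v (N 0) t"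
        by (intro tendsto_intros)
      then show "convergent (\<lambda>K. v (N K) t)" using wt by (auto simp: convergent_def)
    qed
  qed
  define V where "V t = lim (\<lambda>K. v (N K) t)" for t
  have lim: "AE t in lebesgue. t \<in> {0..T} \<longrightarrow> (\<lambda>K. v (N K) t) \<longlonglongrightarrow> V t"
    using conv by eventually_elim (auto simp: V_def convergent_LIMSEQ_iff)
  have Vm: "V \<in> borel_measurable lebesgue" unfolding V_def by (rule borel_measurable_lim_metric[OF vm])
  have indm: "(\<lambda>t. indicator {0..s} t *\<^sub>R (w t *\<^sub>R z t)) \<in> borel_measurable lebesgue"
    if "s \<le> T" "z \<in> borel_measurable lebesgue" for s and z :: "real \<Rightarrow> 'b"
    using borel_measurable_scaleR[OF borel_measurable_integrable[OF wsub[of 0 s, unfolded set_integrable_def]] that(2)] that(1)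
    by simp
  have dc: "set_integrable lebesgue {0..s} (\<lambda>t. w t *\<^sub>R V t)"
     "(\<lambda>K. LINT t:{0..s}|lebesgue. w t *\<^sub>R v (N K) t) \<longlonglongrightarrow> (LINT t:{0..s}|lebesgue. w t *\<^sub>R V t)"
    if s: "s \<in> {0..T}" for s
  proof -
    have 1: "integrable lebesgue (\<lambda>t. indicator {0..s} t *\<^sub>R w t)"
      using wsub[of 0 s] s by (simp add: set_integrable_def)
    have 2: "AE t in lebesgue. (\<lambda>K. indicator {0..s} t *\<^sub>R (w t *\<^sub>R v (N K) t)) \<longlonglongrightarrow> indicator {0..s} t *\<^sub>R (w t *\<^sub>R V t)"
      using lim by eventually_elim (use s in \<open>auto simp: indicator_def intro!: tendsto_intros\<close>)
    have 3: "AE t in lebesgue. norm (indicator {0..s} t *\<^sub>R (w t *\<^sub>R v (N K) t)) \<le> indicator {0..s} t *\<^sub>R w t" for K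
    proof (rule AE_I2)
      fix t show "norm (indicator {0..s} t *\<^sub>R (w t *\<^sub>R v (N K) t)) \<le> indicator {0..s} t *\<^sub>R w t"
        using w1[of t] v1[of "N K" t] s by (auto simp: indicator_def mult_left_le)
    qed
    have sT: "s \<le> T" using s by simp
    show "set_integrable lebesgue {0..s} (\<lambda>t. w t *\<^sub>R V t)" unfolding set_integrable_def
      by (rule integrable_dominated_convergence[OF indm[OF sT Vm] indm[OF sT vm] 1 2 3])
    show "(\<lambda>K. LINT t:{0..s}|lebesgue. w t *\<^sub>R v (N K) t) \<longlonglongrightarrow> (LINT t:{0..s}|lebesgue. w t *\<^sub>R V t)"
      unfolding set_lebesgue_integral_def
      by (rule Bochner_Integration.integral_dominated_convergence[OF indm[OF sT Vm] indm[OF sT vm] 1 2 3])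
  qed
  \<comment> \<open>At grid points of level \<open>n\<close> the integral is exact. From the
    preceding grid point \<open>p n\<close> to \<open>s\<close>, the increment of \<open>x\<close>
    and the integral are both bounded by the weight of \<open>{p n..s}\<close>.\<close>
  have lim1: "(\<lambda>n. LINT t:{0..s}|lebesgue. w t *\<^sub>R v n t) \<longlonglongrightarrow> x s - x 0" if s: "s \<in> {0..T}" for s
  proof -
    define Wi where "Wi t = 0 + (LINT \<tau>:{0..t}|lebesgue. w \<tau>)" for t
    have Wc: "continuous_on {0..T} Wi"
      unfolding Wi_def by (rule abs_continuous_on_imp_continuous_on[OF abs_continuous_on_indefinite_integral[OF w]])
    define p where "p n = \<tau> n (ix n s)" for n
    have ixle: "ix n s \<le> 2 ^ n" and p: "p n \<le> s" "s - T / 2 ^ n \<le> p n" for n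
    proof -
      have nn: "0 \<le> 2 ^ n * s / T" using s T by simp
      have f1: "real (ix n s) \<le> 2 ^ n * s / T" "2 ^ n * s / T < real (ix n s) + 1"
        using nn by (auto simp: ix_def of_nat_nat)
      have "2 ^ n * s / T \<le> 2 ^ n" using s T by (simp add: field_simps)
      then have "real (ix n s) \<le> 2 ^ n" using f1(1) by linarith
      then show "ix n s \<le> 2 ^ n" by (metis of_nat_le_iff of_nat_numeral of_nat_power)
      show "p n \<le> s" using f1(1) T by (simp add: p_def \<tau>_def field_simps)
      have "s * 2 ^ n < T * (real (ix n s) + 1)" using f1(2) T by (simp add: field_simps)
      then have "s < T * (real (ix n s) + 1) / 2 ^ n" by (simp add: pos_less_divide_eq)
      also have "\<dots> = p n + T / 2 ^ n" by (simp add: p_def \<tau>_def add_divide_distrib distrib_left)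
      finally show "s - T / 2 ^ n \<le> p n" by simp
    qed
    have p0: "0 \<le> p n" "p n \<le> T" for n using \<tau>nonneg p(1)[of n] s by (auto simp: p_def)
    have "(\<lambda>n. s - T / 2 ^ n) \<longlonglongrightarrow> s - 0"
      by (rule tendsto_diff[OF tendsto_const LIMSEQ_divide_realpow_zero]) simp
    then have low: "(\<lambda>n. s - T / 2 ^ n) \<longlonglongrightarrow> s" by simp
    have "p \<longlonglongrightarrow> s"
      by (rule tendsto_sandwich[OF always_eventually always_eventually low tendsto_const]) (use p in blast)+
    then have "(\<lambda>n. Wi (p n)) \<longlonglongrightarrow> Wi s"
      by (intro continuous_on_tendsto_compose[OF Wc]) (use s p0 in auto)
    then have "(\<lambda>n. 2 * (Wi s - Wi (p n))) \<longlonglongrightarrow> 2 * (Wi s - Wi s)" by (intro tendsto_intros)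
    then have zero: "(\<lambda>n. 2 * (Wi s - Wi (p n))) \<longlonglongrightarrow> 0" by simp
    have est: "norm ((LINT t:{0..s}|lebesgue. w t *\<^sub>R v n t) - (x s - x 0)) \<le> 2 * (Wi s - Wi (p n))" for n
    proof -
      have 1: "(LINT t:{0..s}|lebesgue. w t *\<^sub>R v n t) = (LINT t:{0..p n}|lebesgue. w t *\<^sub>R v n t) + (LINT t:{p n..s}|lebesgue. w t *\<^sub>R v n t)"
        by (rule set_integral_Icc_split[OF wv]) (use p0 p(1) s in auto)
      have 2: "(LINT t:{0..p n}|lebesgue. w t *\<^sub>R v n t) = x (p n) - x 0"
        using cells[of 0 "ix n s" n] ixle[of n] by (simp add: p_def \<tau>0)
      have 3: "Wi s - Wi (p n) = (LINT t:{p n..s}|lebesgue. w t)"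
        unfolding Wi_def using set_integral_Icc_split[OF w, of "p n" s] p0[of n] p(1)[of n] s by simp
      have sub: "set_integrable lebesgue {p n..s} (\<lambda>t. w t *\<^sub>R v n t)"
        by (rule set_integrable_Icc_subset[OF wv]) (use p0 s in auto)
      have "norm (LINT t:{p n..s}|lebesgue. w t *\<^sub>R v n t) \<le> (LINT t:{p n..s}|lebesgue. norm (w t *\<^sub>R v n t))"
        by (rule set_integral_norm_bound[OF sub])
      also have "\<dots> \<le> (LINT t:{p n..s}|lebesgue. w t)"
      proof (rule set_integral_mono[OF set_integrable_norm[OF sub] wsub])
        fix t assume "t \<in> {p n..s}"
        then have "t \<in> {0..T}" using p0[of n] s by auto
        then show "norm (w t *\<^sub>R v n t) \<le> w t" using w1[of t] v1[of n t] by (simp add: mult_left_le)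
      qed (use p0 s in auto)
      finally have 4: "norm (LINT t:{p n..s}|lebesgue. w t *\<^sub>R v n t) \<le> Wi s - Wi (p n)" using 3 by simp
      have 5: "norm (x s - x (p n)) \<le> Wi s - Wi (p n)" using xw[of "p n" s] p0[of n] p(1)[of n] s 3 by simp
      have eq: "(LINT t:{0..s}|lebesgue. w t *\<^sub>R v n t) - (x s - x 0) = (LINT t:{p n..s}|lebesgue. w t *\<^sub>R v n t) - (x s - x (p n))"
        using 1 2 by simp
      show ?thesis unfolding eq mult_2 by (rule order_trans[OF norm_triangle_ineq4 add_mono[OF 4 5]])
    qed
    have "(\<lambda>n. (LINT t:{0..s}|lebesgue. w t *\<^sub>R v n t) - (x s - x 0)) \<longlonglongrightarrow> 0"
      by (rule Lim_null_comparison[OF _ zero]) (use est in simp)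
    then show ?thesis by (simp add: LIM_zero_iff)
  qed
  have lim2: "(\<lambda>K. LINT t:{0..s}|lebesgue. w t *\<^sub>R v (N K) t) \<longlonglongrightarrow> x s - x 0" if "s \<in> {0..T}" for s
    using LIMSEQ_subseq_LIMSEQ[OF lim1[OF that] Nmono] by (simp add: o_def)
  show thesis
  proof (rule that[of "\<lambda>t. w t *\<^sub>R V t"])
    show "set_integrable lebesgue {0..T} (\<lambda>t. w t *\<^sub>R V t)" using dc(1)[of T] T by simp
    fix t assume t: "t \<in> {0..T}"
    from LIMSEQ_unique[OF dc(2)[OF t] lim2[OF t]]
    show "x t = x 0 + (LINT \<tau>:{0..t}|lebesgue. w \<tau> *\<^sub>R V \<tau>)" by simp
  qed
qed

section \<open>Volterra kernels\<close>

text \<open>A countable basis reduces the claim to countably many preimages, each Borel up to a null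
  set. On the union \<open>N\<close> of these null sets the function is overwritten by the constant
  \<open>undefined\<close>, which restores Borel measurability.\<close>

lemma lebesgue_measurable_ex_borel:
  fixes f :: "'c::euclidean_space \<Rightarrow> 'b::second_countable_topology"
  assumes f: "f \<in> borel_measurable lebesgue"
  obtains f' N where "f' \<in> borel_measurable lborel" "N \<in> null_sets lborel" "\<And>x. x \<notin> N \<Longrightarrow> f x = f' x"
proof -
  obtain B :: "'b set set" where B: "countable B" "topological_basis B" using ex_countable_basis by blast
  have "\<exists>S N'. S \<in> sets lborel \<and> N' \<in> null_sets lborel \<and> S \<subseteq> f -` b \<and> f -` b \<subseteq> S \<union> N'" if "b \<in> B" for b
  proof -
    have "open b" using B that by (simp add: topological_basis_open)
    then have "f -` b \<in> sets lebesgue" using measurable_sets[OF f, of b] by simp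
    then show ?thesis by (rule sets_completionE) blast
  qed
  then obtain S N' where SN: "\<And>b. b \<in> B \<Longrightarrow> S b \<in> sets lborel" "\<And>b. b \<in> B \<Longrightarrow> N' b \<in> null_sets lborel"
      "\<And>b. b \<in> B \<Longrightarrow> S b \<subseteq> f -` b" "\<And>b. b \<in> B \<Longrightarrow> f -` b \<subseteq> S b \<union> N' b" by metis
  define N where "N = (\<Union>b\<in>B. N' b)"
  have N: "N \<in> null_sets lborel" unfolding N_def using SN(2) B(1) by (intro null_sets_UN') auto
  define f' where "f' x = (if x \<in> N then undefined else f x)" for x
  have "f' \<in> borel_measurable lborel"
  proof (rule borel_measurableI)
    fix U :: "'b set" assume "open U"
    then obtain B' where B': "B' \<subseteq> B" "\<Union>B' = U" using B(2) unfolding topological_basis_def by blast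
    have "f' -` U = ((\<Union>b\<in>B'. S b) - N) \<union> (if undefined \<in> U then N else {})"
    proof (intro equalityI subsetI)
      fix x assume x: "x \<in> f' -` U"
      show "x \<in> ((\<Union>b\<in>B'. S b) - N) \<union> (if undefined \<in> U then N else {})"
      proof (cases "x \<in> N")
        case False
        then have "f x \<in> U" using x by (simp add: f'_def)
        then obtain b where b: "b \<in> B'" "f x \<in> b" using B' by blast
        then have "x \<in> S b \<union> N' b" using SN(4)[of b] B'(1) by auto
        moreover have "x \<notin> N' b" using False b B' by (auto simp: N_def)
        ultimately show ?thesis using b False by blast
      qed (use x in \<open>auto simp: f'_def\<close>)
    next
      fix x assume x: "x \<in> ((\<Union>b\<in>B'. S b) - N) \<union> (if undefined \<in> U then N else {})"
      show "x \<in> f' -` U"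
      proof (cases "x \<in> N")
        case True
        then show ?thesis using x by (auto simp: f'_def split: if_splits)
      next
        case False
        then obtain b where b: "b \<in> B'" "x \<in> S b" using x by (auto split: if_splits)
        then have "f x \<in> b" using SN(3)[of b] B'(1) by auto
        then show ?thesis using False b B' by (auto simp: f'_def)
      qed
    qed
    also have "\<dots> \<in> sets lborel"
      using SN(1) B' B(1) N countable_subset[OF B'(1) B(1)] by (intro sets.Un sets.Diff sets.countable_UN') auto
    finally show "f' -` U \<inter> space lborel \<in> sets lborel" by simp
  qed
  then show thesis using N by (rule that) (simp add: f'_def)
qed

text \<open>Lebesgue measure on the plane is the completion of a product, not a product of
  completions. Fubini's theorem is therefore applied to a Borel representative; the planar null set
  has null sections for almost every \<open>t\<close>, which carries the result back.\<close>

lemma lebesgue_Fubini: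
  fixes G :: "real \<times> real \<Rightarrow> 'b::{banach,second_countable_topology}"
  assumes G: "integrable lebesgue G"
  shows "AE t in lebesgue. integrable lebesgue (\<lambda>s. G (t, s))"
    and "integrable lebesgue (\<lambda>t. LINT s|lebesgue. G (t, s))"
proof -
  obtain G' N where G': "G' \<in> borel_measurable lborel" and N: "N \<in> null_sets lborel"
    and eq: "\<And>p. p \<notin> N \<Longrightarrow> G p = G' p"
    using lebesgue_measurable_ex_borel[OF borel_measurable_integrable[OF G]] by metis
  have "AE p in lebesgue. G p = G' p"
    by (rule AE_completion) (use AE_not_in[OF N] eq in \<open>auto elim: eventually_mono\<close>)
  then have "integrable lebesgue G'"
    using G G' by (intro integrable_cong_AE_imp[OF G measurable_completion[OF G']]) auto
  then have intG': "integrable (lborel \<Otimes>\<^sub>M lborel) G'"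
    using G' by (simp add: integrable_completion lborel_prod)
  have "AE p in lborel \<Otimes>\<^sub>M lborel. p \<notin> N" unfolding lborel_prod by (rule AE_not_in[OF N])
  then have aeN: "AE t in lborel. AE s in lborel. (t, s) \<notin> N" by (rule lborel_pair.AE_pair)
  have ae: "AE t in lborel. integrable lebesgue (\<lambda>s. G (t, s)) \<and> (LINT s|lebesgue. G (t, s)) = (LINT s|lborel. G' (t, s))"
    using aeN lborel_pair.AE_integrable_fst'[OF intG']
  proof eventually_elim
    case (elim t)
    have 1: "integrable lebesgue (\<lambda>s. G' (t, s))"
      using elim(2) by (simp add: integrable_completion borel_measurable_integrable[OF elim(2)])
    have 2: "AE s in lebesgue. G' (t, s) = G (t, s)"
      by (rule AE_completion) (use elim(1) in \<open>rule eventually_mono, simp add: eq\<close>)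
    have 3: "(\<lambda>s. G (t, s)) \<in> borel_measurable lebesgue"
      by (rule borel_measurable_lebesgue_AE[OF borel_measurable_integrable[OF 1] 2])
    have "integrable lebesgue (\<lambda>s. G (t, s))" by (rule integrable_cong_AE_imp[OF 1 3]) (use 2 in \<open>auto elim: eventually_mono\<close>)
    moreover have "(LINT s|lebesgue. G' (t, s)) = (LINT s|lebesgue. G (t, s))"
      by (rule integral_cong_AE[OF borel_measurable_integrable[OF 1] 3 2])
    moreover have "(LINT s|lebesgue. G' (t, s)) = (LINT s|lborel. G' (t, s))"
      by (rule integral_completion[OF borel_measurable_integrable[OF elim(2)]])
    ultimately show ?case by simp
  qed
  show "AE t in lebesgue. integrable lebesgue (\<lambda>s. G (t, s))"
    by (rule AE_completion) (use ae in \<open>rule eventually_mono, simp\<close>)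
  have int: "integrable lborel (\<lambda>t. LINT s|lborel. G' (t, s))"
    by (rule lborel_pair.integrable_fst'[OF intG'])
  have 1: "integrable lebesgue (\<lambda>t. LINT s|lborel. G' (t, s))"
    using int by (simp add: integrable_completion borel_measurable_integrable[OF int])
  have 2: "AE t in lebesgue. (LINT s|lborel. G' (t, s)) = (LINT s|lebesgue. G (t, s))"
    by (rule AE_completion) (use ae in \<open>rule eventually_mono, simp\<close>)
  show "integrable lebesgue (\<lambda>t. LINT s|lebesgue. G (t, s))"
    by (rule integrable_cong_AE_imp[OF 1 borel_measurable_lebesgue_AE[OF borel_measurable_integrable[OF 1] 2]])
      (use 2 in \<open>auto elim: eventually_mono\<close>)
qed

definition triangle :: "real \<Rightarrow> (real \<times> real) set" where
  "triangle T = {(t, s). 0 \<le> s \<and> s \<le> t \<and> t \<le> T}"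

lemma triangle_borel [simp]: "triangle T \<in> sets borel"
proof -
  have "closed (triangle T)"
    unfolding triangle_def case_prod_unfold
    by (intro closed_Collect_conj closed_Collect_le continuous_intros)
  then show ?thesis by simp
qed

lemma triangle_Fubini:
  fixes h :: "real \<Rightarrow> real \<Rightarrow> 'b::{banach,second_countable_topology}"
  assumes h: "set_integrable lebesgue (triangle T) (\<lambda>(t, s). h t s)"
  shows "AE t in lebesgue. t \<in> {0..T} \<longrightarrow> set_integrable lebesgue {0..t} (h t)"
    and "set_integrable lebesgue {0..T} (\<lambda>t. LINT s:{0..t}|lebesgue. h t s)"
proof -
  let ?G = "\<lambda>p. indicator (triangle T) p *\<^sub>R (case p of (t, s) \<Rightarrow> h t s)"
  have G: "integrable lebesgue ?G" using h by (simp add: set_integrable_def)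
  have ind: "?G (t, s) = indicator {0..T} t *\<^sub>R (indicator {0..t} s *\<^sub>R h t s)" for t s
    by (auto simp: triangle_def indicator_def)
  have "AE t in lebesgue. integrable lebesgue (\<lambda>s. ?G (t, s))" by (rule lebesgue_Fubini(1)[OF G])
  then show "AE t in lebesgue. t \<in> {0..T} \<longrightarrow> set_integrable lebesgue {0..t} (h t)"
    unfolding ind by eventually_elim (auto simp: set_integrable_def)
  have "integrable lebesgue (\<lambda>t. LINT s|lebesgue. ?G (t, s))" by (rule lebesgue_Fubini(2)[OF G])
  then show "set_integrable lebesgue {0..T} (\<lambda>t. LINT s:{0..t}|lebesgue. h t s)"
    unfolding ind set_integrable_def set_lebesgue_integral_def by (simp only: integral_scaleR_right)
qed


text \<open>For a simple \<open>y\<close> the superposition is a finite sum of functions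
  \<open>g t s v\<close> cut off by sets in the plane; continuity in the last argument gives the
  general case. Borel measurability of \<open>y\<close> makes these sets Borel when pulled back
  along \<open>snd\<close>.\<close>

lemma borel_measurable_Caratheodory:
  fixes g :: "real \<Rightarrow> real \<Rightarrow> 'b::{real_normed_vector,second_countable_topology} \<Rightarrow> 'b"
  assumes g1: "\<And>v. (\<lambda>(t, s). g t s v) \<in> borel_measurable (restrict_space lebesgue ({0..T} \<times> {0..T}))"
    and cont: "\<And>t s. (t, s) \<in> triangle T \<Longrightarrow> continuous_on UNIV (g t s)"
    and y: "y \<in> borel_measurable borel"
  shows "(\<lambda>p. indicator (triangle T) p *\<^sub>R (case p of (t, s) \<Rightarrow> g t s (y s))) \<in> borel_measurable lebesgue"
proof -
  obtain Y where Y: "\<And>i. simple_function borel (Y i)" "\<And>s. (\<lambda>i. Y i s) \<longlonglongrightarrow> y s"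
    using borel_measurable_implies_sequence_metric[OF y, of 0] by auto
  have Q: "{0..T} \<times> {0..T} \<inter> space lebesgue \<in> sets lebesgue" by (simp add: borel_closed closed_Times)
  have gv: "(\<lambda>p. indicator ({0..T} \<times> {0..T}) p *\<^sub>R (case p of (t, s) \<Rightarrow> g t s v)) \<in> borel_measurable lebesgue" for v
    using g1[of v] unfolding borel_measurable_restrict_space_iff[OF Q] .
  have tri: "(\<lambda>p. indicator (triangle T) p :: real) \<in> borel_measurable lebesgue"
    by (intro borel_measurable_indicator) simp
  have simple: "(\<lambda>p. indicator (triangle T) p *\<^sub>R (case p of (t, s) \<Rightarrow> g t s (Y i s))) \<in> borel_measurable lebesgue" for i
  proof -
    have fin: "finite (range (Y i))" using simple_functionD(1)[OF Y(1), of i] by simp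
    have "indicator (triangle T) p *\<^sub>R (case p of (t, s) \<Rightarrow> g t s (Y i s)) =
      (\<Sum>v\<in>range (Y i). (indicator (triangle T) p * indicator {q. Y i (snd q) = v} p) *\<^sub>R
         (indicator ({0..T} \<times> {0..T}) p *\<^sub>R (case p of (t, s) \<Rightarrow> g t s v)))" (is "?l p = ?r p") for p
    proof (cases "p \<in> triangle T")
      case True
      then have pQ: "p \<in> {0..T} \<times> {0..T}" by (auto simp: triangle_def)
      have "?r p = (\<Sum>v\<in>range (Y i). if v = Y i (snd p) then (case p of (t, s) \<Rightarrow> g t s v) else 0)"
        using True pQ by (intro sum.cong) (auto simp: indicator_def)
      also have "\<dots> = (case p of (t, s) \<Rightarrow> g t s (Y i (snd p)))" using fin by simp
      finally show ?thesis using True by (cases p) simp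
    qed simp
    moreover have "(\<lambda>p. ?r p) \<in> borel_measurable lebesgue"
    proof (rule borel_measurable_sum, rule borel_measurable_scaleR[OF borel_measurable_times[OF tri borel_measurable_indicator] gv])
      fix v
      have "Y i -` {v} \<in> sets borel" using simple_functionD(2)[OF Y(1), of i "{v}"] by simp
      then have "snd -` (Y i -` {v}) \<inter> space (borel :: (real \<times> real) measure) \<in> sets borel"
        by (intro measurable_sets[OF borel_measurable_continuous_onI[OF continuous_on_snd[OF continuous_on_id]]]) simp
      moreover have "snd -` (Y i -` {v}) = {q :: real \<times> real. Y i (snd q) = v}" by auto
      ultimately show "{q :: real \<times> real. Y i (snd q) = v} \<in> sets lebesgue" by simp
    qed
    ultimately show ?thesis by presburger
  qed
  show ?thesis
  proof (rule borel_measurable_LIMSEQ_metric[OF simple])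
    fix p :: "real \<times> real"
    obtain t s where p: "p = (t, s)" by (cases p)
    show "(\<lambda>i. indicator (triangle T) p *\<^sub>R (case p of (t, s) \<Rightarrow> g t s (Y i s))) \<longlonglongrightarrow> indicator (triangle T) p *\<^sub>R (case p of (t, s) \<Rightarrow> g t s (y s))"
    proof (cases "p \<in> triangle T")
      case True
      then have "(\<lambda>i. g t s (Y i s)) \<longlonglongrightarrow> g t s (y s)"
        using cont[of t s] p by (intro continuous_on_tendsto_compose[OF _ Y(2)]) auto
      then show ?thesis using True p by simp
    qed simp
  qed
qed

text \<open>The conditions on the kernel alone, stated for a state space of class
  \<open>banach\<close>; the theorem reaches them through an isometric copy of its space.\<close>

locale volterra_kernel =
  fixes T :: real
    and g :: "real \<Rightarrow> real \<Rightarrow> 'b::{real_inner,banach,second_countable_topology} \<Rightarrow> 'b"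
    and \<sigma> :: "real \<Rightarrow> real \<Rightarrow> real"
  assumes T_pos: "T > 0"
    and g1: "(\<lambda>(t, s). g t s v) \<in> borel_measurable (restrict_space lebesgue ({0..T} \<times> {0..T}))"
    and g2: "r > 0 \<Longrightarrow> \<exists>\<mu>. set_integrable lebesgue {0..T} \<mu> \<and> (\<forall>t\<in>{0..T}. \<mu> t \<ge> 0) \<and>
               (\<forall>(t, s)\<in>triangle T. \<forall>x\<in>cball 0 r. \<forall>y\<in>cball 0 r.
                  norm (g t s x - g t s y) \<le> \<mu> t * norm (x - y))"
    and g3_int: "set_integrable lebesgue (triangle T) (\<lambda>(t, s). \<sigma> t s)"
    and g3_nonneg: "(t, s) \<in> triangle T \<Longrightarrow> \<sigma> t s \<ge> 0"
    and g3: "(t, s) \<in> triangle T \<Longrightarrow> norm (g t s x) \<le> \<sigma> t s * (1 + norm x)"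
begin

definition K :: "(real \<Rightarrow> 'b) \<Rightarrow> real \<Rightarrow> 'b" where
  "K y t = (LINT s:{0..t}|lebesgue. g t s (y s))"

text \<open>Causality. It permits the step-by-step construction of polygons and the replacement of a
  curve by a Borel function that agrees with it on \<open>{0..T}\<close>.\<close>

lemma K_cong: "(\<And>s. s \<in> {0..t} \<Longrightarrow> y s = z s) \<Longrightarrow> K y t = K z t"
  unfolding K_def by (rule set_lebesgue_integral_cong) auto

lemma triangle_iff: "(t, s) \<in> triangle T \<longleftrightarrow> t \<in> {0..T} \<and> s \<in> {0..t}"
  by (auto simp: triangle_def)

text \<open>The Lipschitz bound \<open>g2\<close> on the ball of radius \<open>norm x + 1\<close>,
  which contains a neighbourhood of \<open>x\<close>.\<close>

lemma g_cont: assumes ts: "(t, s) \<in> triangle T" shows "continuous_on UNIV (g t s)"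
  unfolding continuous_on_eq_continuous_at[OF open_UNIV]
proof
  fix x :: 'b
  define r where "r = norm x + 1"
  have "r > 0" by (simp add: r_def add_nonneg_pos)
  then obtain \<mu> where \<mu>: "\<forall>t\<in>{0..T}. \<mu> t \<ge> 0" "\<forall>(t, s)\<in>triangle T. \<forall>x\<in>cball 0 r. \<forall>y\<in>cball 0 r.
                  norm (g t s x - g t s y) \<le> \<mu> t * norm (x - y)" using g2 by blast
  have lip: "norm (g t s y - g t s x) \<le> \<mu> t * norm (y - x)" if "y \<in> ball x 1" for y
  proof -
    have "norm y \<le> norm x + norm (y - x)" by (metis add_diff_cancel_left' diff_add_cancel norm_triangle_ineq add.commute)
    also have "norm (y - x) < 1" using that by (simp add: dist_norm norm_minus_commute)
    finally have "y \<in> cball 0 r" "x \<in> cball 0 r" by (auto simp: r_def)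
    then show ?thesis using \<mu>(2) ts by blast
  qed
  have "((\<lambda>y. \<mu> t * norm (y - x)) \<longlongrightarrow> \<mu> t * norm (x - x)) (at x)" by (intro tendsto_intros)
  then have "((\<lambda>y. \<mu> t * norm (y - x)) \<longlongrightarrow> 0) (at x)" by simp
  then have "((\<lambda>y. g t s y - g t s x) \<longlongrightarrow> 0) (at x)"
  proof (rule Lim_null_comparison[rotated])
    have "eventually (\<lambda>y. y \<in> ball x 1) (at x)" by (rule eventually_at_in_open') auto
    then show "eventually (\<lambda>y. norm (g t s y - g t s x) \<le> \<mu> t * norm (y - x)) (at x)"
      by eventually_elim (rule lip)
  qed
  then show "isCont (g t s) x" by (simp add: isCont_def LIM_zero_iff)
qed

text \<open>A bounded Borel factor keeps the kernel integrable on the triangle, and Fubini's theorem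
  does the rest. The constant factor 1 yields the function \<open>S\<close> below.\<close>

lemma bounded_kernel_integrable:
  assumes \<rho>: "\<rho> \<in> borel_measurable borel" and B: "\<And>s. s \<in> {0..T} \<Longrightarrow> \<bar>\<rho> s\<bar> \<le> B"
  shows "AE t in lebesgue. t \<in> {0..T} \<longrightarrow> set_integrable lebesgue {0..t} (\<lambda>s. \<sigma> t s * \<rho> s)"
    and "set_integrable lebesgue {0..T} (\<lambda>t. LINT s:{0..t}|lebesgue. \<sigma> t s * \<rho> s)"
proof -
  have "(\<lambda>p::real\<times>real. \<rho> (snd p)) \<in> borel_measurable lebesgue"
  proof (rule measurable_completion)
    have "snd \<in> borel_measurable (borel :: (real \<times> real) measure)"
      by (rule borel_measurable_continuous_onI[OF continuous_on_snd[OF continuous_on_id]])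
    then show "(\<lambda>p::real\<times>real. \<rho> (snd p)) \<in> borel_measurable lborel"
      using measurable_compose[OF _ \<rho>] by simp
  qed
  then have "set_integrable lebesgue (triangle T) (\<lambda>p. (case p of (t, s) \<Rightarrow> \<sigma> t s) *\<^sub>R \<rho> (snd p))"
    by (rule set_integrable_scaleR_bounded[OF g3_int, where B=B]) (use B in \<open>auto simp: triangle_def\<close>)
  then have "set_integrable lebesgue (triangle T) (\<lambda>(t, s). \<sigma> t s * \<rho> s)"
    by (simp add: case_prod_unfold)
  from triangle_Fubini[OF this]
  show "AE t in lebesgue. t \<in> {0..T} \<longrightarrow> set_integrable lebesgue {0..t} (\<lambda>s. \<sigma> t s * \<rho> s)"
    and "set_integrable lebesgue {0..T} (\<lambda>t. LINT s:{0..t}|lebesgue. \<sigma> t s * \<rho> s)" .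
qed

lemma K_integrable:
  assumes y: "y \<in> borel_measurable borel" and B: "\<And>s. s \<in> {0..T} \<Longrightarrow> norm (y s) \<le> B"
  shows "AE t in lebesgue. t \<in> {0..T} \<longrightarrow> set_integrable lebesgue {0..t} (\<lambda>s. g t s (y s))"
    and "set_integrable lebesgue {0..T} (K y)"
proof -
  have "set_integrable lebesgue (triangle T) (\<lambda>p. case p of (t, s) \<Rightarrow> g t s (y s))"
  proof (rule set_integrable_bound[of _ _ "\<lambda>p. (1 + B) * (case p of (t, s) \<Rightarrow> \<sigma> t s)"])
    show "set_integrable lebesgue (triangle T) (\<lambda>p. (1 + B) * (case p of (t, s) \<Rightarrow> \<sigma> t s))"
      using g3_int by (intro set_integrable_mult_right)
    show "set_borel_measurable lebesgue (triangle T) (\<lambda>p. case p of (t, s) \<Rightarrow> g t s (y s))"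
      unfolding set_borel_measurable_def by (rule borel_measurable_Caratheodory[OF g1 g_cont y])
    show "AE p in lebesgue. p \<in> triangle T \<longrightarrow> norm (case p of (t, s) \<Rightarrow> g t s (y s)) \<le> norm ((1 + B) * (case p of (t, s) \<Rightarrow> \<sigma> t s))"
    proof (rule AE_I2, rule impI)
      fix p assume p: "p \<in> triangle T"
      obtain t s where ts: "p = (t, s)" by (cases p)
      have s: "s \<in> {0..T}" using p ts by (auto simp: triangle_def)
      have "norm (g t s (y s)) \<le> \<sigma> t s * (1 + norm (y s))" using g3 p ts by blast
      also have "\<dots> \<le> \<sigma> t s * (1 + B)" using B[OF s] g3_nonneg p ts by (intro mult_left_mono) auto
      also have "\<dots> \<le> \<bar>(1 + B) * \<sigma> t s\<bar>" by (simp add: mult.commute)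
      finally show "norm (case p of (t, s) \<Rightarrow> g t s (y s)) \<le> norm ((1 + B) * (case p of (t, s) \<Rightarrow> \<sigma> t s))"
        by (simp add: ts)
    qed
  qed
  from triangle_Fubini[OF this]
  show "AE t in lebesgue. t \<in> {0..T} \<longrightarrow> set_integrable lebesgue {0..t} (\<lambda>s. g t s (y s))"
    and "set_integrable lebesgue {0..T} (K y)" by (auto simp: K_def[abs_def])
qed

text \<open>The growth condition \<open>g3\<close> integrated over the past; the majorant \<rho>
  will be a running supremum or \<open>r\<close>.\<close>

lemma K_bound:
  assumes y: "y \<in> borel_measurable borel" and yB: "\<And>s. s \<in> {0..T} \<Longrightarrow> norm (y s) \<le> \<rho> s"
    and \<rho>: "\<rho> \<in> borel_measurable borel" and B: "\<And>s. s \<in> {0..T} \<Longrightarrow> \<rho> s \<le> B"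
  shows "AE t in lebesgue. t \<in> {0..T} \<longrightarrow>
    norm (K y t) \<le> (LINT s:{0..t}|lebesgue. \<sigma> t s) + (LINT s:{0..t}|lebesgue. \<sigma> t s * \<rho> s)"
proof -
  have yB': "norm (y s) \<le> B" if "s \<in> {0..T}" for s using yB[OF that] B[OF that] by linarith
  have \<rho>B: "\<bar>\<rho> s\<bar> \<le> B" if "s \<in> {0..T}" for s using yB[OF that] B[OF that] norm_ge_zero[of "y s"] by linarith
  have 1: "AE t in lebesgue. t \<in> {0..T} \<longrightarrow> set_integrable lebesgue {0..t} (\<lambda>s. \<sigma> t s)"
    using bounded_kernel_integrable(1)[of "\<lambda>_. 1" 1] by simp
  have 2: "AE t in lebesgue. t \<in> {0..T} \<longrightarrow> set_integrable lebesgue {0..t} (\<lambda>s. g t s (y s))"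
    by (rule K_integrable(1)[OF y]) (rule yB')
  have 3: "AE t in lebesgue. t \<in> {0..T} \<longrightarrow> set_integrable lebesgue {0..t} (\<lambda>s. \<sigma> t s * \<rho> s)"
    by (rule bounded_kernel_integrable(1)[OF \<rho>]) (rule \<rho>B)
  from 2 3 1 show ?thesis
  proof eventually_elim
    case (elim t)
    show ?case
    proof
      assume t: "t \<in> {0..T}"
      have i: "set_integrable lebesgue {0..t} (\<lambda>s. \<sigma> t s + \<sigma> t s * \<rho> s)" using elim t by (intro set_integral_add) auto
      have "norm (K y t) \<le> (LINT s:{0..t}|lebesgue. norm (g t s (y s)))"
        unfolding K_def using elim t by (intro set_integral_norm_bound) auto
      also have "\<dots> \<le> (LINT s:{0..t}|lebesgue. \<sigma> t s + \<sigma> t s * \<rho> s)"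
      proof (rule set_integral_mono[OF set_integrable_norm i])
        show "set_integrable lebesgue {0..t} (\<lambda>s. g t s (y s))" using elim t by auto
        fix s assume s: "s \<in> {0..t}"
        then have tri: "(t, s) \<in> triangle T" using t by (simp add: triangle_iff)
        have "norm (g t s (y s)) \<le> \<sigma> t s * (1 + norm (y s))" using g3 tri by blast
        also have "\<dots> \<le> \<sigma> t s * (1 + \<rho> s)" using yB[of s] s t g3_nonneg[OF tri] by (intro mult_left_mono) auto
        finally show "norm (g t s (y s)) \<le> \<sigma> t s + \<sigma> t s * \<rho> s" by (simp add: distrib_left)
      qed
      also have "\<dots> = (LINT s:{0..t}|lebesgue. \<sigma> t s) + (LINT s:{0..t}|lebesgue. \<sigma> t s * \<rho> s)"
        using elim t by (intro set_integral_add) auto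
      finally show "norm (K y t) \<le> (LINT s:{0..t}|lebesgue. \<sigma> t s) + (LINT s:{0..t}|lebesgue. \<sigma> t s * \<rho> s)" .
    qed
  qed
qed

text \<open>The quantifier over \<Delta> stands inside the almost-everywhere statement: in the
  applications \<Delta> depends on \<open>t\<close>, as a running supremum up to \<open>t\<close> or
  a tolerance divided by \<open>\<mu> t * T + 1\<close>, so one null set has to serve all \<Delta>.
  The factor \<open>T\<close> bounds the length of \<open>{0..t}\<close>.\<close>

lemma K_lipschitz:
  assumes y: "y \<in> borel_measurable borel" "\<And>s. s \<in> {0..T} \<Longrightarrow> norm (y s) \<le> r"
    and z: "z \<in> borel_measurable borel" "\<And>s. s \<in> {0..T} \<Longrightarrow> norm (z s) \<le> r"
    and \<mu>: "\<forall>t\<in>{0..T}. \<mu> t \<ge> 0" "\<forall>(t, s)\<in>triangle T. \<forall>x\<in>cball 0 r. \<forall>y\<in>cball 0 r.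
                  norm (g t s x - g t s y) \<le> \<mu> t * norm (x - y)"
  shows "AE t in lebesgue. t \<in> {0..T} \<longrightarrow> (\<forall>\<Delta>. (\<forall>s\<in>{0..t}. norm (y s - z s) \<le> \<Delta>) \<longrightarrow> norm (K y t - K z t) \<le> \<mu> t * T * \<Delta>)"
proof -
  have 1: "AE t in lebesgue. t \<in> {0..T} \<longrightarrow> set_integrable lebesgue {0..t} (\<lambda>s. g t s (y s))"
    by (rule K_integrable(1)[OF y(1)]) (rule y(2))
  have 2: "AE t in lebesgue. t \<in> {0..T} \<longrightarrow> set_integrable lebesgue {0..t} (\<lambda>s. g t s (z s))"
    by (rule K_integrable(1)[OF z(1)]) (rule z(2))
  from 1 2 show ?thesis
  proof eventually_elim
    case (elim t)
    show ?case
    proof (intro impI allI)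
      fix \<Delta> assume t: "t \<in> {0..T}" and \<Delta>: "\<forall>s\<in>{0..t}. norm (y s - z s) \<le> \<Delta>"
      have \<Delta>0: "\<Delta> \<ge> 0" using \<Delta> t by (meson atLeastAtMost_iff norm_ge_zero order.refl order_trans)
      have i: "set_integrable lebesgue {0..t} (\<lambda>s. g t s (y s))" "set_integrable lebesgue {0..t} (\<lambda>s. g t s (z s))"
        using elim t by auto
      have id: "set_integrable lebesgue {0..t} (\<lambda>s. g t s (y s) - g t s (z s))" using i by (rule set_integral_diff)
      have "K y t - K z t = (LINT s:{0..t}|lebesgue. g t s (y s) - g t s (z s))"
        unfolding K_def using i by (simp add: set_integral_diff)
      then have "norm (K y t - K z t) \<le> (LINT s:{0..t}|lebesgue. norm (g t s (y s) - g t s (z s)))"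
        using set_integral_norm_bound[OF id] by simp
      also have "\<dots> \<le> (LINT s:{0..t}|lebesgue. \<mu> t * \<Delta>)"
      proof (rule set_integral_mono[OF set_integrable_norm[OF id] set_integrable_Icc_const])
        fix s assume s: "s \<in> {0..t}"
        then have tri: "(t, s) \<in> triangle T" using t by (simp add: triangle_iff)
        have "y s \<in> cball 0 r" "z s \<in> cball 0 r" using y(2)[of s] z(2)[of s] s t by auto
        then have "norm (g t s (y s) - g t s (z s)) \<le> \<mu> t * norm (y s - z s)" using \<mu>(2) tri by blast
        also have "\<dots> \<le> \<mu> t * \<Delta>" using \<Delta> s \<mu>(1) t by (intro mult_left_mono) auto
        finally show "norm (g t s (y s) - g t s (z s)) \<le> \<mu> t * \<Delta>" .
      qed
      also have "\<dots> = t * (\<mu> t * \<Delta>)" using t by (simp add: set_integral_Icc_const)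
      also have "\<dots> \<le> T * (\<mu> t * \<Delta>)" using t \<mu>(1) \<Delta>0 by (intro mult_right_mono) auto
      finally show "norm (K y t - K z t) \<le> \<mu> t * T * \<Delta>" by (simp add: mult_ac)
    qed
  qed
qed

end

section \<open>Running suprema and energy estimates\<close>

text \<open>The memory term at \<open>t\<close> involves all earlier states, so an inequality in
  \<open>\<phi> t\<close> alone does not close. The running supremum does close it and, being
  monotone, is measurable.\<close>

definition run_sup :: "(real \<Rightarrow> real) \<Rightarrow> real \<Rightarrow> real" where
  "run_sup \<phi> t = (SUP s\<in>{0..t}. \<phi> s)"

lemma run_sup_upper:
  assumes \<phi>: "continuous_on {0..T} \<phi>" and "0 \<le> s" "s \<le> t" "t \<le> T"
  shows "\<phi> s \<le> run_sup \<phi> t"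
proof -
  obtain B where "\<And>t. t \<in> {0..T} \<Longrightarrow> norm (\<phi> t) \<le> B" using continuous_on_Icc_norm_bound[OF \<phi>] by metis
  then have "bdd_above (\<phi> ` {0..t})" using assms(4) by (intro bdd_aboveI2[of _ _ B]) (auto simp: abs_le_iff)
  then show ?thesis unfolding run_sup_def using assms by (intro cSUP_upper) auto
qed

lemma run_sup_least: "0 \<le> t \<Longrightarrow> (\<And>s. 0 \<le> s \<Longrightarrow> s \<le> t \<Longrightarrow> \<phi> s \<le> M) \<Longrightarrow> run_sup \<phi> t \<le> M"
  unfolding run_sup_def by (rule cSUP_least) auto

lemma run_sup_mono:
  assumes \<phi>: "continuous_on {0..T} \<phi>" and "0 \<le> s" "s \<le> t" "t \<le> T"
  shows "run_sup \<phi> s \<le> run_sup \<phi> t"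
proof (rule run_sup_least)
  fix q assume "0 \<le> q" "q \<le> s"
  then show "\<phi> q \<le> run_sup \<phi> t" using assms by (intro run_sup_upper[OF \<phi>]) auto
qed (use assms in simp)

text \<open>Clamping the argument extends a function that is monotone on \<open>{0..T}\<close> to a
  monotone function on the line, and monotone functions are Borel. The same device serves
  \<open>r\<close>.\<close>

lemma run_sup_clamp_borel:
  assumes \<phi>: "continuous_on {0..T} \<phi>" and T: "0 \<le> T"
  shows "(\<lambda>t. run_sup \<phi> (max 0 (min t T))) \<in> borel_measurable borel"
  by (rule borel_measurable_mono, rule monoI, rule run_sup_mono[OF \<phi>]) (use T in auto)

lemma run_sup_mult_integrable:
  assumes \<phi>: "continuous_on {0..T} \<phi>" and T: "0 \<le> T" and \<alpha>: "set_integrable lebesgue {0..T} \<alpha>"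
  shows "set_integrable lebesgue {0..T} (\<lambda>t. \<alpha> t * run_sup \<phi> t)"
proof -
  let ?R = "\<lambda>t. run_sup \<phi> (max 0 (min t T))"
  have m: "?R \<in> borel_measurable lebesgue" 
    by (rule measurable_completion) (use run_sup_clamp_borel[OF \<phi> T] in simp)
  have b: "norm (?R t) \<le> max \<bar>run_sup \<phi> 0\<bar> \<bar>run_sup \<phi> T\<bar>" if "t \<in> {0..T}" for t
    using run_sup_mono[OF \<phi>, of 0 t] run_sup_mono[OF \<phi>, of t T] that by auto
  have "set_integrable lebesgue {0..T} (\<lambda>t. \<alpha> t *\<^sub>R ?R t)"
    by (rule set_integrable_scaleR_bounded[OF \<alpha> m]) (rule b)
  moreover have "indicator {0..T} t *\<^sub>R (\<alpha> t * ?R t) = indicator {0..T} t *\<^sub>R (\<alpha> t * run_sup \<phi> t)" for t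
    by (auto simp: indicator_def)
  ultimately show ?thesis unfolding set_integrable_def real_scaleR_def by simp
qed

text \<open>The right-hand side of \<open>le\<close> is nondecreasing in \<open>t\<close>, its
  integrand being nonnegative. So the bound for \<phi> passes to the running supremum, to which
  \<open>gronwall_integral\<close> applies.\<close>

theorem gronwall_run_sup:
  fixes \<phi> \<alpha> \<beta> :: "real \<Rightarrow> real"
  assumes \<phi>: "continuous_on {0..T} \<phi>" and \<phi>0: "\<And>t. t \<in> {0..T} \<Longrightarrow> 0 \<le> \<phi> t"
    and \<alpha>: "set_integrable lebesgue {0..T} \<alpha>" and \<alpha>0: "\<And>s. s \<in> {0..T} \<Longrightarrow> \<alpha> s \<ge> 0"
    and \<beta>: "set_integrable lebesgue {0..T} \<beta>" and \<beta>0: "\<And>s. s \<in> {0..T} \<Longrightarrow> \<beta> s \<ge> 0"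
    and le: "\<And>t. t \<in> {0..T} \<Longrightarrow> \<phi> t \<le> a + (LINT \<tau>:{0..t}|lebesgue. \<alpha> \<tau> * run_sup \<phi> \<tau> + \<beta> \<tau>)"
    and t: "t \<in> {0..T}"
  shows "run_sup \<phi> t \<le> a * exp (LINT \<tau>:{0..t}|lebesgue. \<alpha> \<tau>) + (LINT s:{0..t}|lebesgue. \<beta> s * exp (LINT \<tau>:{s..t}|lebesgue. \<alpha> \<tau>))"
proof -
  have T: "0 \<le> T" using t by simp
  have R0: "0 \<le> run_sup \<phi> s" if "s \<in> {0..T}" for s
    using run_sup_upper[OF \<phi>, of s s] \<phi>0[OF that] that by simp
  have \<alpha>R: "set_integrable lebesgue {0..T} (\<lambda>t. \<alpha> t * run_sup \<phi> t)" by (rule run_sup_mult_integrable[OF \<phi> T \<alpha>])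
  have h: "set_integrable lebesgue {0..T} (\<lambda>t. \<alpha> t * run_sup \<phi> t + \<beta> t)" using \<alpha>R \<beta> by (rule set_integral_add)
  show ?thesis
  proof (rule gronwall_integral)
    fix s assume s: "s \<in> {0..t}"
    show "run_sup \<phi> s \<le> a + (LINT \<tau>:{0..s}|lebesgue. \<alpha> \<tau> * run_sup \<phi> \<tau> + \<beta> \<tau>)"
    proof (rule run_sup_least)
      fix q assume q: "0 \<le> q" "q \<le> s"
      have "(LINT \<tau>:{q..s}|lebesgue. \<alpha> \<tau> * run_sup \<phi> \<tau> + \<beta> \<tau>) \<ge> 0"
        unfolding set_lebesgue_integral_def
      proof (rule Bochner_Integration.integral_nonneg)
        fix \<tau> show "0 \<le> indicator {q..s} \<tau> *\<^sub>R (\<alpha> \<tau> * run_sup \<phi> \<tau> + \<beta> \<tau>)"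
        proof (cases "\<tau> \<in> {q..s}")
          case True
          then have "\<tau> \<in> {0..T}" using q s t by auto
          then show ?thesis using \<alpha>0 \<beta>0 R0 by simp
        qed simp
      qed
      moreover have "(LINT \<tau>:{0..s}|lebesgue. \<alpha> \<tau> * run_sup \<phi> \<tau> + \<beta> \<tau>) =
         (LINT \<tau>:{0..q}|lebesgue. \<alpha> \<tau> * run_sup \<phi> \<tau> + \<beta> \<tau>) + (LINT \<tau>:{q..s}|lebesgue. \<alpha> \<tau> * run_sup \<phi> \<tau> + \<beta> \<tau>)"
        by (rule set_integral_Icc_split[OF h]) (use q s t in auto)
      ultimately show "\<phi> q \<le> a + (LINT \<tau>:{0..s}|lebesgue. \<alpha> \<tau> * run_sup \<phi> \<tau> + \<beta> \<tau>)"
        using le[of q] q s t by simp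
    qed (use s in auto)
  next
    show "set_integrable lebesgue {0..t} \<alpha>" "set_integrable lebesgue {0..t} \<beta>"
      "set_integrable lebesgue {0..t} (\<lambda>t. \<alpha> t * run_sup \<phi> t)"
      by (rule set_integrable_Icc_subset[OF \<alpha>] set_integrable_Icc_subset[OF \<beta>] set_integrable_Icc_subset[OF \<alpha>R]; use t in simp)+
  qed (use t \<alpha>0 in auto)
qed

section \<open>Energy estimate for absolutely continuous curves\<close>

lemma abs_continuous_on_subset:
  assumes x: "abs_continuous_on a b x" and pq: "a \<le> p" "q \<le> b"
  shows "abs_continuous_on p q x"
  unfolding abs_continuous_on_def
proof (intro allI impI)
  fix \<epsilon> :: real assume \<epsilon>: "\<epsilon> > 0"
  obtain \<delta> where d: "\<delta> > 0" and H: "\<forall>(n::nat) (I :: nat \<Rightarrow> real \<times> real).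
        (\<forall>i<n. a \<le> fst (I i) \<and> fst (I i) \<le> snd (I i) \<and> snd (I i) \<le> b) \<and>
        (\<forall>i<n. \<forall>j<n. i \<noteq> j \<longrightarrow> {fst (I i)<..<snd (I i)} \<inter> {fst (I j)<..<snd (I j)} = {}) \<and>
        (\<Sum>i<n. snd (I i) - fst (I i)) < \<delta>
        \<longrightarrow> (\<Sum>i<n. norm (x (snd (I i)) - x (fst (I i)))) < \<epsilon>"
    using x[unfolded abs_continuous_on_def, THEN spec, THEN mp, OF \<epsilon>] by (elim exE conjE)
  show "\<exists>\<delta>>0. \<forall>(n::nat) (I :: nat \<Rightarrow> real \<times> real).
        (\<forall>i<n. p \<le> fst (I i) \<and> fst (I i) \<le> snd (I i) \<and> snd (I i) \<le> q) \<and>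
        (\<forall>i<n. \<forall>j<n. i \<noteq> j \<longrightarrow> {fst (I i)<..<snd (I i)} \<inter> {fst (I j)<..<snd (I j)} = {}) \<and>
        (\<Sum>i<n. snd (I i) - fst (I i)) < \<delta>
        \<longrightarrow> (\<Sum>i<n. norm (x (snd (I i)) - x (fst (I i)))) < \<epsilon>"
  proof (intro exI[of _ \<delta>] conjI allI impI d)
    fix n and I :: "nat \<Rightarrow> real \<times> real"
    assume A: "(\<forall>i<n. p \<le> fst (I i) \<and> fst (I i) \<le> snd (I i) \<and> snd (I i) \<le> q) \<and>
        (\<forall>i<n. \<forall>j<n. i \<noteq> j \<longrightarrow> {fst (I i)<..<snd (I i)} \<inter> {fst (I j)<..<snd (I j)} = {}) \<and>
        (\<Sum>i<n. snd (I i) - fst (I i)) < \<delta>"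
    show "(\<Sum>i<n. norm (x (snd (I i)) - x (fst (I i)))) < \<epsilon>"
    proof (rule H[THEN spec, THEN spec, THEN mp], intro conjI allI impI)
      fix i assume "i < n"
      then have "p \<le> fst (I i) \<and> fst (I i) \<le> snd (I i) \<and> snd (I i) \<le> q"
        using A[THEN conjunct1] by simp
      then show "a \<le> fst (I i)" "fst (I i) \<le> snd (I i)" "snd (I i) \<le> b" using pq by auto
    next
      fix i j assume "i < n" "j < n" "i \<noteq> j"
      then show "{fst (I i)<..<snd (I i)} \<inter> {fst (I j)<..<snd (I j)} = {}"
        using A[THEN conjunct2, THEN conjunct1, THEN spec, THEN mp, THEN spec, THEN mp, THEN mp] by metis
    qed (rule A[THEN conjunct2, THEN conjunct2])
  qed
qed

lemma abs_continuous_on_diff: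
  assumes "abs_continuous_on a b x" "abs_continuous_on a b y"
  shows "abs_continuous_on a b (\<lambda>t. x t - y t)"
proof (rule abs_continuous_on_dominated[OF assms, of 1])
  fix s t
  have eq: "(x t - y t) - (x s - y s) = (x t - x s) - (y t - y s)" by simp
  show "norm ((x t - y t) - (x s - y s)) \<le> 1 * (norm (x t - x s) + norm (y t - y s))"
    unfolding eq mult_1 by (rule norm_triangle_ineq4)
qed simp

text \<open>The chain rule for the squared norm, which is absolutely continuous because the curve is
  bounded. An upper bound for the inner product is the form in which a one-sided Lipschitz condition
  arrives.\<close>

theorem norm_square_diff_le_integral:
  fixes z :: "real \<Rightarrow> 'b::real_inner" and h :: "real \<Rightarrow> real"
  assumes z: "abs_continuous_on a b z" and h: "set_integrable lebesgue {a..b} h"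
    and ae: "AE t in lebesgue. t \<in> {a..b} \<longrightarrow> (\<exists>D. (z has_vector_derivative D) (at t within {a..b}) \<and> 2 * inner D (z t) \<le> h t)"
    and pq: "a \<le> p" "p \<le> q" "q \<le> b"
  shows "(norm (z q))\<^sup>2 - (norm (z p))\<^sup>2 \<le> (LINT t:{p..q}|lebesgue. h t)"
proof -
  obtain B where B: "B \<ge> 0" "\<And>t. t \<in> {a..b} \<Longrightarrow> norm (z t) \<le> B"
    using continuous_on_Icc_norm_bound[OF abs_continuous_on_imp_continuous_on[OF z]] by metis
  have "abs_continuous_on a b (\<lambda>t. (norm (z t))\<^sup>2)"
  proof (rule abs_continuous_on_dominated[OF z z B(1)])
    fix s t assume st: "a \<le> s" "s \<le> t" "t \<le> b"
    have "norm ((norm (z t))\<^sup>2 - (norm (z s))\<^sup>2) = \<bar>norm (z t) - norm (z s)\<bar> * (norm (z t) + norm (z s))"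
      by (simp add: power2_eq_square square_diff_square_factored abs_mult)
    also have "\<dots> \<le> norm (z t - z s) * (B + B)"
      using B(2)[of s] B(2)[of t] st norm_triangle_ineq3[of "z t" "z s"] by (intro mult_mono) auto
    finally show "norm ((norm (z t))\<^sup>2 - (norm (z s))\<^sup>2) \<le> B * (norm (z t - z s) + norm (z t - z s))"
      by (simp add: algebra_simps)
  qed
  then have ac: "abs_continuous_on p q (\<lambda>t. (norm (z t))\<^sup>2)" by (rule abs_continuous_on_subset) (use pq in auto)
  have "AE t in lebesgue. t \<in> {p..q} \<longrightarrow> (\<exists>D. ((\<lambda>t. (norm (z t))\<^sup>2) has_vector_derivative D) (at t within {p..q}) \<and> D \<le> h t)"
    using ae
  proof eventually_elim
    case (elim t)
    show ?case
    proof
      assume t: "t \<in> {p..q}"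
      then obtain D where D: "(z has_vector_derivative D) (at t within {a..b})" "2 * inner D (z t) \<le> h t"
        using elim pq by auto
      have "(z has_vector_derivative D) (at t within {p..q})"
        by (rule has_vector_derivative_within_subset[OF D(1)]) (use pq in auto)
      then have "((\<lambda>t. inner (z t) (z t)) has_vector_derivative (inner (z t) D + inner D (z t))) (at t within {p..q})"
        unfolding has_vector_derivative_def
        by (auto intro!: derivative_eq_intros simp: algebra_simps)
      then have "((\<lambda>t. (norm (z t))\<^sup>2) has_vector_derivative 2 * inner D (z t)) (at t within {p..q})"
        by (simp add: power2_norm_eq_inner inner_commute)
      then show "\<exists>D. ((\<lambda>t. (norm (z t))\<^sup>2) has_vector_derivative D) (at t within {p..q}) \<and> D \<le> h t" using D(2) by blast
    qed
  qed
  then show ?thesis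
    by (rule abs_continuous_on_diff_le_integral[OF pq(2) ac set_integrable_Icc_subset[OF h pq(1,3)]])
qed

section \<open>Euler approximations\<close>

lemma set_integral_nonneg_Icc:
  fixes f :: "real \<Rightarrow> real"
  assumes "\<And>s. s \<in> {p..q} \<Longrightarrow> 0 \<le> f s"
  shows "0 \<le> (LINT s:{p..q}|lebesgue. f s)"
  unfolding set_lebesgue_integral_def using assms
  by (intro Bochner_Integration.integral_nonneg) (auto simp: indicator_def)

locale integro_inclusion = volterra_kernel T g \<sigma>
  for T :: real and g :: "real \<Rightarrow> real \<Rightarrow> 'b::{real_inner,banach,second_countable_topology} \<Rightarrow> 'b"
    and \<sigma> :: "real \<Rightarrow> real \<Rightarrow> real" +
  fixes x0 :: 'b and F :: "real \<Rightarrow> 'b \<Rightarrow> 'b set" and c d k :: "real \<Rightarrow> real"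
  assumes F_values: "t \<in> {0..T} \<Longrightarrow> F t v \<noteq> {} \<and> closed (F t v) \<and> convex (F t v)"
    and F1: "measurable_multifun {0..T} (\<lambda>t. F t v)"
    and F2: "AE t in lebesgue. t \<in> {0..T} \<longrightarrow> usc_weak (F t)"
    and c_int: "set_integrable lebesgue {0..T} c" and d_int: "set_integrable lebesgue {0..T} d"
    and c_nonneg: "t \<in> {0..T} \<Longrightarrow> c t \<ge> 0" and d_nonneg: "t \<in> {0..T} \<Longrightarrow> d t \<ge> 0"
    and F3: "AE t in lebesgue. t \<in> {0..T} \<longrightarrow> (\<forall>v. Inf (norm ` F t v) \<le> c t * norm v + d t)"
    and k_int: "set_integrable lebesgue {0..T} k"
    and F5: "AE t in lebesgue. t \<in> {0..T} \<longrightarrow>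
               (\<forall>x1 x2 v1 v2. v1 \<in> F t x1 \<longrightarrow> v2 \<in> F t x2 \<longrightarrow>
                  inner (v1 - v2) (x1 - x2) \<le> k t * (norm (x1 - x2))\<^sup>2)"
begin

text \<open>By \<open>g3\<close> the kernel contributes \<open>S t\<close> times one plus the
  supremum of the past norms; hence \<open>S\<close> is added to \<open>c\<close> in \<alpha> and to
  \<open>d\<close> in \<beta>. As \<open>A\<close> is a primitive of \<alpha>, the factor
  \<open>e_fun\<close> becomes \<open>exp (A t - A s)\<close>.\<close>

definition S :: "real \<Rightarrow> real" where "S t = (LINT s:{0..t}|lebesgue. \<sigma> t s)"
definition \<alpha> :: "real \<Rightarrow> real" where "\<alpha> t = c t + S t"
definition \<beta> :: "real \<Rightarrow> real" where "\<beta> t = d t + S t"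
definition A :: "real \<Rightarrow> real" where "A t = 0 + (LINT s:{0..t}|lebesgue. \<alpha> s)"
definition r :: "real \<Rightarrow> real" where "r t = r_fun c d \<sigma> (norm x0) t"
definition \<psi> :: "real \<Rightarrow> real" where "\<psi> t = psi_fun c d \<sigma> (norm x0) t"
definition F0 :: "real \<Rightarrow> 'b \<Rightarrow> 'b" where "F0 t v = min_norm_point (F t v)"

section \<open>Regularity of the bounds \<open>r\<close> and \<psi>\<close>

lemma S_int: "set_integrable lebesgue {0..T} S"
  using bounded_kernel_integrable(2)[of "\<lambda>_. 1" 1] by (simp add: S_def[abs_def])

lemma S_nonneg: "t \<in> {0..T} \<Longrightarrow> 0 \<le> S t"
  unfolding S_def by (rule set_integral_nonneg_Icc, rule g3_nonneg) (simp add: triangle_iff)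

lemma \<alpha>_int: "set_integrable lebesgue {0..T} \<alpha>"
  unfolding \<alpha>_def using c_int S_int by (rule set_integral_add)

lemma \<beta>_int: "set_integrable lebesgue {0..T} \<beta>"
  unfolding \<beta>_def using d_int S_int by (rule set_integral_add)

lemma \<alpha>_nonneg: "t \<in> {0..T} \<Longrightarrow> 0 \<le> \<alpha> t"
  using c_nonneg S_nonneg by (simp add: \<alpha>_def)

lemma \<beta>_nonneg: "t \<in> {0..T} \<Longrightarrow> 0 \<le> \<beta> t"
  using d_nonneg S_nonneg by (simp add: \<beta>_def)

lemma A_diff: "0 \<le> s \<Longrightarrow> s \<le> t \<Longrightarrow> t \<le> T \<Longrightarrow> A t - A s = (LINT \<tau>:{s..t}|lebesgue. \<alpha> \<tau>)"
  using set_integral_Icc_split[OF \<alpha>_int, of s t] by (simp add: A_def)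

lemma A_mono: "0 \<le> s \<Longrightarrow> s \<le> t \<Longrightarrow> t \<le> T \<Longrightarrow> A s \<le> A t"
  using A_diff[of s t] set_integral_nonneg_Icc[of s t \<alpha>] \<alpha>_nonneg by force

lemma A_cont: "continuous_on {0..T} A"
  unfolding A_def by (rule abs_continuous_on_imp_continuous_on[OF abs_continuous_on_indefinite_integral[OF \<alpha>_int]])

text \<open>The formula for \<open>r\<close> is exactly the right-hand side of Gronwall's inequality
  with coefficients \<alpha> and \<beta> and initial value \<open>norm x0\<close>.\<close>

lemma r_gronwall_form:
  "r t = norm x0 * exp (LINT \<tau>:{0..t}|lebesgue. \<alpha> \<tau>) + (LINT s:{0..t}|lebesgue. \<beta> s * exp (LINT \<tau>:{s..t}|lebesgue. \<alpha> \<tau>))"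
  by (simp add: r_def r_fun_def e_fun_def \<alpha>_def \<beta>_def S_def)

lemma \<beta>E_int: "set_integrable lebesgue {0..T} (\<lambda>s. \<beta> s * exp (- A s))"
  by (rule set_integrable_mult_continuous[OF \<beta>_int]) (intro continuous_intros A_cont)

text \<open>Splitting the exponential takes \<open>t\<close> out of the integrand, which makes
  continuity and monotonicity of \<open>r\<close> visible.\<close>

lemma r_eq:
  assumes t: "t \<in> {0..T}"
  shows "r t = exp (A t) * (norm x0 + (LINT s:{0..t}|lebesgue. \<beta> s * exp (- A s)))"
proof -
  have "(LINT s:{0..t}|lebesgue. \<beta> s * exp (LINT \<tau>:{s..t}|lebesgue. \<alpha> \<tau>)) = (LINT s:{0..t}|lebesgue. exp (A t) * (\<beta> s * exp (- A s)))"
  proof (rule set_lebesgue_integral_cong)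
    show "\<forall>s. s \<in> {0..t} \<longrightarrow> \<beta> s * exp (LINT \<tau>:{s..t}|lebesgue. \<alpha> \<tau>) = exp (A t) * (\<beta> s * exp (- A s))"
    proof (intro allI impI)
      fix s assume s: "s \<in> {0..t}"
      have "(LINT \<tau>:{s..t}|lebesgue. \<alpha> \<tau>) = A t - A s" using A_diff[of s t] s t by simp
      then show "\<beta> s * exp (LINT \<tau>:{s..t}|lebesgue. \<alpha> \<tau>) = exp (A t) * (\<beta> s * exp (- A s))"
        by (simp add: exp_diff exp_minus divide_inverse)
    qed
  qed simp
  then show ?thesis unfolding r_gronwall_form by (simp add: A_def distrib_left mult.commute)
qed

lemma r_cont: "continuous_on {0..T} r"
proof -
  have "continuous_on {0..T} (\<lambda>t. 0 + (LINT s:{0..t}|lebesgue. \<beta> s * exp (- A s)))"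
    by (rule abs_continuous_on_imp_continuous_on[OF abs_continuous_on_indefinite_integral[OF \<beta>E_int]])
  then have "continuous_on {0..T} (\<lambda>t. exp (A t) * (norm x0 + (LINT s:{0..t}|lebesgue. \<beta> s * exp (- A s))))"
    by (intro continuous_intros A_cont) simp
  then show ?thesis by (rule continuous_on_eq) (simp add: r_eq)
qed

lemma r_mono: assumes st: "0 \<le> s" "s \<le> t" "t \<le> T" shows "r s \<le> r t"
proof -
  let ?I = "\<lambda>t. LINT s:{0..t}|lebesgue. \<beta> s * exp (- A s)"
  have nn: "0 \<le> (LINT \<tau>:{p..q}|lebesgue. \<beta> \<tau> * exp (- A \<tau>))" if "0 \<le> p" "q \<le> T" for p q
    by (rule set_integral_nonneg_Icc) (use \<beta>_nonneg that in auto)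
  have "?I s \<le> ?I t" using set_integral_Icc_split[OF \<beta>E_int st] nn[of s t] st by simp
  then have "exp (A s) * (norm x0 + ?I s) \<le> exp (A t) * (norm x0 + ?I t)"
    using A_mono[OF st] nn[of 0 s] st by (intro mult_mono) auto
  then show ?thesis using r_eq st by simp
qed

lemma r_nonneg: assumes "t \<in> {0..T}" shows "0 \<le> r t"
proof -
  have "0 \<le> (LINT s:{0..t}|lebesgue. \<beta> s * exp (- A s))"
    by (rule set_integral_nonneg_Icc) (use \<beta>_nonneg assms in auto)
  then show ?thesis using r_eq[OF assms] by simp
qed

lemma r_clamp_borel: "(\<lambda>s. r (max 0 (min s T))) \<in> borel_measurable borel"
  by (rule borel_measurable_mono, rule monoI, rule r_mono) (use T_pos in auto)

lemma \<psi>_eq: "\<psi> t = c t * r t + d t + S t + (LINT s:{0..t}|lebesgue. \<sigma> t s * r s)"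
  by (simp add: \<psi>_def psi_fun_def r_def S_def)

lemma \<psi>_int: "set_integrable lebesgue {0..T} \<psi>"
proof -
  \<comment> \<open>The clamped \<open>r\<close> is Borel on the whole line, as
    \<open>bounded_kernel_integrable\<close> requires.\<close>
  have "set_integrable lebesgue {0..T} (\<lambda>t. LINT s:{0..t}|lebesgue. \<sigma> t s * r (max 0 (min s T)))"
    by (rule bounded_kernel_integrable(2)[OF r_clamp_borel, where B="r T"])
      (use r_mono r_nonneg in \<open>auto simp: max_def min_def\<close>)
  moreover have "indicator {0..T} t *\<^sub>R (LINT s:{0..t}|lebesgue. \<sigma> t s * r (max 0 (min s T))) =
     indicator {0..T} t *\<^sub>R (LINT s:{0..t}|lebesgue. \<sigma> t s * r s)" for t
  proof (cases "t \<in> {0..T}")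
    case True
    have "(LINT s:{0..t}|lebesgue. \<sigma> t s * r (max 0 (min s T))) = (LINT s:{0..t}|lebesgue. \<sigma> t s * r s)"
      by (rule set_lebesgue_integral_cong) (use True in \<open>auto simp: max_def min_def\<close>)
    then show ?thesis by simp
  qed simp
  ultimately have "set_integrable lebesgue {0..T} (\<lambda>t. LINT s:{0..t}|lebesgue. \<sigma> t s * r s)"
    unfolding set_integrable_def by (simp only:)
  then show ?thesis unfolding \<psi>_eq
    by (intro set_integral_add d_int S_int set_integrable_mult_continuous[OF c_int r_cont])
qed

lemma \<psi>_ge: assumes t: "t \<in> {0..T}" shows "c t * r t + d t \<le> \<psi> t"
proof -
  have "0 \<le> (LINT s:{0..t}|lebesgue. \<sigma> t s * r s)"
    by (rule set_integral_nonneg_Icc, rule mult_nonneg_nonneg, rule g3_nonneg) (use t r_nonneg in \<open>auto simp: triangle_iff\<close>)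
  then show ?thesis using S_nonneg[OF t] by (simp add: \<psi>_eq)
qed

lemma \<psi>_nonneg: assumes t: "t \<in> {0..T}" shows "0 \<le> \<psi> t"
  using \<psi>_ge[OF t] mult_nonneg_nonneg[OF c_nonneg[OF t] r_nonneg[OF t]] d_nonneg[OF t] by linarith

lemma F0_in: "t \<in> {0..T} \<Longrightarrow> F0 t v \<in> F t v"
  unfolding F0_def using min_norm_point(1) F_values by blast

lemma F0_bound: "AE t in lebesgue. t \<in> {0..T} \<longrightarrow> (\<forall>v. norm (F0 t v) \<le> c t * norm v + d t)"
  using F3
proof eventually_elim
  case (elim t)
  show ?case
  proof (intro impI allI)
    fix v assume t: "t \<in> {0..T}"
    have "norm (F0 t v) = Inf (norm ` F t v)" unfolding F0_def using min_norm_point(2) F_values[OF t] by blast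
    then show "norm (F0 t v) \<le> c t * norm v + d t" using elim t by simp
  qed
qed

lemma F0_meas: "(\<lambda>t. indicator {0..T} t *\<^sub>R F0 t v) \<in> borel_measurable lebesgue"
  unfolding F0_def by (rule min_norm_point_measurable[OF F1]) (use F_values in auto)

text \<open>\<open>u\<close> is the velocity of the polygon \<open>x\<close>, and \<open>y t\<close> the value of \<open>x\<close> at the grid point preceding \<open>t\<close>.\<close>

definition euler :: "nat \<Rightarrow> (real \<Rightarrow> 'b) \<Rightarrow> (real \<Rightarrow> 'b) \<Rightarrow> (real \<Rightarrow> 'b) \<Rightarrow> bool" where
  "euler N x u y \<longleftrightarrow> set_integrable lebesgue {0..T} u \<and>
     (\<forall>t\<in>{0..T}. x t = x0 + (LINT s:{0..t}|lebesgue. u s)) \<and>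
     y \<in> borel_measurable borel \<and>
     (\<forall>t\<in>{0..T}. \<exists>s. 0 \<le> s \<and> s \<le> t \<and> t - s \<le> T / real N \<and> y t = x s) \<and>
     (\<forall>t\<in>{0..T}. u t = F0 t (y t) + K y t)"

text \<open>The memory term uses all earlier nodal values, so the recursion runs over whole
  sequences of nodes: \<open>P i\<close> is correct up to node \<open>i\<close>, and the diagonal
  \<open>p\<close> collects the correct entries.\<close>

lemma euler_exists:
  assumes N: "N > 0"
  shows "\<exists>x u y. euler N x u y"
proof -
  define \<tau> where "\<tau> i = T * real i / real N" for i :: nat
  define ix where "ix t = nat \<lfloor>real N * t / T\<rfloor>" for t :: real
  define Y where "Y p t = p (ix t)" for p :: "nat \<Rightarrow> 'b" and t
  define rhs where "rhs p t = F0 t (Y p t) + K (Y p) t" for p t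
  have ix_mono: "ix s \<le> ix t" if "s \<le> t" for s t
    using that N T_pos unfolding ix_def by (intro nat_mono floor_mono divide_right_mono mult_left_mono) auto
  have ixT: "ix T = N" using T_pos by (simp add: ix_def)
  have ix_le: "ix t \<le> N" if "t \<in> {0..T}" for t using ix_mono[of t T] ixT that by simp
  have ix_cell: "ix t = i" if "\<tau> i < t" "t < \<tau> (Suc i)" for i t
  proof -
    have "real i < real N * t / T" "real N * t / T < real i + 1"
      using that T_pos N by (auto simp: \<tau>_def field_simps)
    then have "\<lfloor>real N * t / T\<rfloor> = int i" by (simp add: floor_eq_iff)
    then show ?thesis by (simp add: ix_def)
  qed
  have ix_near: "0 \<le> \<tau> (ix t)" "\<tau> (ix t) \<le> t" "t - \<tau> (ix t) \<le> T / real N" if t: "t \<in> {0..T}" for t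
  proof -
    have nn: "0 \<le> real N * t / T" using t T_pos by simp
    have f1: "real (ix t) \<le> real N * t / T" "real N * t / T < real (ix t) + 1"
      using nn by (auto simp: ix_def of_nat_nat)
    show "0 \<le> \<tau> (ix t)" using T_pos by (simp add: \<tau>_def)
    show "\<tau> (ix t) \<le> t" using f1(1) T_pos N by (simp add: \<tau>_def field_simps)
    have "t * real N < T * (real (ix t) + 1)" using f1(2) T_pos by (simp add: field_simps)
    then have "t < T * (real (ix t) + 1) / real N" using N by (simp add: pos_less_divide_eq)
    also have "\<dots> = \<tau> (ix t) + T / real N" by (simp add: \<tau>_def add_divide_distrib distrib_left)
    finally show "t - \<tau> (ix t) \<le> T / real N" by simp
  qed
  have Ym: "Y p \<in> borel_measurable borel" for p unfolding Y_def ix_def by measurable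
  have Yb: "norm (Y p t) \<le> (\<Sum>i\<le>N. norm (p i))" if "t \<in> {0..T}" for p t
    unfolding Y_def by (rule member_le_sum) (use ix_le[OF that] in auto)
  have rhs_int: "set_integrable lebesgue {0..T} (rhs p)" for p
  proof -
    define B where "B = (\<Sum>i\<le>N. norm (p i))"
    have "set_integrable lebesgue {0..T} (\<lambda>t. F0 t (Y p t))"
    proof (rule set_integrable_bound[of _ _ "\<lambda>t. c t * B + d t"])
      show "set_integrable lebesgue {0..T} (\<lambda>t. c t * B + d t)" using c_int d_int by (intro set_integral_add) auto
      \<comment> \<open>Only finitely many frozen states occur, so measurability of
        \<open>F0 t v\<close> in \<open>t\<close> for each fixed \<open>v\<close> suffices.\<close>
      have "indicator {0..T} t *\<^sub>R F0 t (Y p t) = (\<Sum>i\<le>N. indicator {t. ix t = i} t *\<^sub>R (indicator {0..T} t *\<^sub>R F0 t (p i)))"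
        (is "?l t = ?r t") for t
      proof (cases "t \<in> {0..T}")
        case True
        have "?r t = (\<Sum>i\<le>N. if i = ix t then F0 t (p i) else 0)"
          using True by (intro sum.cong) (auto simp: indicator_def)
        also have "\<dots> = F0 t (p (ix t))" using ix_le[OF True] by simp
        finally show ?thesis using True by (simp add: Y_def)
      qed simp
      moreover have "(\<lambda>t. ?r t) \<in> borel_measurable lebesgue"
      proof (rule borel_measurable_sum, rule borel_measurable_scaleR[OF borel_measurable_indicator F0_meas])
        fix i
        have "{t. ix t = i} \<in> sets borel" unfolding ix_def by measurable
        then show "{t. ix t = i} \<in> sets lebesgue" by simp
      qed
      ultimately show "set_borel_measurable lebesgue {0..T} (\<lambda>t. F0 t (Y p t))"
        unfolding set_borel_measurable_def by presburger
      show "AE t in lebesgue. t \<in> {0..T} \<longrightarrow> norm (F0 t (Y p t)) \<le> norm (c t * B + d t)"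
        using F0_bound
      proof eventually_elim
        case (elim t)
        show ?case
        proof
          assume t: "t \<in> {0..T}"
          have "norm (F0 t (Y p t)) \<le> c t * norm (Y p t) + d t" using elim t by blast
          also have "\<dots> \<le> c t * B + d t" using Yb[OF t, of p] c_nonneg[OF t] by (simp add: B_def mult_left_mono)
          finally show "norm (F0 t (Y p t)) \<le> norm (c t * B + d t)" by simp
        qed
      qed
    qed
    moreover have "set_integrable lebesgue {0..T} (K (Y p))" by (rule K_integrable(2)[OF Ym]) (rule Yb)
    ultimately show ?thesis unfolding rhs_def by (rule set_integral_add)
  qed
  have rhs_cong: "rhs p t = rhs q t" if "\<And>j. j \<le> ix t \<Longrightarrow> p j = q j" for p q t
  proof -
    have "Y p s = Y q s" if "s \<le> t" for s using ix_mono[OF that] \<open>\<And>j. j \<le> ix t \<Longrightarrow> p j = q j\<close> by (simp add: Y_def)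
    then show ?thesis unfolding rhs_def using K_cong[of t "Y p" "Y q"] by simp
  qed
  \<comment> \<open>Entries beyond node \<open>i\<close> are still the placeholder
    \<open>x0\<close>. By \<open>rhs_cong\<close> they do not influence the integrand inside cell
    \<open>i\<close>, where \<open>ix\<close> equals \<open>i\<close>.\<close>
  define P where "P = rec_nat (\<lambda>_::nat. x0) (\<lambda>i f. f(Suc i := f i + (LINT s:{\<tau> i..\<tau> (Suc i)}|lebesgue. rhs f s)))"
  have P0: "P 0 = (\<lambda>_. x0)" and PS: "P (Suc i) = (P i)(Suc i := P i i + (LINT s:{\<tau> i..\<tau> (Suc i)}|lebesgue. rhs (P i) s))" for i
    by (simp_all add: P_def)
  define p where "p i = P i i" for i
  have Pp: "P i j = p j" if "j \<le> i" for i j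
    using that by (induction i) (auto simp: p_def PS le_Suc_eq)
  have pS: "p (Suc i) = p i + (LINT s:{\<tau> i..\<tau> (Suc i)}|lebesgue. rhs p s)" for i
  proof -
    have "(LINT s:{\<tau> i..\<tau> (Suc i)}|lebesgue. rhs (P i) s) = (LINT s:{\<tau> i..\<tau> (Suc i)}|lebesgue. rhs p s)"
      by (rule set_integral_Icc_cong_interior, rule rhs_cong) (use ix_cell Pp in auto)
    then show ?thesis by (simp add: p_def PS)
  qed
  define x where "x t = x0 + (LINT s:{0..t}|lebesgue. rhs p s)" for t
  have xp: "x (\<tau> i) = p i" if "i \<le> N" for i
    using that
  proof (induction i)
    case 0
    show ?case by (simp add: x_def \<tau>_def p_def P0)
  next
    case (Suc i)
    have "\<tau> (Suc i) \<le> T" using Suc.prems N T_pos by (simp add: \<tau>_def field_simps flip: of_nat_Suc)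
    moreover have "0 \<le> \<tau> i" "\<tau> i \<le> \<tau> (Suc i)" using T_pos by (auto simp: \<tau>_def divide_right_mono)
    ultimately have "x (\<tau> (Suc i)) = x (\<tau> i) + (LINT s:{\<tau> i..\<tau> (Suc i)}|lebesgue. rhs p s)"
      unfolding x_def using set_integral_Icc_split[OF rhs_int, of "\<tau> i" "\<tau> (Suc i)" p] by simp
    then show ?case using Suc pS by simp
  qed
  have "euler N x (rhs p) (Y p)"
    unfolding euler_def
  proof (intro conjI ballI rhs_int Ym)
    fix t assume t: "t \<in> {0..T}"
    show "\<exists>s. 0 \<le> s \<and> s \<le> t \<and> t - s \<le> T / real N \<and> Y p t = x s"
      using ix_near[OF t] xp[OF ix_le[OF t]] by (intro exI[of _ "\<tau> (ix t)"]) (simp add: Y_def)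
    show "x t = x0 + (LINT s:{0..t}|lebesgue. rhs p s)" by (rule x_def)
    show "rhs p t = F0 t (Y p t) + K (Y p) t" by (rule rhs_def)
  qed
  then show ?thesis by blast
qed

end

lemma AE_has_vector_derivative_if_indefinite_integral:
  fixes u :: "real \<Rightarrow> 'b::{banach,second_countable_topology}"
  assumes u: "set_integrable lebesgue {a..b} u" and x: "\<And>t. t \<in> {a..b} \<Longrightarrow> x t = z + (LINT s:{a..t}|lebesgue. u s)"
  shows "AE t in lebesgue. t \<in> {a..b} \<longrightarrow> (x has_vector_derivative u t) (at t within {a..b})"
  using AE_indefinite_integral_has_vector_derivative[OF u]
proof eventually_elim
  case (elim t)
  show ?case
  proof
    assume t: "t \<in> {a..b}"
    have "((\<lambda>s. z + (LINT \<tau>:{a..s}|lebesgue. u \<tau>)) has_vector_derivative (0 + u t)) (at t within {a..b})"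
      using elim t by (intro has_vector_derivative_add has_vector_derivative_const) auto
    then show "(x has_vector_derivative u t) (at t within {a..b})"
      by (intro has_vector_derivative_transform[OF t x]) auto
  qed
qed

section \<open>A priori bounds and mutual distance of Euler polygons\<close>

context integro_inclusion begin

lemma eulerD:
  assumes "euler N x u y"
  shows "set_integrable lebesgue {0..T} u" "\<And>t. t \<in> {0..T} \<Longrightarrow> x t = x0 + (LINT s:{0..t}|lebesgue. u s)"
    "y \<in> borel_measurable borel" "\<And>t. t \<in> {0..T} \<Longrightarrow> \<exists>s. 0 \<le> s \<and> s \<le> t \<and> t - s \<le> T / real N \<and> y t = x s"
    "\<And>t. t \<in> {0..T} \<Longrightarrow> u t = F0 t (y t) + K y t"
  using assms unfolding euler_def by blast+

lemma euler_diff: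
  assumes e: "euler N x u y" and st: "0 \<le> s" "s \<le> t" "t \<le> T"
  shows "norm (x t - x s) \<le> (LINT \<tau>:{s..t}|lebesgue. norm (u \<tau>))"
proof -
  note E = eulerD[OF e]
  have "x t - x s = (LINT \<tau>:{s..t}|lebesgue. u \<tau>)"
    using E(2)[of t] E(2)[of s] set_integral_Icc_split[OF E(1) st] st by simp
  then show ?thesis using set_integral_norm_bound[OF set_integrable_Icc_subset[OF E(1)], of s t] st by simp
qed

lemma euler_cont: assumes e: "euler N x u y" shows "continuous_on {0..T} x"
proof (rule abs_continuous_on_imp_continuous_on[OF abs_continuous_on_if_integral_bound])
  show "set_integrable lebesgue {0..T} (\<lambda>t. norm (u t))" by (rule set_integrable_norm[OF eulerD(1)[OF e]])
qed (use euler_diff[OF e] in auto)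

lemma euler_norm_le:
  assumes e: "euler N x u y" and t: "t \<in> {0..T}"
  shows "norm (x t) \<le> r t"
proof -
  note E = eulerD[OF e]
  define \<phi> where "\<phi> t = norm (x t)" for t
  have \<phi>: "continuous_on {0..T} \<phi>" unfolding \<phi>_def by (intro continuous_intros euler_cont[OF e])
  let ?R = "run_sup \<phi>"
  let ?\<rho> = "\<lambda>s. ?R (max 0 (min s T))"
  have \<rho>: "?\<rho> \<in> borel_measurable borel" by (rule run_sup_clamp_borel[OF \<phi>]) (use T_pos in simp)
  have y: "norm (y t) \<le> ?R t" if t: "t \<in> {0..T}" for t
  proof -
    obtain s where "0 \<le> s" "s \<le> t" "y t = x s" using E(4)[OF t] by blast
    then show ?thesis using run_sup_upper[OF \<phi>, of s t] t by (simp add: \<phi>_def)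
  qed
  have R0: "0 \<le> ?R t" if "t \<in> {0..T}" for t using order_trans[OF norm_ge_zero y[OF that]] .
  have clamp: "?\<rho> s = ?R s" if "s \<in> {0..T}" for s using that by (simp add: max_def min_def)
  have RB: "?\<rho> s \<le> ?R T" if "s \<in> {0..T}" for s unfolding clamp[OF that] by (rule run_sup_mono[OF \<phi>]) (use that in auto)
  have KB: "AE t in lebesgue. t \<in> {0..T} \<longrightarrow>
    norm (K y t) \<le> (LINT s:{0..t}|lebesgue. \<sigma> t s) + (LINT s:{0..t}|lebesgue. \<sigma> t s * ?\<rho> s)"
    by (rule K_bound[OF E(3) _ \<rho> RB]) (use y clamp in auto)
  have I1: "AE t in lebesgue. t \<in> {0..T} \<longrightarrow> set_integrable lebesgue {0..t} (\<lambda>s. \<sigma> t s * ?\<rho> s)"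
    by (rule bounded_kernel_integrable(1)[OF \<rho>, where B="?R T"]) (use RB R0 clamp in auto)
  have I2: "AE t in lebesgue. t \<in> {0..T} \<longrightarrow> set_integrable lebesgue {0..t} (\<lambda>s. \<sigma> t s)"
    using bounded_kernel_integrable(1)[of "\<lambda>_. 1" 1] by simp
  have ae: "AE t in lebesgue. t \<in> {0..T} \<longrightarrow> norm (u t) \<le> \<alpha> t * ?R t + \<beta> t"
    using KB I1 I2 F0_bound
  proof eventually_elim
    case (elim t)
    show ?case
    proof
      assume t: "t \<in> {0..T}"
      \<comment> \<open>The supremum at \<open>s\<close> is enlarged to the one at \<open>t\<close>,
        so that \<open>S t\<close> factors out of the memory integral.\<close>
      have "(LINT s:{0..t}|lebesgue. \<sigma> t s * ?\<rho> s) \<le> (LINT s:{0..t}|lebesgue. \<sigma> t s * ?R t)"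
      proof (rule set_integral_mono)
        show "set_integrable lebesgue {0..t} (\<lambda>s. \<sigma> t s * ?\<rho> s)" "set_integrable lebesgue {0..t} (\<lambda>s. \<sigma> t s * ?R t)"
          using elim t by auto
        fix s assume s: "s \<in> {0..t}"
        have "?\<rho> s \<le> ?R t" using s t clamp[of s] run_sup_mono[OF \<phi>, of s t] by simp
        then show "\<sigma> t s * ?\<rho> s \<le> \<sigma> t s * ?R t"
          using g3_nonneg[of t s] s t by (intro mult_left_mono) (auto simp: triangle_iff)
      qed
      also have "\<dots> = S t * ?R t" by (simp add: S_def)
      finally have 1: "norm (K y t) \<le> S t + S t * ?R t" using elim(1) t by (simp add: S_def)
      have "norm (F0 t (y t)) \<le> c t * norm (y t) + d t" using elim t by blast
      also have "\<dots> \<le> c t * ?R t + d t" using y[OF t] c_nonneg[OF t] by (simp add: mult_left_mono)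
      finally have 2: "norm (F0 t (y t)) \<le> c t * ?R t + d t" .
      have "norm (u t) \<le> norm (F0 t (y t)) + norm (K y t)" unfolding E(5)[OF t] by (rule norm_triangle_ineq)
      also have "\<dots> \<le> (c t * ?R t + d t) + (S t + S t * ?R t)" by (rule add_mono[OF 2 1])
      also have "\<dots> = \<alpha> t * ?R t + \<beta> t" by (simp add: \<alpha>_def \<beta>_def algebra_simps)
      finally show "norm (u t) \<le> \<alpha> t * ?R t + \<beta> t" .
    qed
  qed
  have \<alpha>R: "set_integrable lebesgue {0..T} (\<lambda>t. \<alpha> t * ?R t + \<beta> t)"
    by (intro set_integral_add run_sup_mult_integrable[OF \<phi> _ \<alpha>_int] \<beta>_int) (use T_pos in simp)
  have "?R t \<le> norm x0 * exp (LINT \<tau>:{0..t}|lebesgue. \<alpha> \<tau>) + (LINT s:{0..t}|lebesgue. \<beta> s * exp (LINT \<tau>:{s..t}|lebesgue. \<alpha> \<tau>))"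
  proof (rule gronwall_run_sup[OF \<phi> _ \<alpha>_int \<alpha>_nonneg \<beta>_int \<beta>_nonneg _ t])
    fix s assume s: "s \<in> {0..T}"
    have "norm (x s) \<le> norm x0 + norm (x s - x 0)"
      using norm_triangle_ineq[of x0 "x s - x 0"] E(2)[of 0] T_pos by simp
    also have "norm (x s - x 0) \<le> (LINT \<tau>:{0..s}|lebesgue. norm (u \<tau>))" by (rule euler_diff[OF e]) (use s in auto)
    also have "\<dots> \<le> (LINT \<tau>:{0..s}|lebesgue. \<alpha> \<tau> * ?R \<tau> + \<beta> \<tau>)"
    proof (rule set_integral_mono_AE)
      show "set_integrable lebesgue {0..s} (\<lambda>\<tau>. norm (u \<tau>))" "set_integrable lebesgue {0..s} (\<lambda>\<tau>. \<alpha> \<tau> * ?R \<tau> + \<beta> \<tau>)"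
        by (rule set_integrable_Icc_subset[OF set_integrable_norm[OF E(1)]] set_integrable_Icc_subset[OF \<alpha>R]; use s in simp)+
      show "AE \<tau>\<in>{0..s} in lebesgue. norm (u \<tau>) \<le> \<alpha> \<tau> * ?R \<tau> + \<beta> \<tau>"
        using ae by eventually_elim (use s in auto)
    qed
    finally show "\<phi> s \<le> norm x0 + (LINT \<tau>:{0..s}|lebesgue. \<alpha> \<tau> * ?R \<tau> + \<beta> \<tau>)" by (simp add: \<phi>_def)
  qed (simp_all add: \<phi>_def)
  then have "?R t \<le> r t" by (simp add: r_gronwall_form)
  then show ?thesis using run_sup_upper[OF \<phi>, of t t] t by (simp add: \<phi>_def)
qed

lemma euler_delayed_norm_le:
  assumes e: "euler N x u y" and t: "t \<in> {0..T}"
  shows "norm (y t) \<le> r t"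
proof -
  obtain s where "0 \<le> s" "s \<le> t" "y t = x s" using eulerD(4)[OF e t] by blast
  then show ?thesis using euler_norm_le[OF e, of s] r_mono[of s t] t by simp
qed

text \<open>The bound \<open>r\<close> is kept pointwise inside the integral instead of being
  replaced by its value at \<open>t\<close>; this produces the last two summands of \<psi>.\<close>

lemma K_le:
  assumes y: "y \<in> borel_measurable borel" and yr: "\<And>t. t \<in> {0..T} \<Longrightarrow> norm (y t) \<le> r t"
  shows "AE t in lebesgue. t \<in> {0..T} \<longrightarrow> norm (K y t) \<le> S t + (LINT s:{0..t}|lebesgue. \<sigma> t s * r s)"
proof -
  let ?\<rho> = "\<lambda>s. r (max 0 (min s T))"
  have clamp: "?\<rho> s = r s" if "s \<in> {0..T}" for s using that by (simp add: max_def min_def)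
  have "AE t in lebesgue. t \<in> {0..T} \<longrightarrow>
    norm (K y t) \<le> (LINT s:{0..t}|lebesgue. \<sigma> t s) + (LINT s:{0..t}|lebesgue. \<sigma> t s * ?\<rho> s)"
  proof (rule K_bound[OF y _ r_clamp_borel])
    fix s assume s: "s \<in> {0..T}"
    show "norm (y s) \<le> ?\<rho> s" using yr[OF s] clamp[OF s] by simp
    show "?\<rho> s \<le> r T" using r_mono[of s T] clamp[OF s] s by simp
  qed
  then show ?thesis
  proof eventually_elim
    case (elim t)
    show ?case
    proof
      assume t: "t \<in> {0..T}"
      have "(LINT s:{0..t}|lebesgue. \<sigma> t s * ?\<rho> s) = (LINT s:{0..t}|lebesgue. \<sigma> t s * r s)"
        by (rule set_lebesgue_integral_cong) (use t clamp in auto)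
      then show "norm (K y t) \<le> S t + (LINT s:{0..t}|lebesgue. \<sigma> t s * r s)" using elim t by (simp add: S_def)
    qed
  qed
qed

lemma euler_velocity_le:
  assumes e: "euler N x u y"
  shows "AE t in lebesgue. t \<in> {0..T} \<longrightarrow> norm (u t) \<le> \<psi> t"
  using K_le[OF eulerD(3)[OF e] euler_delayed_norm_le[OF e], simplified] F0_bound
proof eventually_elim
  case (elim t)
  show ?case
  proof
    assume t: "t \<in> {0..T}"
    have "norm (F0 t (y t)) \<le> c t * norm (y t) + d t" using elim t by blast
    also have "\<dots> \<le> c t * r t + d t" using euler_delayed_norm_le[OF e t] c_nonneg[OF t] by (simp add: mult_left_mono)
    finally have 2: "norm (F0 t (y t)) \<le> c t * r t + d t" .
    have "norm (u t) \<le> norm (F0 t (y t)) + norm (K y t)" unfolding eulerD(5)[OF e t] by (rule norm_triangle_ineq)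
    also have "\<dots> \<le> (c t * r t + d t) + (S t + (LINT s:{0..t}|lebesgue. \<sigma> t s * r s))"
      using elim(1) t by (intro add_mono[OF 2]) auto
    finally show "norm (u t) \<le> \<psi> t" by (simp add: \<psi>_eq)
  qed
qed

text \<open>A modulus of continuity common to all polygons and independent of the grid.\<close>

lemma euler_diff_le:
  assumes e: "euler N x u y" and st: "0 \<le> s" "s \<le> t" "t \<le> T"
  shows "norm (x t - x s) \<le> (LINT \<tau>:{s..t}|lebesgue. \<psi> \<tau>)"
proof -
  note E = eulerD[OF e]
  have "norm (x t - x s) \<le> (LINT \<tau>:{s..t}|lebesgue. norm (u \<tau>))" by (rule euler_diff[OF e st])
  also have "\<dots> \<le> (LINT \<tau>:{s..t}|lebesgue. \<psi> \<tau>)"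
  proof (rule set_integral_mono_AE[OF set_integrable_Icc_subset[OF set_integrable_norm[OF E(1)] st(1,3)] set_integrable_Icc_subset[OF \<psi>_int st(1,3)]])
    show "AE \<tau>\<in>{s..t} in lebesgue. norm (u \<tau>) \<le> \<psi> \<tau>"
      using euler_velocity_le[OF e] by eventually_elim (use st in auto)
  qed
  finally show ?thesis .
qed

lemma euler_ac: "euler N x u y \<Longrightarrow> abs_continuous_on 0 T x"
  by (rule abs_continuous_on_if_integral_bound[OF \<psi>_int \<psi>_nonneg euler_diff_le])

text \<open>\<open>M\<close> depends on \<epsilon> alone because the uniform continuity of one
  primitive of \<psi> serves all polygons at once.\<close>

lemma euler_delay:
  assumes "\<epsilon> > 0"
  obtains M where "\<And>N x u y t. N \<ge> M \<Longrightarrow> euler N x u y \<Longrightarrow> t \<in> {0..T} \<Longrightarrow> norm (x t - y t) \<le> \<epsilon>"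
proof -
  define \<Psi> where "\<Psi> t = 0 + (LINT \<tau>:{0..t}|lebesgue. \<psi> \<tau>)" for t
  have "continuous_on {0..T} \<Psi>" unfolding \<Psi>_def
    by (rule abs_continuous_on_imp_continuous_on[OF abs_continuous_on_indefinite_integral[OF \<psi>_int]])
  then have "uniformly_continuous_on {0..T} \<Psi>" by (rule compact_uniformly_continuous) simp
  then obtain \<delta> where \<delta>: "\<delta> > 0" "\<And>s t. s \<in> {0..T} \<Longrightarrow> t \<in> {0..T} \<Longrightarrow> dist t s < \<delta> \<Longrightarrow> dist (\<Psi> t) (\<Psi> s) < \<epsilon>"
    using assms unfolding uniformly_continuous_on_def by metis
  obtain M where M: "T / \<delta> < real M" using reals_Archimedean2 by blast
  show thesis
  proof (rule that)
    fix N x u y t assume N: "N \<ge> M" and e: "euler N x u y" and t: "t \<in> {0..T}"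
    obtain s where s: "0 \<le> s" "s \<le> t" "t - s \<le> T / real N" "y t = x s" using eulerD(4)[OF e t] by blast
    have "0 < T / \<delta>" using T_pos \<delta> by simp
    then have pos: "0 < real N" "T / \<delta> < real N" using M N by auto
    then have "T / real N < \<delta>" using \<delta>(1) by (simp add: field_simps)
    then have "dist t s < \<delta>" using s by (simp add: dist_real_def)
    then have "\<Psi> t - \<Psi> s < \<epsilon>" using \<delta>(2)[of s t] s t by (simp add: dist_real_def)
    moreover have "\<Psi> t - \<Psi> s = (LINT \<tau>:{s..t}|lebesgue. \<psi> \<tau>)"
      using set_integral_Icc_split[OF \<psi>_int, of s t] s t by (simp add: \<Psi>_def)
    ultimately show "norm (x t - y t) \<le> \<epsilon>" using euler_diff_le[OF e, of s t] s t by simp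
  qed
qed

lemma euler_diff_bound:
  obtains C where "C \<ge> 0" "\<And>N x u y M x' u' y' \<Omega> t. \<lbrakk>euler N x u y; euler M x' u' y'; 0 \<le> \<Omega>; \<Omega> \<le> 1;
     \<And>t. t \<in> {0..T} \<Longrightarrow> norm (x t - y t) + norm (x' t - y' t) \<le> \<Omega>; t \<in> {0..T}\<rbrakk>
     \<Longrightarrow> (norm (x t - x' t))\<^sup>2 \<le> C * \<Omega>"
proof -
  have rT: "0 \<le> r T" using r_nonneg T_pos by simp
  \<comment> \<open>Adding 1 keeps the radius positive, since \<open>r T\<close> may vanish.\<close>
  obtain \<mu> where \<mu>i: "set_integrable lebesgue {0..T} \<mu>" and \<mu>0: "\<forall>t\<in>{0..T}. \<mu> t \<ge> 0"
    and \<mu>: "\<forall>(t, s)\<in>triangle T. \<forall>x\<in>cball 0 (r T + 1). \<forall>y\<in>cball 0 (r T + 1). norm (g t s x - g t s y) \<le> \<mu> t * norm (x - y)"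
    using g2[of "r T + 1"] rT by auto
  \<comment> \<open>The absolute value serves twice: \<open>k\<close> may be negative while only
    upper bounds for the distance of the states are known, and Gronwall's inequality wants a
    nonnegative coefficient.\<close>
  define \<kappa> where "\<kappa> t = \<bar>k t\<bar> + \<mu> t * T" for t
  have \<kappa>i: "set_integrable lebesgue {0..T} \<kappa>" unfolding \<kappa>_def
    using \<mu>i k_int by (intro set_integral_add set_integrable_abs) auto
  have \<kappa>0: "0 \<le> \<kappa> t" if "t \<in> {0..T}" for t using \<mu>0 that T_pos by (simp add: \<kappa>_def)
  have \<kappa>4i: "set_integrable lebesgue {0..T} (\<lambda>t. 4 * \<kappa> t)" using \<kappa>i by simp
  define C0 where "C0 = (LINT t:{0..T}|lebesgue. 4 * \<kappa> t + 4 * \<psi> t)"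
  have \<kappa>\<psi>: "set_integrable lebesgue {0..T} (\<lambda>t. 4 * \<kappa> t + 4 * \<psi> t)" using \<kappa>i \<psi>_int by (intro set_integral_add) auto
  have \<kappa>\<psi>0: "0 \<le> 4 * \<kappa> t + 4 * \<psi> t" if "t \<in> {0..T}" for t using \<kappa>0[OF that] \<psi>_nonneg[OF that] by simp
  have C0: "C0 \<ge> 0" unfolding C0_def by (rule set_integral_nonneg_Icc[OF \<kappa>\<psi>0])
  define C where "C = C0 * exp (LINT t:{0..T}|lebesgue. 4 * \<kappa> t)"
  show thesis
  proof (rule that)
    show "C \<ge> 0" using C0 by (simp add: C_def)
    fix N x u y M x' u' y' \<Omega> t0
    assume e: "euler N x u y" and e': "euler M x' u' y'" and \<Omega>: "0 \<le> \<Omega>" "\<Omega> \<le> 1"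
      and del: "\<And>t. t \<in> {0..T} \<Longrightarrow> norm (x t - y t) + norm (x' t - y' t) \<le> \<Omega>" and t0: "t0 \<in> {0..T}"
    note E = eulerD[OF e] and E' = eulerD[OF e']
    define \<phi> where "\<phi> t = (norm (x t - x' t))\<^sup>2" for t
    have \<phi>: "continuous_on {0..T} \<phi>" unfolding \<phi>_def
      by (intro continuous_intros euler_cont[OF e] euler_cont[OF e'])
    let ?R = "run_sup \<phi>"
    have yb: "norm (y s) \<le> r T + 1" "norm (y' s) \<le> r T + 1" if "s \<in> {0..T}" for s
      using euler_delayed_norm_le[OF e that] euler_delayed_norm_le[OF e' that] r_mono[of s T] that by auto
    have KL: "AE t in lebesgue. t \<in> {0..T} \<longrightarrow> (\<forall>\<Delta>. (\<forall>s\<in>{0..t}. norm (y s - y' s) \<le> \<Delta>) \<longrightarrow> norm (K y t - K y' t) \<le> \<mu> t * T * \<Delta>)"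
      by (rule K_lipschitz[OF E(3) _ E'(3) _ \<mu>0 \<mu>]) (use yb in auto)
    have d1: "AE t in lebesgue. t \<in> {0..T} \<longrightarrow> (x has_vector_derivative u t) (at t within {0..T})"
      by (rule AE_has_vector_derivative_if_indefinite_integral[OF E(1) E(2)])
    have d2: "AE t in lebesgue. t \<in> {0..T} \<longrightarrow> (x' has_vector_derivative u' t) (at t within {0..T})"
      by (rule AE_has_vector_derivative_if_indefinite_integral[OF E'(1) E'(2)])
    \<comment> \<open>Twice the bound \<open>\<kappa> t * (2 * ?R t + 2 * \<Omega>) + 2 * \<psi> t *
      \<Omega>\<close> for the inner product of the velocity and state differences.\<close>
    let ?h = "\<lambda>t. 4 * \<kappa> t * ?R t + \<Omega> * (4 * \<kappa> t + 4 * \<psi> t)"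
    have \<kappa>R: "set_integrable lebesgue {0..T} (\<lambda>t. 4 * \<kappa> t * ?R t)"
      by (rule run_sup_mult_integrable[OF \<phi> _ \<kappa>4i]) (use T_pos in simp)
    have hi: "set_integrable lebesgue {0..T} ?h"
      using \<kappa>R \<kappa>\<psi> by (intro set_integral_add) auto
    have ae: "AE t in lebesgue. t \<in> {0..T} \<longrightarrow> (\<exists>D. ((\<lambda>t. x t - x' t) has_vector_derivative D) (at t within {0..T}) \<and> 2 * inner D (x t - x' t) \<le> ?h t)"
      using d1 d2 KL F5 F0_bound
    proof eventually_elim
      case (elim t)
      show ?case
      proof
        assume t: "t \<in> {0..T}"
        define \<rho> where "\<rho> = sqrt (?R t)"
        have R0: "0 \<le> ?R t" using order_trans[OF _ run_sup_upper[OF \<phi>, of t t]] t by (simp add: \<phi>_def)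
        have \<rho>2: "\<rho>\<^sup>2 = ?R t" and \<rho>0: "0 \<le> \<rho>" using R0 by (auto simp: \<rho>_def)
        have x\<rho>: "norm (x s - x' s) \<le> \<rho>" if "s \<in> {0..t}" for s
          unfolding \<rho>_def using run_sup_upper[OF \<phi>, of s t] that t by (intro real_le_rsqrt) (auto simp: \<phi>_def)
        have y\<rho>: "norm (y s - y' s) \<le> \<rho> + \<Omega>" if s: "s \<in> {0..t}" for s
        proof -
          have eq: "y s - y' s = (x s - x' s) - ((x s - y s) - (x' s - y' s))" by simp
          have "norm (y s - y' s) \<le> norm (x s - x' s) + (norm (x s - y s) + norm (x' s - y' s))"
            unfolding eq by (rule order_trans[OF norm_triangle_ineq4 add_left_mono[OF norm_triangle_ineq4]])
          also have "\<dots> \<le> \<rho> + \<Omega>" using x\<rho>[OF s] del[of s] s t by (intro add_mono) auto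
          finally show ?thesis .
        qed
        have tt: "t \<in> {0..t}" using t by simp
        let ?f = "F0 t (y t)" and ?f' = "F0 t (y' t)"
        have K1: "norm (K y t - K y' t) \<le> \<mu> t * T * (\<rho> + \<Omega>)" using elim(3) t y\<rho> by blast
        have F1: "norm ?f \<le> \<psi> t" "norm ?f' \<le> \<psi> t"
        proof -
          have "norm ?f \<le> c t * norm (y t) + d t" using elim t by blast
          also have "\<dots> \<le> c t * r t + d t" using euler_delayed_norm_le[OF e t] c_nonneg[OF t] by (simp add: mult_left_mono)
          finally show "norm ?f \<le> \<psi> t" using \<psi>_ge[OF t] by linarith
          have "norm ?f' \<le> c t * norm (y' t) + d t" using elim t by blast
          also have "\<dots> \<le> c t * r t + d t" using euler_delayed_norm_le[OF e' t] c_nonneg[OF t] by (simp add: mult_left_mono)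
          finally show "norm ?f' \<le> \<psi> t" using \<psi>_ge[OF t] by linarith
        qed
        have sq: "(\<rho> + \<Omega>)\<^sup>2 \<le> 2 * ?R t + 2 * \<Omega>"
        proof -
          have "(\<rho> + \<Omega>)\<^sup>2 + (\<rho> - \<Omega>)\<^sup>2 = 2 * \<rho>\<^sup>2 + 2 * \<Omega>\<^sup>2" by (simp add: power2_eq_square algebra_simps)
          moreover have "0 \<le> (\<rho> - \<Omega>)\<^sup>2" by simp
          moreover have "\<Omega>\<^sup>2 \<le> \<Omega>" using \<Omega> by (simp add: power2_eq_square mult_left_le)
          ultimately show ?thesis using \<rho>2 by linarith
        qed
        have i1: "inner (?f - ?f') (y t - y' t) \<le> \<bar>k t\<bar> * (\<rho> + \<Omega>)\<^sup>2"
        proof -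
          have "inner (?f - ?f') (y t - y' t) \<le> k t * (norm (y t - y' t))\<^sup>2"
            using elim(4) t F0_in[OF t] by blast
          also have "\<dots> \<le> \<bar>k t\<bar> * (\<rho> + \<Omega>)\<^sup>2"
            using y\<rho>[OF tt] by (intro mult_mono power_mono) auto
          finally show ?thesis .
        qed
        have i2: "inner (?f - ?f') ((x t - y t) - (x' t - y' t)) \<le> 2 * \<psi> t * \<Omega>"
        proof -
          have "inner (?f - ?f') ((x t - y t) - (x' t - y' t)) \<le> norm (?f - ?f') * norm ((x t - y t) - (x' t - y' t))"
            by (rule norm_cauchy_schwarz)
          also have "\<dots> \<le> (\<psi> t + \<psi> t) * \<Omega>"
            using order_trans[OF norm_triangle_ineq4 add_mono[OF F1]] order_trans[OF norm_triangle_ineq4 del[OF t]]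
              \<psi>_nonneg[OF t] by (intro mult_mono) auto
          finally show ?thesis by simp
        qed
        have i3: "inner (K y t - K y' t) (x t - x' t) \<le> \<mu> t * T * (\<rho> + \<Omega>)\<^sup>2"
        proof -
          have "inner (K y t - K y' t) (x t - x' t) \<le> norm (K y t - K y' t) * norm (x t - x' t)"
            by (rule norm_cauchy_schwarz)
          also have "\<dots> \<le> (\<mu> t * T * (\<rho> + \<Omega>)) * (\<rho> + \<Omega>)"
            using K1 x\<rho>[OF tt] \<Omega> \<rho>0 \<mu>0 t T_pos by (intro mult_mono) auto
          finally show ?thesis by (simp add: power2_eq_square mult.assoc)
        qed
        have "inner (u t - u' t) (x t - x' t) = inner (?f - ?f') (y t - y' t)
           + inner (?f - ?f') ((x t - y t) - (x' t - y' t)) + inner (K y t - K y' t) (x t - x' t)"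
          unfolding E(5)[OF t] E'(5)[OF t] by (simp add: inner_diff inner_add algebra_simps)
        also have "\<dots> \<le> \<bar>k t\<bar> * (\<rho> + \<Omega>)\<^sup>2 + 2 * \<psi> t * \<Omega> + \<mu> t * T * (\<rho> + \<Omega>)\<^sup>2"
          by (intro add_mono i1 i2 i3)
        also have "\<dots> = \<kappa> t * (\<rho> + \<Omega>)\<^sup>2 + 2 * \<psi> t * \<Omega>" by (simp add: \<kappa>_def algebra_simps)
        also have "\<dots> \<le> \<kappa> t * (2 * ?R t + 2 * \<Omega>) + 2 * \<psi> t * \<Omega>"
          using mult_left_mono[OF sq \<kappa>0[OF t]] by simp
        finally have "2 * inner (u t - u' t) (x t - x' t) \<le> ?h t" by (simp add: algebra_simps)
        moreover have "((\<lambda>t. x t - x' t) has_vector_derivative (u t - u' t)) (at t within {0..T})"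
          using elim(1,2) t by (intro has_vector_derivative_diff) auto
        ultimately show "\<exists>D. ((\<lambda>t. x t - x' t) has_vector_derivative D) (at t within {0..T}) \<and> 2 * inner D (x t - x' t) \<le> ?h t"
          by blast
      qed
    qed
    have le: "\<phi> t \<le> \<Omega> * C0 + (LINT s:{0..t}|lebesgue. 4 * \<kappa> s * ?R s + 0)" if t: "t \<in> {0..T}" for t
    proof -
      have "(norm (x t - x' t))\<^sup>2 - (norm (x 0 - x' 0))\<^sup>2 \<le> (LINT s:{0..t}|lebesgue. ?h s)"
        by (rule norm_square_diff_le_integral[OF abs_continuous_on_diff[OF euler_ac[OF e] euler_ac[OF e']] hi ae]) (use t in auto)
      moreover have "x 0 = x' 0" using E(2)[of 0] E'(2)[of 0] T_pos by simp
      ultimately have "\<phi> t \<le> (LINT s:{0..t}|lebesgue. ?h s)" by (simp add: \<phi>_def)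
      also have "\<dots> = (LINT s:{0..t}|lebesgue. 4 * \<kappa> s * ?R s) + (LINT s:{0..t}|lebesgue. \<Omega> * (4 * \<kappa> s + 4 * \<psi> s))"
      proof (rule set_integral_add)
        have "set_integrable lebesgue {0..T} (\<lambda>s. \<Omega> * (4 * \<kappa> s + 4 * \<psi> s))" using \<kappa>\<psi> by (rule set_integrable_mult_right)
        then show "set_integrable lebesgue {0..t} (\<lambda>s. \<Omega> * (4 * \<kappa> s + 4 * \<psi> s))" by (rule set_integrable_Icc_subset) (use t in auto)
        show "set_integrable lebesgue {0..t} (\<lambda>s. 4 * \<kappa> s * ?R s)" by (rule set_integrable_Icc_subset[OF \<kappa>R]) (use t in auto)
      qed
      also have "(LINT s:{0..t}|lebesgue. \<Omega> * (4 * \<kappa> s + 4 * \<psi> s)) = \<Omega> * (LINT s:{0..t}|lebesgue. 4 * \<kappa> s + 4 * \<psi> s)"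
        by (rule set_integral_mult_right)
      also have "\<dots> \<le> \<Omega> * C0"
      proof (rule mult_left_mono[OF _ \<Omega>(1)])
        have "0 \<le> (LINT s:{t..T}|lebesgue. 4 * \<kappa> s + 4 * \<psi> s)" by (rule set_integral_nonneg_Icc[OF \<kappa>\<psi>0]) (use t in auto)
        then show "(LINT s:{0..t}|lebesgue. 4 * \<kappa> s + 4 * \<psi> s) \<le> C0"
          unfolding C0_def using set_integral_Icc_split[OF \<kappa>\<psi>, of t T] t by simp
      qed
      finally show ?thesis by simp
    qed
    \<comment> \<open>Gronwall's inequality with inhomogeneity 0: everything proportional to
      \<Omega> already sits in the constant \<open>\<Omega> * C0\<close>.\<close>
    have "?R t0 \<le> \<Omega> * C0 * exp (LINT s:{0..t0}|lebesgue. 4 * \<kappa> s) + (LINT s:{0..t0}|lebesgue. 0 * exp (LINT q:{s..t0}|lebesgue. 4 * \<kappa> q))"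
      by (rule gronwall_run_sup[OF \<phi> _ \<kappa>4i _ _ _ le t0]) (use \<kappa>0 in \<open>auto simp: \<phi>_def\<close>)
    then have "?R t0 \<le> \<Omega> * C0 * exp (LINT s:{0..t0}|lebesgue. 4 * \<kappa> s)" by simp
    also have "\<dots> \<le> \<Omega> * C0 * exp (LINT s:{0..T}|lebesgue. 4 * \<kappa> s)"
    proof (rule mult_left_mono)
      have "0 \<le> (LINT s:{t0..T}|lebesgue. 4 * \<kappa> s)" by (rule set_integral_nonneg_Icc) (use t0 \<kappa>0 in auto)
      then show "exp (LINT s:{0..t0}|lebesgue. 4 * \<kappa> s) \<le> exp (LINT s:{0..T}|lebesgue. 4 * \<kappa> s)"
        using set_integral_Icc_split[OF \<kappa>4i, of t0 T] t0 by simp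
    qed (use \<Omega> C0 in simp)
    also have "\<dots> = C * \<Omega>" by (simp add: C_def)
    finally show "(norm (x t0 - x' t0))\<^sup>2 \<le> C * \<Omega>"
      using run_sup_upper[OF \<phi>, of t0 t0] t0 by (simp add: \<phi>_def)
  qed
qed

end

section \<open>Passage to the limit\<close>

lemma mono_imp_deriv_nonneg:
  fixes f :: "real \<Rightarrow> real"
  assumes d: "(f has_vector_derivative D) (at t within {a..b})" and t: "t \<in> {a..b}" and ab: "a < b"
    and mono: "\<And>p q. a \<le> p \<Longrightarrow> p \<le> q \<Longrightarrow> q \<le> b \<Longrightarrow> f p \<le> f q"
  shows "0 \<le> D"
proof -
  have "((\<lambda>s. (f s - f t) / (s - t)) \<longlongrightarrow> D) (at t within {a..b})"
    using d unfolding has_real_derivative_iff_has_vector_derivative[symmetric] has_field_derivative_iff .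
  moreover have "eventually (\<lambda>s. 0 \<le> (f s - f t) / (s - t)) (at t within {a..b})"
    unfolding eventually_at_filter
  proof (rule always_eventually, intro allI impI)
    fix s assume s: "s \<noteq> t" "s \<in> {a..b}"
    show "0 \<le> (f s - f t) / (s - t)"
    proof (cases "s < t")
      case True
      then have "f s \<le> f t" using mono[of s t] s t by simp
      then show ?thesis using True by (simp add: divide_nonpos_neg)
    next
      case False
      then have "f t \<le> f s" using mono[of t s] s t by simp
      then show ?thesis using False by simp
    qed
  qed
  moreover have "at t within {a..b} \<noteq> bot"
    using t ab by (simp add: trivial_limit_within islimpt_Icc)
  ultimately show ?thesis by (intro tendsto_lowerbound)
qed

text \<open>Pairing the increments with the fixed vector \<open>u\<close> avoids differentiating a
  norm: \<open>norm u * \<Psi> s - inner (x s) u\<close> is nondecreasing, with derivative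
  \<open>norm u * m - (norm u)\<^sup>2\<close> at \<open>t\<close>.\<close>

lemma norm_deriv_le:
  fixes x :: "real \<Rightarrow> 'b::real_inner"
  assumes x: "(x has_vector_derivative u) (at t within {a..b})" and \<Psi>: "(\<Psi> has_vector_derivative m) (at t within {a..b})"
    and t: "t \<in> {a..b}" and ab: "a < b"
    and le: "\<And>p q. a \<le> p \<Longrightarrow> p \<le> q \<Longrightarrow> q \<le> b \<Longrightarrow> norm (x q - x p) \<le> \<Psi> q - \<Psi> p"
  shows "norm u \<le> m"
proof -
  define \<theta> where "\<theta> s = norm u * \<Psi> s - inner (x s) u" for s
  have "(\<theta> has_vector_derivative (norm u * m - inner u u)) (at t within {a..b})"
    unfolding \<theta>_def using x \<Psi> unfolding has_vector_derivative_def
    by (auto intro!: derivative_eq_intros simp: algebra_simps)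
  then have "0 \<le> norm u * m - inner u u"
  proof (rule mono_imp_deriv_nonneg[OF _ t ab])
    fix p q assume pq: "a \<le> p" "p \<le> q" "q \<le> b"
    have "inner (x q - x p) u \<le> norm (x q - x p) * norm u" by (rule norm_cauchy_schwarz)
    also have "\<dots> \<le> (\<Psi> q - \<Psi> p) * norm u" using le[OF pq] by (simp add: mult_right_mono)
    finally show "\<theta> p \<le> \<theta> q" by (simp add: \<theta>_def inner_diff_left algebra_simps)
  qed
  then have *: "norm u * norm u \<le> norm u * m" by (simp add: power2_norm_eq_inner[symmetric] power2_eq_square)
  show ?thesis
  proof (cases "u = 0")
    case True
    \<comment> \<open>For \<open>u = 0\<close> the pairing carries no information; monotonicity of
      \<Psi> itself settles the case.\<close>
    have "0 \<le> m" by (rule mono_imp_deriv_nonneg[OF \<Psi> t ab]) (use le norm_ge_zero in \<open>smt (verit)\<close>)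
    then show ?thesis using True by simp
  next
    case False
    then show ?thesis using * by simp
  qed
qed

text \<open>Open half-spaces are the weakly open sets against which Minty's argument uses
  semicontinuity.\<close>

lemma weakly_open_halfspace: "weakly_open {w. inner w e < b}"
  unfolding weakly_open_def
proof
  fix x assume x: "x \<in> {w. inner w e < b}"
  have "{y. \<forall>z\<in>{e}. \<bar>inner (y - x) z\<bar> < b - inner x e} \<subseteq> {w. inner w e < b}"
    by (auto simp: inner_diff_left)
  then show "\<exists>Z \<epsilon>. finite Z \<and> \<epsilon> > 0 \<and> {y. \<forall>z\<in>Z. \<bar>inner (y - x) z\<bar> < \<epsilon>} \<subseteq> {w. inner w e < b}"
    using x by (intro exI[of _ "{e}"] exI[of _ "b - inner x e"]) auto
qed

text \<open>Minty's argument: if \<open>z\<close> were separated from \<open>\<Phi> x\<close> by \<open>e\<close>, then testing the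
  monotonicity inequality at points near \<open>x - s e\<close> and letting \<open>s\<close> tend to \<open>0\<close> would contradict
  upper semicontinuity.\<close>

lemma usc_weak_minty:
  fixes \<Phi> :: "'b::{real_inner,complete_space} \<Rightarrow> 'b set"
  assumes usc: "usc_weak \<Phi>" and val: "\<Phi> x \<noteq> {}" "closed (\<Phi> x)" "convex (\<Phi> x)"
    and f: "\<And>v. f v \<in> \<Phi> v" "\<And>v. norm (f v) \<le> c * norm v + d" and cd: "c \<ge> 0"
    and V: "\<And>U. open U \<Longrightarrow> U \<noteq> {} \<Longrightarrow> \<exists>v\<in>V. v \<in> U"
    and mono: "\<And>v. v \<in> V \<Longrightarrow> inner (z - f v) (x - v) \<le> \<kappa> * (norm (x - v))\<^sup>2"
  shows "z \<in> \<Phi> x"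
proof (rule ccontr)
  assume "z \<notin> \<Phi> x"
  then obtain e \<delta> where \<delta>: "\<delta> > 0" and sep: "\<And>w. w \<in> \<Phi> x \<Longrightarrow> inner w e \<le> inner z e - \<delta>"
    using closed_convex_separation[OF val] by metis
  have "\<Phi> x \<subseteq> {w. inner w e < inner z e - \<delta>/2}" using sep \<delta> by fastforce
  then have "\<exists>\<eta>>0. \<forall>y. norm (y - x) < \<eta> \<longrightarrow> \<Phi> y \<subseteq> {w. inner w e < inner z e - \<delta>/2}"
    by (intro usc[unfolded usc_weak_def, THEN spec, THEN spec, THEN mp] conjI weakly_open_halfspace)
  then obtain \<eta> where \<eta>: "\<eta> > 0" "\<And>y. norm (y - x) < \<eta> \<Longrightarrow> \<Phi> y \<subseteq> {w. inner w e < inner z e - \<delta>/2}"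
    by blast
  \<comment> \<open>\<open>M\<close> bounds \<open>norm (z - f v)\<close> for the test points, and
    \<open>L\<close> collects the coefficients of all terms quadratic in \<open>s\<close>.\<close>
  define M where "M = norm z + (c * (norm x + norm e + 1) + d)"
  define L where "L = \<bar>M\<bar> + \<bar>\<kappa>\<bar> * (norm e + 1)\<^sup>2 + 1"
  have L: "L > 0" "\<bar>M\<bar> + \<bar>\<kappa>\<bar> * (norm e + 1)\<^sup>2 \<le> L" by (auto simp: L_def add_nonneg_pos)
  \<comment> \<open>Small enough to keep the test point within \<eta> of \<open>x\<close> and the
    quadratic terms below a quarter of \<open>s * \<delta>\<close>, against the half of it that the
    separation yields.\<close>
  define s where "s = min 1 (min (\<eta> / (norm e + 2)) (\<delta> / (4 * L)))"
  have ne: "norm e + 2 > 0" by (simp add: add_nonneg_pos)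
  have s0: "s > 0" using \<eta> \<delta> L ne by (simp add: s_def)
  have s1: "s \<le> 1" by (simp add: s_def)
  have "s \<le> \<eta> / (norm e + 2)" by (simp add: s_def)
  then have s2: "s * (norm e + 2) \<le> \<eta>" using ne by (simp add: pos_le_divide_eq)
  have "s \<le> \<delta> / (4 * L)" by (simp add: s_def)
  then have s3: "s * L \<le> \<delta> / 4" using L by (simp add: pos_le_divide_eq algebra_simps)
  \<comment> \<open>\<open>V\<close> is only dense, so the ideal point
    \<open>x - s *\<^sub>R e\<close> is missed by a vector \<open>p\<close>; an error of size
    \<open>s\<^sup>2\<close> is harmless in a comparison of first order in \<open>s\<close>.\<close>
  obtain v where v: "v \<in> V" "v \<in> ball (x - s *\<^sub>R e) (s\<^sup>2)"
    using V[of "ball (x - s *\<^sub>R e) (s\<^sup>2)"] s0 by auto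
  define p where "p = x - v - s *\<^sub>R e"
  have p: "norm p < s\<^sup>2" using v(2) by (simp add: p_def dist_norm algebra_simps)
  have xv: "x - v = s *\<^sub>R e + p" by (simp add: p_def)
  have ss: "s\<^sup>2 \<le> s" using s0 s1 by (simp add: power2_eq_square mult_left_le)
  have nxv: "norm (x - v) \<le> s * (norm e + 1)"
    unfolding xv using norm_triangle_ineq[of "s *\<^sub>R e" p] p ss s0 by (simp add: distrib_left)
  have "norm (v - x) < \<eta>"
  proof -
    have "s * (norm e + 1) < s * (norm e + 2)" using s0 by simp
    then show ?thesis using nxv s2 by (simp add: norm_minus_commute)
  qed
  then have fv: "inner (f v) e < inner z e - \<delta>/2" using \<eta>(2)[of v] f(1)[of v] by blast
  have nv: "norm v \<le> norm x + norm e + 1"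
  proof -
    have "norm v \<le> norm x + norm (x - v)" using norm_triangle_ineq4[of x "x - v"] by simp
    also have "norm (x - v) \<le> 1 * (norm e + 1)"
      by (rule order_trans[OF nxv mult_right_mono[OF s1]]) simp
    finally show ?thesis by simp
  qed
  have zf: "norm (z - f v) \<le> M"
  proof -
    have "norm (f v) \<le> c * (norm x + norm e + 1) + d"
      using f(2)[of v] mult_left_mono[OF nv cd] by linarith
    then show ?thesis unfolding M_def by (rule order_trans[OF norm_triangle_ineq4 add_left_mono])
  qed
  have "s * (\<delta>/2) < s * inner (z - f v) e" using fv s0 by (simp add: inner_diff_left)
  also have "\<dots> = inner (z - f v) (x - v) - inner (z - f v) p" unfolding xv by (simp add: inner_add_right)
  also have "\<dots> \<le> \<kappa> * (norm (x - v))\<^sup>2 + norm (z - f v) * norm p"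
    using mono[OF v(1)] Cauchy_Schwarz_ineq2[of "z - f v" p] by (simp add: abs_le_iff)
  also have "\<dots> \<le> \<bar>\<kappa>\<bar> * (s * (norm e + 1))\<^sup>2 + \<bar>M\<bar> * s\<^sup>2"
    using nxv zf p by (intro add_mono mult_mono power_mono) auto
  also have "\<dots> = s * (s * (\<bar>M\<bar> + \<bar>\<kappa>\<bar> * (norm e + 1)\<^sup>2))" by (simp add: power2_eq_square algebra_simps)
  also have "\<dots> \<le> s * (s * L)" using L(2) s0 by (intro mult_left_mono) auto
  also have "\<dots> \<le> s * (\<delta>/4)" using s3 s0 by (intro mult_left_mono) auto
  finally have "\<delta>/2 < \<delta>/4" by (simp only: mult_less_cancel_left_pos[OF s0])
  then show False using \<delta> by simp
qed

section \<open>Uniform limit of the polygons and the tested inequality\<close>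

context integro_inclusion begin

lemma euler_limit:
  obtains X U Y x where "\<And>n. euler (Suc n) (X n) (U n) (Y n)"
    "uniform_limit {0..T} X x sequentially" "uniform_limit {0..T} Y x sequentially"
proof -
  have "\<forall>n. \<exists>q. euler (Suc n) (fst q) (fst (snd q)) (snd (snd q))" using euler_exists by force
  then obtain q where q: "\<And>n. euler (Suc n) (fst (q n)) (fst (snd (q n))) (snd (snd (q n)))" by metis
  define X where "X n = fst (q n)" for n
  define U where "U n = fst (snd (q n))" for n
  define Y where "Y n = snd (snd (q n))" for n
  have e: "euler (Suc n) (X n) (U n) (Y n)" for n using q by (simp add: X_def U_def Y_def)
  obtain C where C: "C \<ge> 0" "\<And>N x u y M x' u' y' \<Omega> t. \<lbrakk>euler N x u y; euler M x' u' y'; 0 \<le> \<Omega>; \<Omega> \<le> 1;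
     \<And>t. t \<in> {0..T} \<Longrightarrow> norm (x t - y t) + norm (x' t - y' t) \<le> \<Omega>; t \<in> {0..T}\<rbrakk>
     \<Longrightarrow> (norm (x t - x' t))\<^sup>2 \<le> C * \<Omega>"
    by (rule euler_diff_bound) blast
  have "uniformly_Cauchy_on {0..T} X"
    unfolding uniformly_Cauchy_on_def
  proof (intro allI impI)
    fix \<epsilon> :: real assume \<epsilon>: "\<epsilon> > 0"
    define \<Omega> where "\<Omega> = min 1 (\<epsilon>\<^sup>2 / (C + 1))"
    have \<Omega>: "0 < \<Omega>" "\<Omega> \<le> 1" using \<epsilon> C by (auto simp: \<Omega>_def)
    have "\<Omega> \<le> \<epsilon>\<^sup>2 / (C + 1)" by (simp add: \<Omega>_def)
    then have "\<Omega> * (C + 1) \<le> \<epsilon>\<^sup>2" using C by (simp add: pos_le_divide_eq)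
    then have C\<Omega>: "C * \<Omega> < \<epsilon>\<^sup>2" using \<Omega> by (simp add: algebra_simps)
    have "\<Omega>/2 > 0" using \<Omega> by simp
    then obtain M where M: "\<And>N x u y t. N \<ge> M \<Longrightarrow> euler N x u y \<Longrightarrow> t \<in> {0..T} \<Longrightarrow> norm (x t - y t) \<le> \<Omega>/2"
      by (rule euler_delay) blast
    have "dist (X m t) (X n t) < \<epsilon>" if "t \<in> {0..T}" "m \<ge> M" "n \<ge> M" for t m n
    proof -
      have "(norm (X m t - X n t))\<^sup>2 \<le> C * \<Omega>"
      proof (rule C(2)[OF e e])
        fix s assume s: "s \<in> {0..T}"
        show "norm (X m s - Y m s) + norm (X n s - Y n s) \<le> \<Omega>"
          using M[OF _ e s, of m] M[OF _ e s, of n] that by simp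
      qed (use \<Omega> that in auto)
      then have "(norm (X m t - X n t))\<^sup>2 < \<epsilon>\<^sup>2" using C\<Omega> by linarith
      then show ?thesis unfolding dist_norm by (rule power_less_imp_less_base) (use \<epsilon> in simp)
    qed
    then show "\<exists>M. \<forall>t\<in>{0..T}. \<forall>m\<ge>M. \<forall>n\<ge>M. dist (X m t) (X n t) < \<epsilon>" by blast
  qed
  then have "uniformly_convergent_on {0..T} X" by (rule Cauchy_uniformly_convergent)
  then obtain x where x: "uniform_limit {0..T} X x sequentially" by (auto simp: uniformly_convergent_on_def)
  have "uniform_limit {0..T} Y x sequentially"
    unfolding uniform_limit_iff
  proof (intro allI impI)
    fix \<epsilon> :: real assume \<epsilon>: "\<epsilon> > 0"
    then have e2: "\<epsilon>/2 > 0" by simp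
    then obtain M where M: "\<And>N x u y t. N \<ge> M \<Longrightarrow> euler N x u y \<Longrightarrow> t \<in> {0..T} \<Longrightarrow> norm (x t - y t) \<le> \<epsilon>/2"
      by (rule euler_delay) blast
    have "\<forall>\<^sub>F n in sequentially. \<forall>t\<in>{0..T}. dist (X n t) (x t) < \<epsilon>/2"
      using x[unfolded uniform_limit_iff, THEN spec, THEN mp, OF e2] .
    moreover have "\<forall>\<^sub>F n in sequentially. n \<ge> M" by (rule eventually_ge_at_top)
    ultimately show "\<forall>\<^sub>F n in sequentially. \<forall>t\<in>{0..T}. dist (Y n t) (x t) < \<epsilon>"
    proof eventually_elim
      case (elim n)
      show ?case
      proof
        fix t assume t: "t \<in> {0..T}"
        have "dist (Y n t) (X n t) \<le> \<epsilon>/2" using M[OF _ e t, of n] elim(2) by (simp add: dist_norm norm_minus_commute)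
        moreover have "dist (X n t) (x t) < \<epsilon>/2" using elim(1) t by blast
        ultimately show "dist (Y n t) (x t) < \<epsilon>" using dist_triangle[of "Y n t" "x t" "X n t"] by linarith
      qed
    qed
  qed
  then show thesis using e x that by blast
qed

text \<open>Each \<open>n\<close> has its own null set in the Lipschitz estimate; countably many of
  them merge into one.\<close>

lemma K_tendsto:
  assumes Y: "\<And>n. Y n \<in> borel_measurable borel" "\<And>n t. t \<in> {0..T} \<Longrightarrow> norm (Y n t) \<le> B"
    and z: "z \<in> borel_measurable borel" "\<And>t. t \<in> {0..T} \<Longrightarrow> norm (z t) \<le> B"
    and lim: "uniform_limit {0..T} Y z sequentially"
  shows "AE t in lebesgue. t \<in> {0..T} \<longrightarrow> (\<lambda>n. K (Y n) t) \<longlonglongrightarrow> K z t"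
proof -
  have "\<bar>B\<bar> + 1 > 0" by simp
  then obtain \<mu> where \<mu>0: "\<forall>t\<in>{0..T}. \<mu> t \<ge> 0"
    and \<mu>: "\<forall>(t, s)\<in>triangle T. \<forall>x\<in>cball 0 (\<bar>B\<bar> + 1). \<forall>y\<in>cball 0 (\<bar>B\<bar> + 1). norm (g t s x - g t s y) \<le> \<mu> t * norm (x - y)"
    using g2 by blast
  have Yb: "norm (Y n t) \<le> \<bar>B\<bar> + 1" and zb: "norm (z t) \<le> \<bar>B\<bar> + 1" if "t \<in> {0..T}" for n t
    using Y(2)[OF that, of n] z(2)[OF that] by linarith+
  have "AE t in lebesgue. t \<in> {0..T} \<longrightarrow> (\<forall>\<Delta>. (\<forall>s\<in>{0..t}. norm (Y n s - z s) \<le> \<Delta>) \<longrightarrow> norm (K (Y n) t - K z t) \<le> \<mu> t * T * \<Delta>)" for n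
    by (rule K_lipschitz[OF Y(1) _ z(1) _ \<mu>0 \<mu>]) (use Yb zb in auto)
  then have "AE t in lebesgue. \<forall>n. t \<in> {0..T} \<longrightarrow> (\<forall>\<Delta>. (\<forall>s\<in>{0..t}. norm (Y n s - z s) \<le> \<Delta>) \<longrightarrow> norm (K (Y n) t - K z t) \<le> \<mu> t * T * \<Delta>)"
    unfolding AE_all_countable by blast
  then show ?thesis
  proof eventually_elim
    case (elim t)
    note lip = elim
    show ?case
    proof
      assume t: "t \<in> {0..T}"
      show "(\<lambda>n. K (Y n) t) \<longlonglongrightarrow> K z t"
        unfolding tendsto_iff
      proof (intro allI impI)
        fix \<epsilon> :: real assume \<epsilon>: "\<epsilon> > 0"
        \<comment> \<open>The summand 1 keeps the denominator positive where \<open>\<mu> t\<close>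
          is 0.\<close>
        define \<Delta> where "\<Delta> = \<epsilon> / (\<mu> t * T + 1)"
        have pos: "\<mu> t * T + 1 > 0" using \<mu>0 t T_pos by (simp add: add_nonneg_pos)
        have \<Delta>: "\<Delta> > 0" using \<epsilon> pos by (simp add: \<Delta>_def)
        have "\<mu> t * T * \<Delta> < (\<mu> t * T + 1) * \<Delta>" using \<Delta> by (intro mult_strict_right_mono) auto
        also have "\<dots> = \<epsilon>" using pos by (simp add: \<Delta>_def)
        finally have small: "\<mu> t * T * \<Delta> < \<epsilon>" .
        have "\<forall>\<^sub>F n in sequentially. \<forall>s\<in>{0..T}. dist (Y n s) (z s) < \<Delta>"
          using lim[unfolded uniform_limit_iff, THEN spec, THEN mp, OF \<Delta>] .
        then show "\<forall>\<^sub>F n in sequentially. dist (K (Y n) t) (K z t) < \<epsilon>"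
        proof eventually_elim
          case (elim n)
          have "\<forall>s\<in>{0..t}. norm (Y n s - z s) \<le> \<Delta>" using elim t by (auto simp: dist_norm less_imp_le)
          then have "norm (K (Y n) t - K z t) \<le> \<mu> t * T * \<Delta>" using lip t by blast
          then show ?case using small by (simp add: dist_norm)
        qed
      qed
    qed
  qed
qed

text \<open>In the derivative of the squared distance from \<open>X n\<close> to \<open>v\<close>,
  subtracting and adding \<open>F0 t v\<close> lets \<open>F5\<close> eliminate
  \<open>F0 t (Y n t)\<close>, which need not converge. There remain \<open>F0 t v\<close>, memory
  terms and states, all convergent almost everywhere, and dominated convergence applies. The
  function \<open>z\<close> is a Borel substitute for \<open>x\<close> inside
  \<open>K\<close>.\<close>

lemma limit_integral_inequality:
  assumes e: "\<And>n. euler (Suc n) (X n) (U n) (Y n)"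
    and X: "uniform_limit {0..T} X x sequentially" and Y: "uniform_limit {0..T} Y x sequentially"
    and z: "z \<in> borel_measurable borel" "\<And>t. t \<in> {0..T} \<Longrightarrow> z t = x t"
    and zr: "\<And>t. t \<in> {0..T} \<Longrightarrow> norm (x t) \<le> r t"
    and h: "\<And>t. h t = 2 * (inner (F0 t v + K z t) (x t - v) + k t * (norm (x t - v))\<^sup>2)"
  shows "set_integrable lebesgue {0..T} h"
    and "0 \<le> p \<Longrightarrow> p \<le> q \<Longrightarrow> q \<le> T \<Longrightarrow> (norm (x q - v))\<^sup>2 - (norm (x p - v))\<^sup>2 \<le> (LINT t:{p..q}|lebesgue. h t)"
proof -
  define B where "B = r T + norm v"
  have rT: "r t \<le> r T" if "t \<in> {0..T}" for t using r_mono[of t T] that by simp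
  have B0: "0 \<le> B" using r_nonneg[of T] T_pos by (simp add: B_def)
  \<comment> \<open>The last summand is the price of testing with \<open>X n t - v\<close> while
    \<open>F5\<close> is applied at \<open>Y n t\<close>; it vanishes in the limit.\<close>
  define hn where "hn n t = 2 * (inner (F0 t v + K (Y n) t) (Y n t - v) + k t * (norm (Y n t - v))\<^sup>2 + \<psi> t * norm (X n t - Y n t))" for n t
  \<comment> \<open>The dominating function: \<open>B\<close> bounds
    \<open>norm (Y n t - v)\<close>, and \<open>2 * B\<close> bounds the freezing error.\<close>
  define w where "w t = 2 * ((norm (F0 t v) + \<psi> t) * B + \<bar>k t\<bar> * B\<^sup>2 + \<psi> t * (2 * B))" for t
  have Xr: "norm (X n t) \<le> r t" and Yr: "norm (Y n t) \<le> r t" if "t \<in> {0..T}" for n t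
    using euler_norm_le[OF e that] euler_delayed_norm_le[OF e that] by auto
  have F0i: "set_integrable lebesgue {0..T} (\<lambda>t. F0 t v)"
  proof (rule set_integrable_bound[of _ _ "\<lambda>t. c t * norm v + d t"])
    show "set_integrable lebesgue {0..T} (\<lambda>t. c t * norm v + d t)" using c_int d_int by (intro set_integral_add) auto
    show "set_borel_measurable lebesgue {0..T} (\<lambda>t. F0 t v)" unfolding set_borel_measurable_def by (rule F0_meas)
    show "AE t in lebesgue. t \<in> {0..T} \<longrightarrow> norm (F0 t v) \<le> norm (c t * norm v + d t)"
      using F0_bound by eventually_elim (simp add: order_trans[OF _ abs_ge_self])
  qed
  have wi: "set_integrable lebesgue {0..T} w" unfolding w_def
    using F0i \<psi>_int k_int
    by (intro set_integrable_mult_right set_integral_add set_integrable_mult_left set_integrable_norm set_integrable_abs) auto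
  have Yn: "\<And>n. Y n \<in> borel_measurable lebesgue" by (rule measurable_completion) (use eulerD(3)[OF e] in simp)
  have zm: "z \<in> borel_measurable lebesgue" by (rule measurable_completion) (use z in simp)
  have Km: "(\<lambda>t. indicator {0..T} t *\<^sub>R K (Y n) t) \<in> borel_measurable lebesgue" for n
  proof -
    have "set_integrable lebesgue {0..T} (K (Y n))"
      by (rule K_integrable(2)[OF eulerD(3)[OF e], where B="r T"]) (use Yr rT order_trans in blast)
    then show ?thesis by (simp add: set_integrable_def)
  qed
  have Kzm: "(\<lambda>t. indicator {0..T} t *\<^sub>R K z t) \<in> borel_measurable lebesgue"
  proof -
    have "set_integrable lebesgue {0..T} (K z)"
      by (rule K_integrable(2)[OF z(1), where B="r T"]) (use zr z(2) rT order_trans in metis)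
    then show ?thesis by (simp add: set_integrable_def)
  qed
  have km: "(\<lambda>t. indicator {0..T} t *\<^sub>R k t) \<in> borel_measurable lebesgue" "(\<lambda>t. indicator {0..T} t *\<^sub>R \<psi> t) \<in> borel_measurable lebesgue"
    using k_int \<psi>_int by (auto simp: set_integrable_def simp del: real_scaleR_def)
  have Xm: "(\<lambda>t. indicator {0..T} t *\<^sub>R X n t) \<in> borel_measurable lebesgue" for n
    by (rule measurable_completion) (use borel_measurable_continuous_on_indicator[OF _ euler_cont[OF e]] in simp)
  have hm: "(\<lambda>t. indicator {0..T} t *\<^sub>R h t) \<in> borel_measurable lebesgue"
  proof -
    have "(\<lambda>t. 2 * (inner (indicator {0..T} t *\<^sub>R F0 t v + indicator {0..T} t *\<^sub>R K z t) (z t - v) + (indicator {0..T} t *\<^sub>R k t) * (norm (z t - v))\<^sup>2)) \<in> borel_measurable lebesgue"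
      by (intro borel_measurable_times borel_measurable_add borel_measurable_inner borel_measurable_diff borel_measurable_power
          borel_measurable_norm borel_measurable_const F0_meas Kzm zm km measurable_compose[OF _ borel_measurable_norm])
    moreover have "2 * (inner (indicator {0..T} t *\<^sub>R F0 t v + indicator {0..T} t *\<^sub>R K z t) (z t - v) + (indicator {0..T} t *\<^sub>R k t) * (norm (z t - v))\<^sup>2)
        = indicator {0..T} t *\<^sub>R h t" for t
      using z(2)[of t] by (auto simp: h indicator_def)
    ultimately show ?thesis by (simp only:)
  qed
  have hnm: "(\<lambda>t. indicator {0..T} t *\<^sub>R hn n t) \<in> borel_measurable lebesgue" for n
  proof -
    have "(\<lambda>t. 2 * (inner (indicator {0..T} t *\<^sub>R F0 t v + indicator {0..T} t *\<^sub>R K (Y n) t) (Y n t - v) + (indicator {0..T} t *\<^sub>R k t) * (norm (Y n t - v))\<^sup>2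
        + (indicator {0..T} t *\<^sub>R \<psi> t) * norm (indicator {0..T} t *\<^sub>R X n t - Y n t))) \<in> borel_measurable lebesgue"
      by (intro borel_measurable_times borel_measurable_add borel_measurable_inner borel_measurable_diff borel_measurable_power
          borel_measurable_norm borel_measurable_const F0_meas Km Yn km Xm measurable_compose[OF _ borel_measurable_norm])
    moreover have "2 * (inner (indicator {0..T} t *\<^sub>R F0 t v + indicator {0..T} t *\<^sub>R K (Y n) t) (Y n t - v) + (indicator {0..T} t *\<^sub>R k t) * (norm (Y n t - v))\<^sup>2
        + (indicator {0..T} t *\<^sub>R \<psi> t) * norm (indicator {0..T} t *\<^sub>R X n t - Y n t)) = indicator {0..T} t *\<^sub>R hn n t" for t
      by (auto simp: hn_def indicator_def)
    ultimately show ?thesis by (simp only:)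
  qed
  have Kle: "AE t in lebesgue. \<forall>n. t \<in> {0..T} \<longrightarrow> norm (K (Y n) t) \<le> S t + (LINT s:{0..t}|lebesgue. \<sigma> t s * r s)"
    unfolding AE_all_countable by (intro allI K_le[OF eulerD(3)[OF e]]) (rule Yr)
  have hnw: "AE t in lebesgue. t \<in> {0..T} \<longrightarrow> (\<forall>n. norm (hn n t) \<le> w t)"
    using Kle
  proof eventually_elim
    case (elim t)
    show ?case
    proof (intro impI allI)
      fix n assume t: "t \<in> {0..T}"
      have K\<psi>: "norm (K (Y n) t) \<le> \<psi> t"
        using elim[rule_format, OF t, of n] mult_nonneg_nonneg[OF c_nonneg[OF t] r_nonneg[OF t]] d_nonneg[OF t] by (simp add: \<psi>_eq)
      have YB: "norm (Y n t - v) \<le> B"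
        using order_trans[OF norm_triangle_ineq4 add_right_mono[OF order_trans[OF Yr[OF t] rT[OF t]]]] by (simp add: B_def)
      have XB: "norm (X n t - Y n t) \<le> 2 * B"
        using norm_triangle_ineq4[of "X n t" "Y n t"] Xr[OF t, of n] Yr[OF t, of n] rT[OF t] norm_ge_zero[of v] unfolding B_def mult_2 by linarith
      have "\<bar>inner (F0 t v + K (Y n) t) (Y n t - v)\<bar> \<le> norm (F0 t v + K (Y n) t) * norm (Y n t - v)"
        by (rule Cauchy_Schwarz_ineq2)
      also have "\<dots> \<le> (norm (F0 t v) + \<psi> t) * B"
        using order_trans[OF norm_triangle_ineq add_left_mono[OF K\<psi>]] YB \<psi>_nonneg[OF t] by (intro mult_mono) auto
      finally have 1: "\<bar>inner (F0 t v + K (Y n) t) (Y n t - v)\<bar> \<le> (norm (F0 t v) + \<psi> t) * B" .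
      have 2: "\<bar>k t * (norm (Y n t - v))\<^sup>2\<bar> \<le> \<bar>k t\<bar> * B\<^sup>2"
        unfolding abs_mult using YB by (intro mult_mono) (auto intro: power_mono)
      have 3: "\<bar>\<psi> t * norm (X n t - Y n t)\<bar> \<le> \<psi> t * (2 * B)"
        unfolding abs_mult using XB \<psi>_nonneg[OF t] by (intro mult_mono) auto
      have tri: "\<bar>2 * (a + b + c)\<bar> \<le> 2 * (a' + b' + c')" if "\<bar>a\<bar> \<le> a'" "\<bar>b\<bar> \<le> b'" "\<bar>c\<bar> \<le> c'"
        for a b c a' b' c' :: real using that by (auto simp: abs_le_iff)
      show "norm (hn n t) \<le> w t" unfolding hn_def w_def real_norm_def by (rule tri[OF 1 2 3])
    qed
  qed
  have Kt: "AE t in lebesgue. t \<in> {0..T} \<longrightarrow> (\<lambda>n. K (Y n) t) \<longlonglongrightarrow> K z t"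
  proof (rule K_tendsto[OF eulerD(3)[OF e] _ z(1)])
    show "uniform_limit {0..T} Y z sequentially"
      using Y by (rule uniform_limit_cong'[THEN iffD1, rotated 2]) (use z(2) in auto)
    show "norm (Y n t) \<le> r T" if "t \<in> {0..T}" for n t using Yr[OF that, of n] rT[OF that] by linarith
    show "norm (z t) \<le> r T" if "t \<in> {0..T}" for t using zr[OF that] z(2)[OF that] rT[OF that] by simp
  qed
  have Xt: "(\<lambda>n. X n t) \<longlonglongrightarrow> x t" and Yt: "(\<lambda>n. Y n t) \<longlonglongrightarrow> x t" if "t \<in> {0..T}" for t
    using tendsto_uniform_limitI[OF X that] tendsto_uniform_limitI[OF Y that] .
  have hlim: "AE t in lebesgue. t \<in> {0..T} \<longrightarrow> (\<lambda>n. hn n t) \<longlonglongrightarrow> h t"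
    using Kt
  proof eventually_elim
    case (elim t)
    show ?case
    proof
      assume t: "t \<in> {0..T}"
      have "(\<lambda>n. hn n t) \<longlonglongrightarrow> 2 * (inner (F0 t v + K z t) (x t - v) + k t * (norm (x t - v))\<^sup>2 + \<psi> t * norm (x t - x t))"
        unfolding hn_def using elim t by (intro tendsto_intros Xt Yt) auto
      then show "(\<lambda>n. hn n t) \<longlonglongrightarrow> h t" by (simp add: h)
    qed
  qed
  have dc: "set_integrable lebesgue {0..T} h \<and> (\<forall>n. set_integrable lebesgue {0..T} (hn n))"
    unfolding set_integrable_def
  proof (intro conjI allI)
    have a1: "integrable lebesgue (\<lambda>t. indicator {0..T} t *\<^sub>R w t)" using wi by (simp add: set_integrable_def)
    have a2: "AE t in lebesgue. (\<lambda>n. indicator {0..T} t *\<^sub>R hn n t) \<longlonglongrightarrow> indicator {0..T} t *\<^sub>R h t"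
      using hlim by eventually_elim (auto simp: indicator_def)
    have a3: "AE t in lebesgue. norm (indicator {0..T} t *\<^sub>R hn n t) \<le> indicator {0..T} t *\<^sub>R w t" for n
      using hnw by eventually_elim (auto simp: indicator_def)
    show "integrable lebesgue (\<lambda>t. indicator {0..T} t *\<^sub>R h t)"
      by (rule integrable_dominated_convergence[OF hm hnm a1 a2 a3])
    show "integrable lebesgue (\<lambda>t. indicator {0..T} t *\<^sub>R hn n t)" for n
      by (rule integrable_dominated_convergence2[OF hm hnm a1 a2 a3])
  qed
  then show hi: "set_integrable lebesgue {0..T} h" by blast
  have hni: "set_integrable lebesgue {0..T} (hn n)" for n using dc by blast
  assume pq: "0 \<le> p" "p \<le> q" "q \<le> T"
  have est: "(norm (X n q - v))\<^sup>2 - (norm (X n p - v))\<^sup>2 \<le> (LINT t:{p..q}|lebesgue. hn n t)" for n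
  proof (rule norm_square_diff_le_integral[OF _ hni _ pq])
    show "abs_continuous_on 0 T (\<lambda>t. X n t - v)"
      using abs_continuous_on_dominated[OF euler_ac[OF e] euler_ac[OF e], of 1 "\<lambda>t. X n t - v" n n] by simp
    have d1: "AE t in lebesgue. t \<in> {0..T} \<longrightarrow> (X n has_vector_derivative U n t) (at t within {0..T})"
      by (rule AE_has_vector_derivative_if_indefinite_integral[OF eulerD(1,2)[OF e]])
    show "AE t in lebesgue. t \<in> {0..T} \<longrightarrow> (\<exists>D. ((\<lambda>t. X n t - v) has_vector_derivative D) (at t within {0..T}) \<and> 2 * inner D (X n t - v) \<le> hn n t)"
      using d1 F5 euler_velocity_le[OF e[of n]]
    proof eventually_elim
      case (elim t)
      show ?case
      proof
        assume t: "t \<in> {0..T}"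
        have "((\<lambda>t. X n t - v) has_vector_derivative (U n t - 0)) (at t within {0..T})"
          using elim(1) t by (intro has_vector_derivative_diff has_vector_derivative_const) auto
        then have 1: "((\<lambda>t. X n t - v) has_vector_derivative U n t) (at t within {0..T})" by simp
        have U: "U n t = F0 t (Y n t) + K (Y n) t" by (rule eulerD(5)[OF e t])
        have "inner (F0 t (Y n t) - F0 t v) (Y n t - v) \<le> k t * (norm (Y n t - v))\<^sup>2"
          using elim(2) t F0_in[OF t] by blast
        moreover have "inner (U n t) (X n t - Y n t) \<le> \<psi> t * norm (X n t - Y n t)"
          by (rule order_trans[OF norm_cauchy_schwarz mult_right_mono]) (use elim(3) t in auto)
        moreover have "inner (U n t) (X n t - v) = inner (F0 t (Y n t) - F0 t v) (Y n t - v)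
           + inner (F0 t v + K (Y n) t) (Y n t - v) + inner (U n t) (X n t - Y n t)"
          unfolding U by (simp add: inner_diff inner_add algebra_simps)
        ultimately have "2 * inner (U n t) (X n t - v) \<le> hn n t" unfolding hn_def by simp
        with 1 show "\<exists>D. ((\<lambda>t. X n t - v) has_vector_derivative D) (at t within {0..T}) \<and> 2 * inner D (X n t - v) \<le> hn n t" by blast
      qed
    qed
  qed
  have ind: "indicator {p..q} t *\<^sub>R f = indicator {p..q} t *\<^sub>R (indicator {0..T} t *\<^sub>R f)" for t and f :: real
    using pq by (auto simp: indicator_def)
  have mi: "(\<lambda>t. indicator {p..q} t *\<^sub>R f t) \<in> borel_measurable lebesgue"
    if "(\<lambda>t. indicator {0..T} t *\<^sub>R f t) \<in> borel_measurable lebesgue" for f :: "real \<Rightarrow> real"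
    unfolding ind[of _ "f _"] by (rule borel_measurable_scaleR[OF borel_measurable_indicator that]) simp
  have l1: "(\<lambda>n. LINT t:{p..q}|lebesgue. hn n t) \<longlonglongrightarrow> (LINT t:{p..q}|lebesgue. h t)"
    unfolding set_lebesgue_integral_def
  proof (rule Bochner_Integration.integral_dominated_convergence[OF mi[OF hm] mi[OF hnm]])
    show "integrable lebesgue (\<lambda>t. indicator {p..q} t *\<^sub>R w t)"
      using set_integrable_Icc_subset[OF wi pq(1,3)] by (simp add: set_integrable_def)
    show "AE t in lebesgue. (\<lambda>n. indicator {p..q} t *\<^sub>R hn n t) \<longlonglongrightarrow> indicator {p..q} t *\<^sub>R h t"
      using hlim by eventually_elim (use pq in \<open>auto simp: indicator_def\<close>)
    show "AE t in lebesgue. norm (indicator {p..q} t *\<^sub>R hn n t) \<le> indicator {p..q} t *\<^sub>R w t" for n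
      using hnw by eventually_elim (use pq in \<open>auto simp: indicator_def\<close>)
  qed
  have l2: "(\<lambda>n. (norm (X n q - v))\<^sup>2 - (norm (X n p - v))\<^sup>2) \<longlonglongrightarrow> (norm (x q - v))\<^sup>2 - (norm (x p - v))\<^sup>2"
    using pq by (intro tendsto_intros Xt) auto
  show "(norm (x q - v))\<^sup>2 - (norm (x p - v))\<^sup>2 \<le> (LINT t:{p..q}|lebesgue. h t)"
    by (rule LIMSEQ_le[OF l2 l1]) (use est in blast)
qed

end

section \<open>Existence and uniqueness\<close>

context integro_inclusion begin

theorem solution_exists:
  "\<exists>x. is_solution T F g x0 x \<and> (\<forall>t\<in>{0..T}. norm (x t) \<le> r t) \<and>
     (AE t in lebesgue. t \<in> {0..T} \<longrightarrow> norm (vector_derivative x (at t within {0..T})) \<le> \<psi> t)"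
proof -
  obtain X U Y x where e: "\<And>n. euler (Suc n) (X n) (U n) (Y n)"
    and X: "uniform_limit {0..T} X x sequentially" and Y: "uniform_limit {0..T} Y x sequentially"
    by (rule euler_limit) blast
  have Xt: "(\<lambda>n. X n t) \<longlonglongrightarrow> x t" if "t \<in> {0..T}" for t by (rule tendsto_uniform_limitI[OF X that])
  have xr: "norm (x t) \<le> r t" if "t \<in> {0..T}" for t
    by (rule LIMSEQ_le_const2[OF tendsto_norm[OF Xt[OF that]]]) (use euler_norm_le[OF e that] in blast)
  have xd: "norm (x t - x s) \<le> (LINT \<tau>:{s..t}|lebesgue. \<psi> \<tau>)" if st: "0 \<le> s" "s \<le> t" "t \<le> T" for s t
  proof (rule LIMSEQ_le_const2[OF tendsto_norm[OF tendsto_diff[OF Xt Xt]]])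
    show "\<exists>N. \<forall>n\<ge>N. norm (X n t - X n s) \<le> (LINT \<tau>:{s..t}|lebesgue. \<psi> \<tau>)"
      using euler_diff_le[OF e st] by blast
  qed (use st in auto)
  have x_0: "x 0 = x0"
  proof -
    have "X n 0 = x0" for n using eulerD(2)[OF e, of 0 n] T_pos by simp
    then show ?thesis using Xt[of 0] T_pos by (simp add: LIMSEQ_const_iff)
  qed
  have xac: "abs_continuous_on 0 T x" by (rule abs_continuous_on_if_integral_bound[OF \<psi>_int \<psi>_nonneg xd])
  obtain u where u: "set_integrable lebesgue {0..T} u" "\<And>t. t \<in> {0..T} \<Longrightarrow> x t = x 0 + (LINT \<tau>:{0..t}|lebesgue. u \<tau>)"
    by (rule indefinite_integral_if_integral_bound[OF T_pos \<psi>_int \<psi>_nonneg xd]) blast+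
  have dx: "AE t in lebesgue. t \<in> {0..T} \<longrightarrow> (x has_vector_derivative u t) (at t within {0..T})"
    by (rule AE_has_vector_derivative_if_indefinite_integral[OF u])
  have bound: "AE t in lebesgue. t \<in> {0..T} \<longrightarrow> norm (u t) \<le> \<psi> t"
    using dx AE_indefinite_integral_has_vector_derivative[OF \<psi>_int]
  proof eventually_elim
    case (elim t)
    show ?case
    proof
      assume t: "t \<in> {0..T}"
      show "norm (u t) \<le> \<psi> t"
      proof (rule norm_deriv_le[OF _ _ t T_pos])
        show "(x has_vector_derivative u t) (at t within {0..T})"
          "((\<lambda>s. LINT \<tau>:{0..s}|lebesgue. \<psi> \<tau>) has_vector_derivative \<psi> t) (at t within {0..T})" using elim t by auto
        fix p q assume pq: "0 \<le> p" "p \<le> q" "q \<le> T"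
        show "norm (x q - x p) \<le> (LINT \<tau>:{0..q}|lebesgue. \<psi> \<tau>) - (LINT \<tau>:{0..p}|lebesgue. \<psi> \<tau>)"
          using xd[OF pq] set_integral_Icc_split[OF \<psi>_int pq] by simp
      qed
    qed
  qed
  \<comment> \<open>The estimates for \<open>K\<close> ask for a function that is Borel on the line;
    cutting off outside \<open>{0..T}\<close> leaves \<open>K\<close> unchanged there by
    causality.\<close>
  define z where "z t = indicator {0..T} t *\<^sub>R x t" for t
  have zm: "z \<in> borel_measurable borel" unfolding z_def
    by (rule borel_measurable_continuous_on_indicator[OF _ abs_continuous_on_imp_continuous_on[OF xac]]) simp
  have zx: "z t = x t" if "t \<in> {0..T}" for t using that by (simp add: z_def)
  have Kz: "K z t = K x t" if "t \<in> {0..T}" for t by (rule K_cong) (use zx that in auto)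
  define h where "h v t = 2 * (inner (F0 t v + K z t) (x t - v) + k t * (norm (x t - v))\<^sup>2)" for v t
  have lim1: "set_integrable lebesgue {0..T} (h v)" for v
    by (rule limit_integral_inequality(1)[OF e X Y zm zx xr h_def[of v]])
  have lim2: "(norm (x q - v))\<^sup>2 - (norm (x p - v))\<^sup>2 \<le> (LINT t:{p..q}|lebesgue. h v t)" if "0 \<le> p" "p \<le> q" "q \<le> T" for v p q
    by (rule limit_integral_inequality(2)[OF e X Y zm zx xr h_def[of v] that])
  obtain V :: "'b set" where V: "countable V" "\<And>U. open U \<Longrightarrow> U \<noteq> {} \<Longrightarrow> \<exists>v\<in>V. v \<in> U"
    using countable_dense_exists by blast
  have "AE t in lebesgue. t \<in> {0..T} \<longrightarrow> 2 * inner (u t) (x t - v) \<le> h v t" for v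
    using dx AE_indefinite_integral_has_vector_derivative[OF lim1[of v]]
  proof eventually_elim
    case (elim t)
    show ?case
    proof
      assume t: "t \<in> {0..T}"
      \<comment> \<open>Nondecreasing by the integrated inequality; its derivative at
        \<open>t\<close> is the difference to be shown nonnegative.\<close>
      let ?\<theta> = "\<lambda>s. (LINT \<tau>:{0..s}|lebesgue. h v \<tau>) - inner (x s - v) (x s - v)"
      have dxt: "(x has_vector_derivative u t) (at t within {0..T})"
        and dht: "((\<lambda>s. LINT \<tau>:{0..s}|lebesgue. h v \<tau>) has_vector_derivative h v t) (at t within {0..T})" using elim t by auto
      have "(?\<theta> has_vector_derivative (h v t - 2 * inner (u t) (x t - v))) (at t within {0..T})"
        using dxt dht unfolding has_vector_derivative_def
        by (auto intro!: derivative_eq_intros simp: algebra_simps inner_commute)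
      then have "0 \<le> h v t - 2 * inner (u t) (x t - v)"
      proof (rule mono_imp_deriv_nonneg[OF _ t T_pos])
        fix p q assume pq: "0 \<le> p" "p \<le> q" "q \<le> T"
        show "?\<theta> p \<le> ?\<theta> q"
          using lim2[OF pq, of v] set_integral_Icc_split[OF lim1[of v] pq] by (simp add: power2_norm_eq_inner)
      qed
      then show "2 * inner (u t) (x t - v) \<le> h v t" by simp
    qed
  qed
  \<comment> \<open>Each \<open>v\<close> has its own null set; countability of \<open>V\<close>
    leaves a single one, and density is all that Minty's argument asks for.\<close>
  then have "AE t in lebesgue. \<forall>v\<in>V. t \<in> {0..T} \<longrightarrow> 2 * inner (u t) (x t - v) \<le> h v t"
    unfolding AE_ball_countable[OF V(1)] by blast
  then have incl: "AE t in lebesgue. t \<in> {0..T} \<longrightarrow> u t - K x t \<in> F t (x t)"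
    using F2 F0_bound
  proof eventually_elim
    case (elim t)
    show ?case
    proof
      assume t: "t \<in> {0..T}"
      show "u t - K x t \<in> F t (x t)"
      proof (rule usc_weak_minty[where f="F0 t" and c="c t" and d="d t" and V=V and \<kappa>="k t"])
        show "usc_weak (F t)" using elim t by blast
        show "F t (x t) \<noteq> {}" "closed (F t (x t))" "convex (F t (x t))" using F_values[OF t] by auto
        show "F0 t v \<in> F t v" for v by (rule F0_in[OF t])
        show "norm (F0 t v) \<le> c t * norm v + d t" for v using elim t by blast
        show "0 \<le> c t" by (rule c_nonneg[OF t])
        show "\<exists>v\<in>V. v \<in> U" if "open U" "U \<noteq> {}" for U by (rule V(2)[OF that])
        fix v assume "v \<in> V"
        then have "2 * inner (u t) (x t - v) \<le> h v t" using elim t by blast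
        then show "inner (u t - K x t - F0 t v) (x t - v) \<le> k t * (norm (x t - v))\<^sup>2"
          unfolding h_def Kz[OF t] by (simp add: inner_diff_left inner_add_left)
      qed
    qed
  qed
  have "is_solution T F g x0 x"
    unfolding is_solution_def
  proof (intro conjI xac x_0)
    show "AE t in lebesgue. t \<in> {0..T} \<longrightarrow> (\<exists>v. (x has_vector_derivative v) (at t within {0..T}) \<and>
             v \<in> (\<lambda>w. w + (LINT s:{0..t}|lebesgue. g t s (x s))) ` F t (x t))"
      using dx incl
    proof eventually_elim
      case (elim t)
      show ?case
      proof
        assume t: "t \<in> {0..T}"
        then have "u t \<in> (\<lambda>w. w + (LINT s:{0..t}|lebesgue. g t s (x s))) ` F t (x t)"
          using elim(2) by (intro image_eqI[of _ _ "u t - K x t"]) (auto simp: K_def)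
        then show "\<exists>v. (x has_vector_derivative v) (at t within {0..T}) \<and>
             v \<in> (\<lambda>w. w + (LINT s:{0..t}|lebesgue. g t s (x s))) ` F t (x t)" using elim(1) t by blast
      qed
    qed
  qed
  moreover have "AE t in lebesgue. t \<in> {0..T} \<longrightarrow> norm (vector_derivative x (at t within {0..T})) \<le> \<psi> t"
    using dx bound
  proof eventually_elim
    case (elim t)
    show ?case
    proof
      assume t: "t \<in> {0..T}"
      have "vector_derivative x (at t within {0..T}) = u t"
        using vector_derivative_within_cbox[OF T_pos, of t x "u t"] elim(1) t by simp
      then show "norm (vector_derivative x (at t within {0..T})) \<le> \<psi> t" using elim(2) t by simp
    qed
  qed
  ultimately show ?thesis using xr by blast
qed

text \<open>An arbitrary solution need not follow the minimal selection, so its bound comes from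
  continuity on a compact interval instead of \<open>r\<close>. The energy estimate is that of the
  polygons without freezing errors, and Gronwall's inequality has zero data.\<close>

theorem solution_unique:
  assumes x: "is_solution T F g x0 x" and y: "is_solution T F g x0 y" and t0: "t0 \<in> {0..T}"
  shows "x t0 = y t0"
proof -
  have xac: "abs_continuous_on 0 T x" and yac: "abs_continuous_on 0 T y" and init: "x 0 = y 0"
    using x y by (auto simp: is_solution_def)
  have xc: "continuous_on {0..T} x" and yc: "continuous_on {0..T} y"
    using abs_continuous_on_imp_continuous_on xac yac by auto
  obtain B1 where B1: "B1 \<ge> 0" "\<And>t. t \<in> {0..T} \<Longrightarrow> norm (x t) \<le> B1" using continuous_on_Icc_norm_bound[OF xc] by metis
  obtain B2 where B2: "B2 \<ge> 0" "\<And>t. t \<in> {0..T} \<Longrightarrow> norm (y t) \<le> B2" using continuous_on_Icc_norm_bound[OF yc] by metis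
  define B where "B = B1 + B2 + 1"
  have "B > 0" using B1 B2 by (simp add: B_def)
  then obtain \<mu> where \<mu>i: "set_integrable lebesgue {0..T} \<mu>" and \<mu>0: "\<forall>t\<in>{0..T}. \<mu> t \<ge> 0"
    and \<mu>: "\<forall>(t, s)\<in>triangle T. \<forall>x\<in>cball 0 B. \<forall>y\<in>cball 0 B. norm (g t s x - g t s y) \<le> \<mu> t * norm (x - y)"
    using g2 by blast
  define xb where "xb t = indicator {0..T} t *\<^sub>R x t" for t
  define yb where "yb t = indicator {0..T} t *\<^sub>R y t" for t
  have xbm: "xb \<in> borel_measurable borel" and ybm: "yb \<in> borel_measurable borel"
    unfolding xb_def yb_def by (rule borel_measurable_continuous_on_indicator; use xc yc in simp)+
  have xbx: "xb t = x t" and yby: "yb t = y t" if "t \<in> {0..T}" for t using that by (auto simp: xb_def yb_def)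
  have Kx: "K xb t = K x t" "K yb t = K y t" if "t \<in> {0..T}" for t
    by (rule K_cong; use xbx yby that in auto)+
  have KL: "AE t in lebesgue. t \<in> {0..T} \<longrightarrow> (\<forall>\<Delta>. (\<forall>s\<in>{0..t}. norm (xb s - yb s) \<le> \<Delta>) \<longrightarrow> norm (K xb t - K yb t) \<le> \<mu> t * T * \<Delta>)"
  proof (rule K_lipschitz[OF xbm _ ybm _ \<mu>0 \<mu>])
    fix s assume s: "s \<in> {0..T}"
    show "norm (xb s) \<le> B" "norm (yb s) \<le> B" using B1(1) B2(1) B1(2)[OF s] B2(2)[OF s] xbx[OF s] yby[OF s] by (auto simp: B_def)
  qed
  define \<phi> where "\<phi> t = (norm (x t - y t))\<^sup>2" for t
  have \<phi>: "continuous_on {0..T} \<phi>" unfolding \<phi>_def by (intro continuous_intros xc yc)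
  let ?R = "run_sup \<phi>"
  define \<kappa> where "\<kappa> t = 2 * (\<bar>k t\<bar> + \<mu> t * T)" for t
  have \<kappa>i: "set_integrable lebesgue {0..T} \<kappa>" unfolding \<kappa>_def
    using \<mu>i k_int by (intro set_integrable_mult_right set_integral_add set_integrable_abs) auto
  have \<kappa>0: "0 \<le> \<kappa> t" if "t \<in> {0..T}" for t using \<mu>0 that T_pos by (simp add: \<kappa>_def)
  have hi: "set_integrable lebesgue {0..T} (\<lambda>t. \<kappa> t * ?R t)"
    by (rule run_sup_mult_integrable[OF \<phi> _ \<kappa>i]) (use T_pos in simp)
  have sx: "AE t in lebesgue. t \<in> {0..T} \<longrightarrow> (\<exists>v. (x has_vector_derivative v) (at t within {0..T}) \<and> v - K x t \<in> F t (x t))"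
    and sy: "AE t in lebesgue. t \<in> {0..T} \<longrightarrow> (\<exists>v. (y has_vector_derivative v) (at t within {0..T}) \<and> v - K y t \<in> F t (y t))"
  proof -
    have *: "AE t in lebesgue. t \<in> {0..T} \<longrightarrow> (\<exists>v. (q has_vector_derivative v) (at t within {0..T}) \<and> v - K q t \<in> F t (q t))"
      if q: "is_solution T F g x0 q" for q
    proof -
      have "AE t in lebesgue. t \<in> {0..T} \<longrightarrow> (\<exists>v. (q has_vector_derivative v) (at t within {0..T}) \<and>
             v \<in> (\<lambda>w. w + (LINT s:{0..t}|lebesgue. g t s (q s))) ` F t (q t))"
        using q unfolding is_solution_def by blast
      then show ?thesis
      proof eventually_elim
        case (elim t)
        show ?case
        proof
          assume "t \<in> {0..T}"
          then obtain v w where "(q has_vector_derivative v) (at t within {0..T})" "w \<in> F t (q t)" "v = w + K q t"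
            using elim unfolding K_def by blast
          then show "\<exists>v. (q has_vector_derivative v) (at t within {0..T}) \<and> v - K q t \<in> F t (q t)"
            by (intro exI[of _ v]) simp
        qed
      qed
    qed
    show "AE t in lebesgue. t \<in> {0..T} \<longrightarrow> (\<exists>v. (x has_vector_derivative v) (at t within {0..T}) \<and> v - K x t \<in> F t (x t))"
      by (rule *[OF x])
    show "AE t in lebesgue. t \<in> {0..T} \<longrightarrow> (\<exists>v. (y has_vector_derivative v) (at t within {0..T}) \<and> v - K y t \<in> F t (y t))"
      by (rule *[OF y])
  qed
  have ae: "AE t in lebesgue. t \<in> {0..T} \<longrightarrow> (\<exists>D. ((\<lambda>t. x t - y t) has_vector_derivative D) (at t within {0..T}) \<and> 2 * inner D (x t - y t) \<le> \<kappa> t * ?R t)"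
    using sx sy KL F5
  proof eventually_elim
    case (elim t)
    show ?case
    proof
      assume t: "t \<in> {0..T}"
      obtain v where v: "(x has_vector_derivative v) (at t within {0..T})" "v - K x t \<in> F t (x t)" using elim(1) t by blast
      obtain w where w: "(y has_vector_derivative w) (at t within {0..T})" "w - K y t \<in> F t (y t)" using elim(2) t by blast
      define \<rho> where "\<rho> = sqrt (?R t)"
      have R0: "0 \<le> ?R t" using order_trans[OF _ run_sup_upper[OF \<phi>, of t t]] t by (simp add: \<phi>_def)
      have \<rho>2: "\<rho>\<^sup>2 = ?R t" and \<rho>0: "0 \<le> \<rho>" using R0 by (auto simp: \<rho>_def)
      have x\<rho>: "norm (x s - y s) \<le> \<rho>" if "s \<in> {0..t}" for s
        unfolding \<rho>_def using run_sup_upper[OF \<phi>, of s t] that t by (intro real_le_rsqrt) (auto simp: \<phi>_def)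
      have "norm (xb s - yb s) \<le> \<rho>" if "s \<in> {0..t}" for s using x\<rho>[OF that] xbx[of s] yby[of s] that t by simp
      then have K1: "norm (K x t - K y t) \<le> \<mu> t * T * \<rho>" using elim(3) t Kx[OF t] by metis
      have i1: "inner ((v - K x t) - (w - K y t)) (x t - y t) \<le> \<bar>k t\<bar> * \<rho>\<^sup>2"
      proof -
        have "inner ((v - K x t) - (w - K y t)) (x t - y t) \<le> k t * (norm (x t - y t))\<^sup>2"
          using elim(4) t v(2) w(2) by blast
        also have "\<dots> \<le> \<bar>k t\<bar> * \<rho>\<^sup>2" using x\<rho>[of t] t by (intro mult_mono power_mono) auto
        finally show ?thesis .
      qed
      have i2: "inner (K x t - K y t) (x t - y t) \<le> \<mu> t * T * \<rho>\<^sup>2"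
      proof -
        have "inner (K x t - K y t) (x t - y t) \<le> norm (K x t - K y t) * norm (x t - y t)" by (rule norm_cauchy_schwarz)
        also have "\<dots> \<le> (\<mu> t * T * \<rho>) * \<rho>" using K1 x\<rho>[of t] \<rho>0 \<mu>0 t T_pos by (intro mult_mono) auto
        finally show ?thesis by (simp add: power2_eq_square mult.assoc)
      qed
      have "inner (v - w) (x t - y t) = inner ((v - K x t) - (w - K y t)) (x t - y t) + inner (K x t - K y t) (x t - y t)"
        by (simp add: inner_diff_left)
      also have "\<dots> \<le> \<bar>k t\<bar> * \<rho>\<^sup>2 + \<mu> t * T * \<rho>\<^sup>2" by (rule add_mono[OF i1 i2])
      finally have "2 * inner (v - w) (x t - y t) \<le> \<kappa> t * ?R t" unfolding \<rho>2 by (simp add: \<kappa>_def algebra_simps)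
      moreover have "((\<lambda>t. x t - y t) has_vector_derivative (v - w)) (at t within {0..T})"
        by (rule has_vector_derivative_diff[OF v(1) w(1)])
      ultimately show "\<exists>D. ((\<lambda>t. x t - y t) has_vector_derivative D) (at t within {0..T}) \<and> 2 * inner D (x t - y t) \<le> \<kappa> t * ?R t"
        by blast
    qed
  qed
  have le: "\<phi> t \<le> 0 + (LINT s:{0..t}|lebesgue. \<kappa> s * ?R s + 0)" if t: "t \<in> {0..T}" for t
  proof -
    have "(norm (x t - y t))\<^sup>2 - (norm (x 0 - y 0))\<^sup>2 \<le> (LINT s:{0..t}|lebesgue. \<kappa> s * ?R s)"
      by (rule norm_square_diff_le_integral[OF abs_continuous_on_diff[OF xac yac] hi ae]) (use t in auto)
    then show ?thesis using init by (simp add: \<phi>_def)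
  qed
  have "?R t0 \<le> 0 * exp (LINT s:{0..t0}|lebesgue. \<kappa> s) + (LINT s:{0..t0}|lebesgue. 0 * exp (LINT q:{s..t0}|lebesgue. \<kappa> q))"
    by (rule gronwall_run_sup[OF \<phi> _ \<kappa>i _ _ _ le t0]) (use \<kappa>0 in \<open>auto simp: \<phi>_def\<close>)
  then have "\<phi> t0 \<le> 0" using run_sup_upper[OF \<phi>, of t0 t0] t0 by simp
  then show ?thesis by (simp add: \<phi>_def)
qed

end

section \<open>Transfer to the sort of the theorem\<close>

text \<open>The Bochner integral is developed for the class \<open>banach\<close>, which the type checker does not derive
  from \<open>real_inner\<close> and \<open>complete_space\<close>. An isometric copy of the given space has the required instance.\<close>

typedef 'a hilbert_copy = "UNIV :: 'a set" morphisms of_copy to_copy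
  by simp

lemma of_to_copy [simp]: "of_copy (to_copy x) = x" by (simp add: to_copy_inverse)
lemma to_of_copy [simp]: "to_copy (of_copy x) = x" by (rule of_copy_inverse)

instantiation hilbert_copy :: (real_inner) real_vector
begin

definition zero_hilbert_copy :: "'a hilbert_copy" where "0 = to_copy 0"
definition plus_hilbert_copy :: "'a hilbert_copy \<Rightarrow> 'a hilbert_copy \<Rightarrow> 'a hilbert_copy" where
  "x + y = to_copy (of_copy x + of_copy y)"
definition minus_hilbert_copy :: "'a hilbert_copy \<Rightarrow> 'a hilbert_copy \<Rightarrow> 'a hilbert_copy" where
  "x - y = to_copy (of_copy x - of_copy y)"
definition uminus_hilbert_copy :: "'a hilbert_copy \<Rightarrow> 'a hilbert_copy" where
  "- x = to_copy (- of_copy x)"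
definition scaleR_hilbert_copy :: "real \<Rightarrow> 'a hilbert_copy \<Rightarrow> 'a hilbert_copy" where
  "c *\<^sub>R x = to_copy (c *\<^sub>R of_copy x)"

instance
proof
  fix x y z :: "'a hilbert_copy" and a b :: real
  note defs = zero_hilbert_copy_def plus_hilbert_copy_def minus_hilbert_copy_def uminus_hilbert_copy_def scaleR_hilbert_copy_def
  show "x + y + z = x + (y + z)" unfolding defs of_to_copy by (simp only: add.assoc)
  show "x + y = y + x" unfolding defs by (simp only: add.commute)
  show "0 + x = x" "- x + x = 0" "x - y = x + - y" unfolding defs by simp_all
  show "a *\<^sub>R (x + y) = a *\<^sub>R x + a *\<^sub>R y" "(a + b) *\<^sub>R x = a *\<^sub>R x + b *\<^sub>R x"
    unfolding defs of_to_copy by (simp_all only: scaleR_add_right scaleR_add_left)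
  show "a *\<^sub>R b *\<^sub>R x = (a * b) *\<^sub>R x" "1 *\<^sub>R x = x" unfolding defs by simp_all
qed

end

lemma linear_of_copy: "of_copy (x + y) = of_copy x + of_copy y" "of_copy (x - y) = of_copy x - of_copy y"
  "of_copy (c *\<^sub>R x) = c *\<^sub>R of_copy x" "of_copy 0 = 0"
  by (simp_all add: plus_hilbert_copy_def minus_hilbert_copy_def scaleR_hilbert_copy_def zero_hilbert_copy_def)

lemma linear_to_copy: "to_copy (x + y) = to_copy x + to_copy y" "to_copy (x - y) = to_copy x - to_copy y"
  "to_copy (c *\<^sub>R x) = c *\<^sub>R to_copy x" "to_copy 0 = 0"
  by (simp_all add: plus_hilbert_copy_def minus_hilbert_copy_def scaleR_hilbert_copy_def zero_hilbert_copy_def)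

instantiation hilbert_copy :: (real_inner) real_inner
begin

definition norm_hilbert_copy :: "'a hilbert_copy \<Rightarrow> real" where
  "norm x = norm (of_copy x)"
definition inner_hilbert_copy :: "'a hilbert_copy \<Rightarrow> 'a hilbert_copy \<Rightarrow> real" where
  "inner x y = inner (of_copy x) (of_copy y)"
definition sgn_hilbert_copy :: "'a hilbert_copy \<Rightarrow> 'a hilbert_copy" where
  "sgn x = to_copy (sgn (of_copy x))"
definition dist_hilbert_copy :: "'a hilbert_copy \<Rightarrow> 'a hilbert_copy \<Rightarrow> real" where
  "dist x y = dist (of_copy x) (of_copy y)"
definition uniformity_hilbert_copy_def:
  "(uniformity :: ('a hilbert_copy \<times> 'a hilbert_copy) filter) = (INF e\<in>{0 <..}. principal {(x, y). dist x y < e})"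
definition open_hilbert_copy_def:
  "open (U :: 'a hilbert_copy set) \<longleftrightarrow> (\<forall>x\<in>U. eventually (\<lambda>(x', y). x' = x \<longrightarrow> y \<in> U) uniformity)"

instance
proof
  fix x y z :: "'a hilbert_copy" and a :: real
  show "dist x y = norm (x - y)" by (simp add: dist_hilbert_copy_def norm_hilbert_copy_def linear_of_copy dist_norm)
  show "sgn x = x /\<^sub>R norm x" by (simp add: sgn_hilbert_copy_def norm_hilbert_copy_def sgn_div_norm linear_to_copy)
  show "(uniformity :: ('a hilbert_copy \<times> 'a hilbert_copy) filter) = (INF e\<in>{0 <..}. principal {(x, y). dist x y < e})"
    by (rule uniformity_hilbert_copy_def)
  show "open U \<longleftrightarrow> (\<forall>x\<in>U. eventually (\<lambda>(x', y). x' = x \<longrightarrow> y \<in> U) uniformity)" for U :: "'a hilbert_copy set"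
    by (rule open_hilbert_copy_def)
  show "inner x y = inner y x" unfolding inner_hilbert_copy_def by (rule inner_commute)
  show "inner (x + y) z = inner x z + inner y z" "inner (a *\<^sub>R x) y = a * inner x y"
    by (simp_all add: inner_hilbert_copy_def linear_of_copy inner_add_left)
  show "0 \<le> inner x x" "norm x = sqrt (inner x x)"
    by (simp_all add: inner_hilbert_copy_def norm_hilbert_copy_def norm_eq_sqrt_inner)
  have "of_copy x = 0 \<longleftrightarrow> x = 0" unfolding zero_hilbert_copy_def by (metis of_to_copy to_of_copy)
  then show "inner x x = 0 \<longleftrightarrow> x = 0" by (simp add: inner_hilbert_copy_def)
qed

end

section \<open>The copy as a separable Hilbert space isometric to the original\<close>

lemma norm_to_copy [simp]: "norm (to_copy x) = norm x" and norm_of_copy [simp]: "norm (of_copy y) = norm y"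
  by (simp_all add: norm_hilbert_copy_def)

lemma bounded_linear_of_copy: "bounded_linear of_copy"
  by (rule bounded_linear_intro[of _ 1]) (simp_all add: linear_of_copy)

lemma bounded_linear_to_copy: "bounded_linear to_copy"
  by (rule bounded_linear_intro[of _ 1]) (simp_all add: linear_to_copy)

lemma continuous_of_copy: "continuous_on A of_copy" and continuous_to_copy: "continuous_on B to_copy"
  using bounded_linear.continuous_on[OF bounded_linear_of_copy continuous_on_id]
    bounded_linear.continuous_on[OF bounded_linear_to_copy continuous_on_id] by auto

lemma to_copy_image: "to_copy ` C = of_copy -` C"
  by (auto simp: image_iff) (metis to_of_copy)

lemma of_copy_image: "of_copy ` C = to_copy -` C"
  by (auto simp: image_iff) (metis of_to_copy)

lemma open_to_copy_image: "open C \<Longrightarrow> open (to_copy ` C)"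
  unfolding to_copy_image by (rule open_vimage[OF _ continuous_of_copy])

lemma open_of_copy_image: "open C \<Longrightarrow> open (of_copy ` C)"
  unfolding of_copy_image by (rule open_vimage[OF _ continuous_to_copy])

instance hilbert_copy :: ("{real_inner,complete_space}") banach
proof
  fix X :: "nat \<Rightarrow> 'a hilbert_copy" assume "Cauchy X"
  then have "Cauchy (\<lambda>n. of_copy (X n))" by (simp add: Cauchy_def dist_hilbert_copy_def)
  then obtain l where "(\<lambda>n. of_copy (X n)) \<longlonglongrightarrow> l" using Cauchy_convergent convergent_def by blast
  then have "(\<lambda>n. to_copy (of_copy (X n))) \<longlonglongrightarrow> to_copy l"
    by (rule bounded_linear.tendsto[OF bounded_linear_to_copy])
  then show "convergent X" by (auto simp: convergent_def)
qed

instance hilbert_copy :: ("{real_inner,second_countable_topology}") second_countable_topology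
proof
  obtain B :: "'a set set" where B: "countable B" "topological_basis B" using ex_countable_basis by blast
  have "topological_basis ((\<lambda>b. to_copy ` b) ` B)"
    unfolding topological_basis_def
  proof (intro conjI allI impI ballI)
    fix b :: "'a hilbert_copy set" assume "b \<in> (\<lambda>b. to_copy ` b) ` B"
    then show "open b" using B(2) open_to_copy_image topological_basis_open by blast
  next
    fix U :: "'a hilbert_copy set" assume "open U"
    then have "open (of_copy ` U)" by (rule open_of_copy_image)
    then obtain B' where "B' \<subseteq> B" "\<Union>B' = of_copy ` U" using B(2) unfolding topological_basis_def by blast
    moreover have "\<Union>((\<lambda>b. to_copy ` b) ` B') = to_copy ` \<Union>B'" by blast
    moreover have "to_copy ` of_copy ` U = U" by (simp add: image_image)
    ultimately show "\<exists>B'\<subseteq>(\<lambda>b. to_copy ` b) ` B. \<Union>B' = U" by (intro exI[of _ "(\<lambda>b. to_copy ` b) ` B'"]) auto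
  qed
  then show "\<exists>B :: 'a hilbert_copy set set. countable B \<and> open = generate_topology B"
    using B(1) topological_basis_imp_subbasis by blast
qed

text \<open>If \<open>f\<close> has no Bochner integral, neither has its image, since
  \<open>of_copy\<close> would carry one back; both sides are then the default value 0. So the
  identity can be rewritten inside \<open>is_solution\<close> without side conditions.\<close>

lemma integral_to_copy:
  fixes f :: "'c \<Rightarrow> 'a::{real_inner,second_countable_topology}"
  shows "(LINT s|M. to_copy (f s)) = to_copy (LINT s|M. f s)"
proof (cases "\<exists>l. has_bochner_integral M f l")
  case True
  then obtain l where l: "has_bochner_integral M f l" by blast
  then have "has_bochner_integral M (\<lambda>s. to_copy (f s)) (to_copy l)"
    by (rule has_bochner_integral_bounded_linear[OF bounded_linear_to_copy])
  then show ?thesis using l by (simp add: has_bochner_integral_integral_eq)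
next
  case False
  have "\<not> (\<exists>l. has_bochner_integral M (\<lambda>s. to_copy (f s)) l)"
  proof
    assume "\<exists>l. has_bochner_integral M (\<lambda>s. to_copy (f s)) l"
    then obtain l where "has_bochner_integral M (\<lambda>s. to_copy (f s)) l" by blast
    from has_bochner_integral_bounded_linear[OF bounded_linear_of_copy this] False show False by simp
  qed
  then show ?thesis using False by (simp add: lebesgue_integral_def linear_to_copy)
qed

lemma set_integral_to_copy:
  fixes f :: "'c \<Rightarrow> 'a::{real_inner,second_countable_topology}"
  shows "(LINT s:A|M. to_copy (f s)) = to_copy (LINT s:A|M. f s)"
  unfolding set_lebesgue_integral_def by (simp add: integral_to_copy flip: linear_to_copy(3))

text \<open>Weak neighbourhoods are cut out by finitely many inner products, which the copy
  preserves.\<close>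

lemma weakly_open_of_copy_image: "weakly_open W \<Longrightarrow> weakly_open (of_copy ` W)"
  unfolding weakly_open_def
proof (intro ballI)
  fix x assume W: "\<forall>x\<in>W. \<exists>Z \<epsilon>. finite Z \<and> \<epsilon> > 0 \<and> {y. \<forall>z\<in>Z. \<bar>inner (y - x) z\<bar> < \<epsilon>} \<subseteq> W" and "x \<in> of_copy ` W"
  then have "to_copy x \<in> W" by auto
  then obtain Z \<epsilon> where Z: "finite Z" "\<epsilon> > 0" "{y. \<forall>z\<in>Z. \<bar>inner (y - to_copy x) z\<bar> < \<epsilon>} \<subseteq> W" using W by blast
  have "{y. \<forall>z\<in>of_copy ` Z. \<bar>inner (y - x) z\<bar> < \<epsilon>} \<subseteq> of_copy ` W"
  proof
    fix y assume y: "y \<in> {y. \<forall>z\<in>of_copy ` Z. \<bar>inner (y - x) z\<bar> < \<epsilon>}"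
    have "\<bar>inner (to_copy y - to_copy x) z\<bar> < \<epsilon>" if "z \<in> Z" for z
      using y that by (simp add: inner_hilbert_copy_def linear_of_copy)
    then have "to_copy y \<in> W" using Z(3) by blast
    then show "y \<in> of_copy ` W" by (metis image_eqI of_to_copy)
  qed
  then show "\<exists>Z \<epsilon>. finite Z \<and> \<epsilon> > 0 \<and> {y. \<forall>z\<in>Z. \<bar>inner (y - x) z\<bar> < \<epsilon>} \<subseteq> of_copy ` W"
    using Z(1,2) by (intro exI[of _ "of_copy ` Z"] exI[of _ \<epsilon>]) auto
qed

lemma usc_weak_to_copy:
  assumes "usc_weak \<Phi>" shows "usc_weak (\<lambda>v. to_copy ` \<Phi> (of_copy v))"
  unfolding usc_weak_def
proof (intro allI impI)
  fix x :: "'a hilbert_copy" and W assume W: "weakly_open W \<and> to_copy ` \<Phi> (of_copy x) \<subseteq> W"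
  then have "\<Phi> (of_copy x) \<subseteq> of_copy ` W" unfolding of_copy_image by blast
  then have "\<exists>\<delta>>0. \<forall>y. norm (y - of_copy x) < \<delta> \<longrightarrow> \<Phi> y \<subseteq> of_copy ` W"
    using W weakly_open_of_copy_image
    by (intro assms[unfolded usc_weak_def, THEN spec, THEN spec, THEN mp] conjI) blast
  then obtain \<delta> where \<delta>: "\<delta> > 0" "\<And>y. norm (y - of_copy x) < \<delta> \<Longrightarrow> \<Phi> y \<subseteq> of_copy ` W" by blast
  show "\<exists>\<delta>>0. \<forall>y. norm (y - x) < \<delta> \<longrightarrow> to_copy ` \<Phi> (of_copy y) \<subseteq> W"
  proof (intro exI[of _ \<delta>] conjI \<delta>(1) allI impI)
    fix y assume "norm (y - x) < \<delta>"
    then have "\<Phi> (of_copy y) \<subseteq> of_copy ` W"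
      by (intro \<delta>(2)) (simp flip: linear_of_copy(2))
    then show "to_copy ` \<Phi> (of_copy y) \<subseteq> W" unfolding of_copy_image by blast
  qed
qed

text \<open>Both directions matter: existence is brought back from the copy, while uniqueness sends
  a competing solution into it.\<close>

lemma is_solution_to_copy:
  fixes x :: "real \<Rightarrow> 'a::{real_inner,complete_space,second_countable_topology}"
  shows "is_solution T (\<lambda>t v. to_copy ` F t (of_copy v)) (\<lambda>t s v. to_copy (g t s (of_copy v))) (to_copy x0) (\<lambda>t. to_copy (x t))
     \<longleftrightarrow> is_solution T F g x0 x"
proof -
  have ac: "abs_continuous_on 0 T (\<lambda>t. to_copy (x t)) \<longleftrightarrow> abs_continuous_on 0 T x"
    unfolding abs_continuous_on_def by (simp flip: linear_to_copy(2))
  have inj: "to_copy a = to_copy b \<longleftrightarrow> a = b" for a b :: 'a by (metis of_to_copy)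
  have d: "((\<lambda>t. to_copy (x t)) has_vector_derivative to_copy v) F' \<longleftrightarrow> (x has_vector_derivative v) F'" for v F'
    using bounded_linear.has_vector_derivative[OF bounded_linear_to_copy, of x v F']
      bounded_linear.has_vector_derivative[OF bounded_linear_of_copy, of "\<lambda>t. to_copy (x t)" "to_copy v" F'] by auto
  have ex: "(\<exists>v. P v) \<longleftrightarrow> (\<exists>v. P (to_copy v))" for P :: "'a hilbert_copy \<Rightarrow> bool"
  proof
    assume "\<exists>v. P v"
    then obtain v where "P v" by blast
    then have "P (to_copy (of_copy v))" by simp
    then show "\<exists>v. P (to_copy v)" by blast
  qed blast
  have im: "to_copy v \<in> (\<lambda>w. w + to_copy b) ` to_copy ` C \<longleftrightarrow> v \<in> (\<lambda>w. w + b) ` C" for v b :: 'a and C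
    by (auto simp: image_iff inj simp flip: linear_to_copy(1))
  show ?thesis
    unfolding is_solution_def ac inj of_to_copy set_integral_to_copy
    by (subst ex) (simp only: d im)
qed

theorem theorem4p4:
  fixes T :: real
    and x0 :: "'a::{real_inner,complete_space,second_countable_topology}"
    and F :: "real \<Rightarrow> 'a \<Rightarrow> 'a set"
    and g :: "real \<Rightarrow> real \<Rightarrow> 'a \<Rightarrow> 'a"
    and c d k :: "real \<Rightarrow> real"
    and \<sigma> :: "real \<Rightarrow> real \<Rightarrow> real"
  defines "D \<equiv> {(t, s). 0 \<le> s \<and> s \<le> t \<and> t \<le> T}"
  assumes T_pos: "T > 0"
    and F_values: "\<forall>t\<in>{0..T}. \<forall>v. F t v \<noteq> {} \<and> closed (F t v) \<and> convex (F t v)"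
    and F1: "\<forall>v. measurable_multifun {0..T} (\<lambda>t. F t v)"
    and F2: "AE t in lebesgue. t \<in> {0..T} \<longrightarrow> usc_weak (F t)"
    and F3_int: "set_integrable lebesgue {0..T} c" "set_integrable lebesgue {0..T} d"
    and F3_nonneg: "\<forall>t\<in>{0..T}. c t \<ge> 0 \<and> d t \<ge> 0"
    and F3: "AE t in lebesgue. t \<in> {0..T} \<longrightarrow>
               (\<forall>v. Inf (norm ` F t v) \<le> c t * norm v + d t)"
    and F5_int: "set_integrable lebesgue {0..T} k"
    and F5: "AE t in lebesgue. t \<in> {0..T} \<longrightarrow>
               (\<forall>x1 x2 v1 v2. v1 \<in> F t x1 \<longrightarrow> v2 \<in> F t x2 \<longrightarrow>
                  inner (v1 - v2) (x1 - x2) \<le> k t * (norm (x1 - x2))\<^sup>2)"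
    and g1: "\<forall>v. (\<lambda>(t, s). g t s v) \<in> borel_measurable (restrict_space lebesgue ({0..T} \<times> {0..T}))"
    and g2: "\<forall>r>0. \<exists>\<mu>. set_integrable lebesgue {0..T} \<mu> \<and> (\<forall>t\<in>{0..T}. \<mu> t \<ge> 0) \<and>
               (\<forall>(t, s)\<in>D. \<forall>x\<in>cball 0 r. \<forall>y\<in>cball 0 r.
                  norm (g t s x - g t s y) \<le> \<mu> t * norm (x - y))"
    and g3_int: "set_integrable lebesgue D (\<lambda>(t, s). \<sigma> t s)"
    and g3_nonneg: "\<forall>(t, s)\<in>D. \<sigma> t s \<ge> 0"
    and g3: "\<forall>(t, s)\<in>D. \<forall>x. norm (g t s x) \<le> \<sigma> t s * (1 + norm x)"
  shows "\<exists>x. is_solution T F g x0 x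
            \<and> (\<forall>y. is_solution T F g x0 y \<longrightarrow> (\<forall>t\<in>{0..T}. y t = x t))
            \<and> (\<forall>t\<in>{0..T}. norm (x t) \<le> r_fun c d \<sigma> (norm x0) t)
            \<and> (AE t in lebesgue. t \<in> {0..T} \<longrightarrow>
                 norm (vector_derivative x (at t within {0..T})) \<le> psi_fun c d \<sigma> (norm x0) t)"
proof -
  define G where "G t s v = to_copy (g t s (of_copy v))" for t s and v :: "'a hilbert_copy"
  define \<Phi> where "\<Phi> t v = to_copy ` F t (of_copy v)" for t and v :: "'a hilbert_copy"
  have D: "D = triangle T" by (simp add: D_def triangle_def)
  have to_borel: "to_copy \<in> borel_measurable borel"
    by (rule borel_measurable_continuous_onI[OF continuous_to_copy])
  \<comment> \<open>All hypotheses move to the copy; \<open>r\<close> and \<psi> stay the same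
    because they depend on \<open>x0\<close> only through its norm.\<close>
  interpret integro_inclusion T G \<sigma> "to_copy x0" \<Phi> c d k
  proof
    fix v :: "'a hilbert_copy"
    show "(\<lambda>(t, s). G t s v) \<in> borel_measurable (restrict_space lebesgue ({0..T} \<times> {0..T}))"
      using measurable_compose[OF g1[THEN spec, of "of_copy v"] to_borel] by (simp add: G_def case_prod_unfold)
    show "measurable_multifun {0..T} (\<lambda>t. \<Phi> t v)"
      unfolding measurable_multifun_def
    proof (intro allI impI)
      fix U :: "'a hilbert_copy set" assume "open U"
      then have "{t \<in> {0..T}. F t (of_copy v) \<inter> of_copy ` U \<noteq> {}} \<in> sets lebesgue"
        using F1 open_of_copy_image unfolding measurable_multifun_def by blast
      moreover have "\<Phi> t v \<inter> U \<noteq> {} \<longleftrightarrow> F t (of_copy v) \<inter> of_copy ` U \<noteq> {}" for t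
        unfolding \<Phi>_def of_copy_image by blast
      ultimately show "{t \<in> {0..T}. \<Phi> t v \<inter> U \<noteq> {}} \<in> sets lebesgue" by simp
    qed
  next
    fix t and v :: "'a hilbert_copy" assume t: "t \<in> {0..T}"
    have "convex (to_copy ` F t (of_copy v))"
      using F_values t by (intro convex_linear_image bounded_linear.linear[OF bounded_linear_to_copy]) blast
    moreover have "closed (to_copy ` F t (of_copy v))"
      unfolding to_copy_image using F_values t by (intro closed_vimage continuous_of_copy) blast
    ultimately show "\<Phi> t v \<noteq> {} \<and> closed (\<Phi> t v) \<and> convex (\<Phi> t v)" using F_values t by (simp add: \<Phi>_def)
  next
    fix \<rho> :: real assume "\<rho> > 0"
    then obtain \<mu> where \<mu>: "set_integrable lebesgue {0..T} \<mu>" "\<forall>t\<in>{0..T}. \<mu> t \<ge> 0"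
      "\<forall>(t, s)\<in>D. \<forall>x\<in>cball 0 \<rho>. \<forall>y\<in>cball 0 \<rho>. norm (g t s x - g t s y) \<le> \<mu> t * norm (x - y)" using g2 by blast
    have "norm (G t s x - G t s y) \<le> \<mu> t * norm (x - y)" if "(t, s) \<in> triangle T" "x \<in> cball 0 \<rho>" "y \<in> cball 0 \<rho>" for t s x y
    proof -
      have "norm (g t s (of_copy x) - g t s (of_copy y)) \<le> \<mu> t * norm (of_copy x - of_copy y)"
        using \<mu>(3) that unfolding D by fastforce
      then show ?thesis by (simp add: G_def flip: linear_to_copy(2) linear_of_copy(2))
    qed
    then show "\<exists>\<mu>. set_integrable lebesgue {0..T} \<mu> \<and> (\<forall>t\<in>{0..T}. \<mu> t \<ge> 0) \<and>
        (\<forall>(t, s)\<in>triangle T. \<forall>x\<in>cball 0 \<rho>. \<forall>y\<in>cball 0 \<rho>. norm (G t s x - G t s y) \<le> \<mu> t * norm (x - y))"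
      using \<mu>(1,2) by (intro exI[of _ \<mu>]) auto
  next
    show "set_integrable lebesgue (triangle T) (\<lambda>(t, s). \<sigma> t s)" using g3_int by (simp add: D)
  next
    fix t s assume "(t, s) \<in> triangle T"
    then show "0 \<le> \<sigma> t s" using g3_nonneg by (auto simp: D)
  next
    fix t s and x :: "'a hilbert_copy" assume "(t, s) \<in> triangle T"
    then have "norm (g t s (of_copy x)) \<le> \<sigma> t s * (1 + norm (of_copy x))" using g3 unfolding D by blast
    then show "norm (G t s x) \<le> \<sigma> t s * (1 + norm x)" by (simp add: G_def)
  next
    show "AE t in lebesgue. t \<in> {0..T} \<longrightarrow> usc_weak (\<Phi> t)"
      using F2 by eventually_elim (auto simp: \<Phi>_def[abs_def] intro: usc_weak_to_copy)
  next
    have eq: "norm ` \<Phi> t v = norm ` F t (of_copy v)" for t v unfolding \<Phi>_def image_image by simp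
    show "AE t in lebesgue. t \<in> {0..T} \<longrightarrow> (\<forall>v. Inf (norm ` \<Phi> t v) \<le> c t * norm v + d t)"
      using F3
    proof eventually_elim
      case (elim t)
      show ?case
      proof (intro impI allI)
        fix v :: "'a hilbert_copy" assume "t \<in> {0..T}"
        then have "Inf (norm ` F t (of_copy v)) \<le> c t * norm (of_copy v) + d t" using elim by blast
        then show "Inf (norm ` \<Phi> t v) \<le> c t * norm v + d t" by (simp add: eq)
      qed
    qed
  next
    show "AE t in lebesgue. t \<in> {0..T} \<longrightarrow> (\<forall>x1 x2 v1 v2. v1 \<in> \<Phi> t x1 \<longrightarrow> v2 \<in> \<Phi> t x2 \<longrightarrow>
        inner (v1 - v2) (x1 - x2) \<le> k t * (norm (x1 - x2))\<^sup>2)"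
      using F5
    proof eventually_elim
      case (elim t)
      show ?case
      proof (intro impI allI)
        fix x1 x2 v1 v2 assume "t \<in> {0..T}" "v1 \<in> \<Phi> t x1" "v2 \<in> \<Phi> t x2"
        then have "inner (of_copy v1 - of_copy v2) (of_copy x1 - of_copy x2) \<le> k t * (norm (of_copy x1 - of_copy x2))\<^sup>2"
          using elim unfolding \<Phi>_def to_copy_image by blast
        then show "inner (v1 - v2) (x1 - x2) \<le> k t * (norm (x1 - x2))\<^sup>2"
          by (simp add: inner_hilbert_copy_def linear_of_copy flip: linear_of_copy(2))
      qed
    qed
  qed (use T_pos F3_int F3_nonneg F5_int in auto)
  have sol: "is_solution T \<Phi> G (to_copy x0) (\<lambda>t. to_copy (z t)) \<longleftrightarrow> is_solution T F g x0 z" for z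
    using is_solution_to_copy[of T F g x0 z] by (simp only: \<Phi>_def[abs_def] G_def[abs_def])
  obtain X where X: "is_solution T \<Phi> G (to_copy x0) X" "\<forall>t\<in>{0..T}. norm (X t) \<le> r t"
    "AE t in lebesgue. t \<in> {0..T} \<longrightarrow> norm (vector_derivative X (at t within {0..T})) \<le> \<psi> t"
    using solution_exists by blast
  define x where "x t = of_copy (X t)" for t
  have x: "is_solution T F g x0 x" using X(1) by (simp add: x_def flip: sol)
  \<comment> \<open>\<open>vector_derivative\<close> is a choice operator, so differentiability
    almost everywhere is extracted first; only there do the chosen values for \<open>X\<close> and
    \<open>x\<close> correspond.\<close>
  have "AE t in lebesgue. t \<in> {0..T} \<longrightarrow> (\<exists>v. (X has_vector_derivative v) (at t within {0..T}))"
    using X(1)[unfolded is_solution_def, THEN conjunct2, THEN conjunct2] by eventually_elim blast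
  then have deriv: "AE t in lebesgue. t \<in> {0..T} \<longrightarrow> norm (vector_derivative x (at t within {0..T})) \<le> psi_fun c d \<sigma> (norm x0) t"
    using X(3)
  proof eventually_elim
    case (elim t)
    show ?case
    proof
      assume t: "t \<in> {0..T}"
      then obtain v where v: "(X has_vector_derivative v) (at t within {0..T})" using elim(1) by blast
      have xv: "(x has_vector_derivative of_copy v) (at t within {0..T})"
        unfolding x_def by (rule bounded_linear.has_vector_derivative[OF bounded_linear_of_copy v])
      have "vector_derivative X (at t within {0..T}) = v"
        using vector_derivative_within_cbox[OF T_pos, of t X v] v t by simp
      moreover have "vector_derivative x (at t within {0..T}) = of_copy v"
        using vector_derivative_within_cbox[OF T_pos, of t x "of_copy v"] xv t by simp
      ultimately show "norm (vector_derivative x (at t within {0..T})) \<le> psi_fun c d \<sigma> (norm x0) t"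
        using elim(2) t by (simp add: \<psi>_def)
    qed
  qed
  have uniq: "y t = x t" if y: "is_solution T F g x0 y" and t: "t \<in> {0..T}" for y t
  proof -
    have "to_copy (y t) = X t"
      by (rule solution_unique[OF _ X(1) t]) (use y sol in blast)
    then show ?thesis unfolding x_def by (metis of_to_copy)
  qed
  have bound: "norm (x t) \<le> r_fun c d \<sigma> (norm x0) t" if "t \<in> {0..T}" for t
    using X(2) that by (simp add: x_def r_def)
  show ?thesis using x uniq bound deriv by blast
qed

end
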